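(* Let $\Gamma$ be a finite abelian group, $\sigma$ a unitary bicharacter on $\Gamma$ and $S\subseteq\Gamma$. The twisted quantum Cayley graph $\breve{\mathrm{Cay}}(\Gamma,S)$ is quantum isomorphic to the classical Cayley graph $\mathrm{Cay}(\Gamma,S)$. Its quantum automorphism group is the 2-cocycle twist $\breve G$ of the quantum automorphism group $G$ of the classical Cayley graph $\mathrm{Cay}(\Gamma,S)$.
   Context: **Finite quantum sets and quantum graphs.** A finite quantum set $X$ is a finite-dimensional C*-algebra $C(X)\cong\bigoplus_i M_{n_i}(\mathbb{C})$ with the functional (counit) $\eta^\dag(x)=\sum_i n_i\mathrm{Tr}(x_i)$. $l^2(X)$ is $C(X)$ with inner product $\langle a,b\rangle=\eta^\dag(a^*b)$; $m$ is the multiplication, $\eta$ the unit map, $\dag$ denotes Hilbert space adjoints; $mm^\dag=\mathrm{id}$. Put $R^\dag=\eta^\dag m$. A quantum graph on $X$ is an orthogonal projection $\tilde A\in C(X)\otimes C(X)^{\rm op}$, or equivalently its adjacency matrix $A=(\mathrm{id}\otimes R^\dag)(\tilde A\otimes\mathrm{id})\colon l^2(X)\to l^2(X)$. **Quantum automorphism groups.** Let $(e_i)_{i=1}^N$ be an orthonormal basis of $l^2(X)$ and $F$ the matrix with $e_i^*=\sum_jF_i^je_j$. $\mathrm{Aut}^+X$ is the compact matrix quantum group given by the universal unital $*$-algebra $\mathscr{O}(\mathrm{Aut}^+X)$ generated by $u^i_j$, $i,j=1,\dots,N$, with relations: $u=(u^i_j)$ is unitary, $uF=F\bar u$, $m(u\otimes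 u)=um$, $Au=uA$ (where $[\bar u]^i_j=u^{i*}_j$), with comultiplication $\Delta(u^i_j)=\sum_ku^i_k\otimes u^k_j$. For a compact matrix quantum group $G$ with fundamental representation $u$ of size $N$, let $\mathfrak{C}_G(k,l)=\{T\colon(\mathbb{C}^N)^{\otimes k}\to(\mathbb{C}^N)^{\otimes l}\mid Tu^{\otimes k}=u^{\otimes l}T\}$; this is a rigid monoidal $\dag$-category with objects $\mathbb{N}_0$, which determines $G$ uniquely (Woronowicz–Tannaka–Krein). **Quantum isomorphism.** Quantum graphs $X_1,X_2$ with $G_i=\mathrm{Aut}^+X_i$ are quantum isomorphic if there is a monoidal equivalence $\mathrm{Rep}\,G_1\to\mathrm{Rep}\,G_2$ mapping the fundamental representation $u_1\mapsto u_2$ and $A_1\mapsto A_2$; equivalently, a monoidal $\dag$-category isomorphism $\mathfrak{C}_{G_1}\to\mathfrak{C}_{G_2}$ (identity on objects) mapping $A_1\mapsto A_2$ (and, as understood, $m_1\mapsto m_2$, $\eta_1\mapsto\eta_2$). **Cayley graphs.** $\Gamma$ is written additively, $N=|\Gamma|$. Fix characters $\tau_\mu\colon\Gamma\to\mathbb{C}$, $\mu\in\Gamma$, listing all irreducible characters with $\tau_\mu\tau_\nu=\tau_{\mu+\nu}$. $\mathrm{Cay}(\Gamma,S)$ is the directed graph on $\Gamma$ with an edge $(\alpha,\alpha+\theta)$ for $\alpha\in\Gamma$, $\theta\in S$; its adjacency matrix is $[A]^\beta_\alpha=1$ if $\beta-\alpha\in S$ and $0$ otherwise, regarded as a quantum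 graph with $C(X)=C(\Gamma)$. Then $A\tau_\mu=\lambda_\mu\tau_\mu$ with $\lambda_\mu=\sum_{\theta\in S}\tau_\mu(-\theta)$. **Twisted Cayley graph.** A unitary bicharacter is a map $\sigma\colon\Gamma\times\Gamma\to\mathbb{T}$ that is a homomorphism in each variable; write $\sigma_{\mu\nu}=\sigma(\mu,\nu)$. The quantum space $\breve\Gamma$ is given by the C*-algebra $C(\breve\Gamma)$ with linear basis of unitaries $\breve\tau_\mu$, $\mu\in\Gamma$, with $\breve\tau_0=1$ and $\breve\tau_\mu\breve\tau_\nu=\bar\sigma_{\mu\nu}\breve\tau_{\mu+\nu}$, with counit $\breve\eta^\dag(\breve\tau_\mu)=N\delta_{\mu,0}$. $\breve{\mathrm{Cay}}(\Gamma,S)$ is the quantum graph on $\breve\Gamma$ with adjacency operator $\breve A\breve\tau_\mu=\lambda_\mu\breve\tau_\mu$. **The twist $\breve G$.** Let $G=\mathrm{Aut}^+\mathrm{Cay}(\Gamma,S)$ with fundamental representation $u$ in the standard basis $(\delta_\alpha)_{\alpha\in\Gamma}$. Let $\mathcal{F}^\alpha_\mu=\tau_\mu(\alpha)$ and $\hat G=\mathcal{F}^{-1}G\mathcal{F}$, i.e. the same quantum group with fundamental representation $\hat u=\mathcal{F}^{-1}u\mathcal{F}$, indexed by $\Gamma$. For a multiindex $\mathbf{i}=(i_1,\dots,i_k)\in\Gamma^k$ put $\sigma_{\mathbf i}=\prod_{1\le a<b\le k}\sigma(i_a,i_b)$. For $T\in\mathfrak{C}_{\hat G}(k,l)$ with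 entries $T^{\mathbf i}_{\mathbf j}$ (upper multiindex for output, lower for input), put $\breve T^{\mathbf i}_{\mathbf j}=\sigma_{\mathbf i}\bar\sigma_{\mathbf j}T^{\mathbf i}_{\mathbf j}$. The spaces $\{\breve T\mid T\in\mathfrak{C}_{\hat G}(k,l)\}$ form a rigid monoidal $\dag$-category, and $\breve G$ is the unique compact matrix quantum group with $\mathfrak{C}_{\breve G}(k,l)=\{\breve T\mid T\in\mathfrak{C}_{\hat G}(k,l)\}$. The quantum automorphism group of $\breve{\mathrm{Cay}}(\Gamma,S)$ is expressed with respect to the (suitably normalized) basis $(\breve\tau_\mu)$. *)

theory Defs
  imports "HOL-Analysis.Analysis" "HOL-Library.Poly_Mapping"
begin

section \<open>Finite quantum sets and quantum graphs\<close>

text \<open>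
  A finite-dimensional algebra is put on the vector space \<open>\<complex>\<^sup>N\<close>, with an arbitrary finite index type
  \<open>'i\<close> of cardinality \<open>N\<close>. The coordinates of \<open>complex ^ 'i\<close> are merely linear coordinates; they
  need not be orthonormal for the inner product of \<open>l\<^sup>2(X)\<close>.
\<close>

record ('i::finite) quantum_set =
  qmult :: "complex ^ 'i \<Rightarrow> complex ^ 'i \<Rightarrow> complex ^ 'i"
  qone :: "complex ^ 'i"
  qstar :: "complex ^ 'i \<Rightarrow> complex ^ 'i"
  counit :: "complex ^ 'i \<Rightarrow> complex"

text \<open>
  The C*-norm is automatically complete. In an algebra \<open>\<Oplus>\<^sub>i M\<^bsub>n\<^sub>i\<^esub>(\<complex>)\<close> the left regular representation
  contains the defining representation of the \<open>i\<close>-th block \<open>n\<^sub>i\<close> times, so the canonical functional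
  \<open>\<Sum>\<^sub>i n\<^sub>i Tr(x\<^sub>i)\<close> is the trace of the left multiplication by \<open>x\<close>; stating it so avoids fixing
  an isomorphism with a direct sum of matrix algebras.
\<close>

locale finite_quantum_set =
  fixes X :: "('i::finite, 'z) quantum_set_scheme"
  assumes add_left: "qmult X (x + y) z = qmult X x z + qmult X y z"
    and add_right: "qmult X x (y + z) = qmult X x y + qmult X x z"
    and scale_left: "qmult X (c *s x) y = c *s qmult X x y"
    and scale_right: "qmult X x (c *s y) = c *s qmult X x y"
    and assoc: "qmult X (qmult X x y) z = qmult X x (qmult X y z)"
    and one_left: "qmult X (qone X) x = x"
    and one_right: "qmult X x (qone X) = x"
    and star_add: "qstar X (x + y) = qstar X x + qstar X y"
    and star_scale: "qstar X (c *s x) = cnj c *s qstar X x"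
    and star_mult: "qstar X (qmult X x y) = qmult X (qstar X y) (qstar X x)"
    and star_star: "qstar X (qstar X x) = x"
    and cstar_norm: "\<exists>\<nu> :: complex ^ 'i \<Rightarrow> real.
          (\<forall>x. 0 \<le> \<nu> x \<and> (\<nu> x = 0 \<longleftrightarrow> x = 0)) \<and>
          (\<forall>x y. \<nu> (x + y) \<le> \<nu> x + \<nu> y) \<and>
          (\<forall>c x. \<nu> (c *s x) = cmod c * \<nu> x) \<and>
          (\<forall>x y. \<nu> (qmult X x y) \<le> \<nu> x * \<nu> y) \<and>
          (\<forall>x. \<nu> (qmult X (qstar X x) x) = (\<nu> x)\<^sup>2)"
    and counit_trace: "counit X x = (\<Sum>i\<in>UNIV. qmult X x (axis i 1) $ i)"

definition qinner :: "('i::finite, 'z) quantum_set_scheme \<Rightarrow> complex ^ 'i \<Rightarrow> complex ^ 'i \<Rightarrow> complex"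
  where "qinner X a b = counit X (qmult X (qstar X a) b)"

text \<open>
  A quantum graph comes with its adjacency operator and with the orthonormal basis of \<open>l\<^sup>2(X)\<close> with
  respect to which its quantum automorphism group is written.
\<close>

record ('i::finite) quantum_graph = "'i quantum_set" +
  adj :: "complex ^ 'i \<Rightarrow> complex ^ 'i"
  onb :: "'i \<Rightarrow> complex ^ 'i"

text \<open>
  An element \<open>\<Sum>\<^sub>a\<^sub>b P\<^sub>a\<^sub>b (\<epsilon>\<^sub>a \<otimes> \<epsilon>\<^sub>b)\<close> of \<open>C(X) \<otimes> C(X)\<^sup>o\<^sup>p\<close> is given by its coefficient matrix, where
  \<open>\<epsilon>\<^sub>a = axis a 1\<close>.
\<close>

definition op_tensor_mult ::
    "('i::finite, 'z) quantum_set_scheme \<Rightarrow> complex ^ 'i ^ 'i \<Rightarrow> complex ^ 'i ^ 'i \<Rightarrow> complex ^ 'i ^ 'i"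
  where "op_tensor_mult X P Q =
    (\<chi> r s. \<Sum>a\<in>UNIV. \<Sum>b\<in>UNIV. \<Sum>c\<in>UNIV. \<Sum>d\<in>UNIV.
       P $ a $ b * Q $ c $ d * (qmult X (axis a 1) (axis c 1) $ r) * (qmult X (axis d 1) (axis b 1) $ s))"

definition op_tensor_star ::
    "('i::finite, 'z) quantum_set_scheme \<Rightarrow> complex ^ 'i ^ 'i \<Rightarrow> complex ^ 'i ^ 'i"
  where "op_tensor_star X P =
    (\<chi> r s. \<Sum>a\<in>UNIV. \<Sum>b\<in>UNIV. cnj (P $ a $ b) * (qstar X (axis a 1) $ r) * (qstar X (axis b 1) $ s))"

text \<open>The operator \<open>(id \<otimes> R\<^sup>\<dagger>)(P \<otimes> id)\<close>, where \<open>R\<^sup>\<dagger>(b \<otimes> x) = \<eta>\<^sup>\<dagger>(b x)\<close>.\<close>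

definition adjacency_of ::
    "('i::finite, 'z) quantum_set_scheme \<Rightarrow> complex ^ 'i ^ 'i \<Rightarrow> complex ^ 'i \<Rightarrow> complex ^ 'i"
  where "adjacency_of X P x =
    (\<Sum>a\<in>UNIV. \<Sum>b\<in>UNIV. (P $ a $ b * counit X (qmult X (axis b 1) x)) *s axis a 1)"

definition is_quantum_graph :: "('i::finite, 'z) quantum_graph_scheme \<Rightarrow> bool"
  where "is_quantum_graph X \<longleftrightarrow>
    finite_quantum_set X \<and>
    (\<forall>i j. qinner X (onb X i) (onb X j) = (if i = j then 1 else 0)) \<and>
    (\<exists>P. op_tensor_mult X P P = P \<and> op_tensor_star X P = P \<and> adj X = adjacency_of X P)"


section \<open>Matrices between tensor powers\<close>

text \<open>
  A linear map \<open>(\<complex>\<^sup>N)\<^sup>\<otimes>\<^sup>k \<rightarrow> (\<complex>\<^sup>N)\<^sup>\<otimes>\<^sup>l\<close> is a function \<open>T\<close> of two multiindices, \<open>T i j\<close> having output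
  multiindex \<open>i\<close> of length \<open>l\<close> and input multiindex \<open>j\<close> of length \<open>k\<close>; all other values are \<open>0\<close>.
\<close>

type_synonym 'i tmat = "'i list \<Rightarrow> 'i list \<Rightarrow> complex"

definition tmats :: "nat \<Rightarrow> nat \<Rightarrow> 'i tmat set"
  where "tmats k l = {T. \<forall>i j. T i j \<noteq> 0 \<longrightarrow> length i = l \<and> length j = k}"

definition tm_id :: "nat \<Rightarrow> 'i tmat"
  where "tm_id k = (\<lambda>i j. if i = j \<and> length i = k then 1 else 0)"

text \<open>The argument \<open>m\<close> is the intermediate tensor power.\<close>

definition tm_comp :: "nat \<Rightarrow> 'i::finite tmat \<Rightarrow> 'i tmat \<Rightarrow> 'i tmat"
  where "tm_comp m T R = (\<lambda>i j. \<Sum>p | length p = m. T i p * R p j)"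

text \<open>Tensor product with left factor \<open>T \<in> tmats k l\<close>.\<close>

definition tm_tensor :: "nat \<Rightarrow> nat \<Rightarrow> 'i tmat \<Rightarrow> 'i tmat \<Rightarrow> 'i tmat"
  where "tm_tensor k l T R = (\<lambda>i j. T (take l i) (take k j) * R (drop l i) (drop k j))"

definition tm_dagger :: "'i tmat \<Rightarrow> 'i tmat"
  where "tm_dagger T = (\<lambda>i j. cnj (T j i))"

text \<open>
  The structure maps of a quantum graph in the chosen orthonormal basis. The coordinates of \<open>v\<close> are
  \<open>\<langle>e\<^sub>i, v\<rangle>\<close>; in \<open>star_matrix\<close>, the row \<open>i\<close> and column \<open>j\<close> entry is the coefficient of \<open>e\<^sub>i\<close> in \<open>e\<^sub>j\<^sup>*\<close>.
\<close>

definition onb_coord :: "('i::finite, 'z) quantum_graph_scheme \<Rightarrow> 'i \<Rightarrow> complex ^ 'i \<Rightarrow> complex"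
  where "onb_coord X i v = qinner X (onb X i) v"

definition mult_tmat :: "('i::finite, 'z) quantum_graph_scheme \<Rightarrow> 'i tmat"
  where "mult_tmat X = (\<lambda>i j. case (i, j) of
      ([c], [a, b]) \<Rightarrow> onb_coord X c (qmult X (onb X a) (onb X b)) | _ \<Rightarrow> 0)"

definition unit_tmat :: "('i::finite, 'z) quantum_graph_scheme \<Rightarrow> 'i tmat"
  where "unit_tmat X = (\<lambda>i j. case (i, j) of ([c], []) \<Rightarrow> onb_coord X c (qone X) | _ \<Rightarrow> 0)"

definition adj_tmat :: "('i::finite, 'z) quantum_graph_scheme \<Rightarrow> 'i tmat"
  where "adj_tmat X = (\<lambda>i j. case (i, j) of ([c], [a]) \<Rightarrow> onb_coord X c (adj X (onb X a)) | _ \<Rightarrow> 0)"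

definition star_matrix :: "('i::finite, 'z) quantum_graph_scheme \<Rightarrow> 'i \<Rightarrow> 'i \<Rightarrow> complex"
  where "star_matrix X i j = onb_coord X i (qstar X (onb X j))"


section \<open>The free unital *-algebra on the entries of a matrix\<close>

text \<open>\<open>Gen i j\<close> is the letter for \<open>u\<^sup>i\<^sub>j\<close> (row \<open>i\<close>, column \<open>j\<close>), \<open>Gen_star i j\<close> the letter for \<open>(u\<^sup>i\<^sub>j)\<^sup>*\<close>.\<close>

datatype 'i gen = Gen 'i 'i | Gen_star 'i 'i

datatype 'x word = Word (letters: "'x list")

instantiation word :: (type) monoid_add
begin

definition zero_word :: "'a word" where "zero_word = Word []"

definition plus_word :: "'a word \<Rightarrow> 'a word \<Rightarrow> 'a word"
  where "plus_word v w = Word (letters v @ letters w)"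

instance
  by standard (auto simp: zero_word_def plus_word_def)

end

text \<open>
  The free algebra is the complex monoid algebra of the free monoid. Its tensor square is the monoid
  algebra of the product of two free monoids; the ring operations are those of \<open>\<Rightarrow>\<^sub>0\<close>.
\<close>

type_synonym 'i fsa = "'i gen word \<Rightarrow>\<^sub>0 complex"
type_synonym 'i fsa2 = "('i gen word \<times> 'i gen word) \<Rightarrow>\<^sub>0 complex"

definition scal :: "complex \<Rightarrow> ('k::monoid_add \<Rightarrow>\<^sub>0 complex)"
  where "scal c = Poly_Mapping.single 0 c"

definition fund :: "'i \<Rightarrow> 'i \<Rightarrow> 'i fsa"
  where "fund i j = Poly_Mapping.single (Word [Gen i j]) 1"

definition fund_st :: "'i \<Rightarrow> 'i \<Rightarrow> 'i fsa"
  where "fund_st i j = Poly_Mapping.single (Word [Gen_star i j]) 1"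

fun gen_flip :: "'i gen \<Rightarrow> 'i gen"
  where "gen_flip (Gen i j) = Gen_star i j"
  | "gen_flip (Gen_star i j) = Gen i j"

definition fsa_star :: "'i fsa \<Rightarrow> 'i fsa"
  where "fsa_star p = (\<Sum>w\<in>Poly_Mapping.keys p.
    Poly_Mapping.single (Word (rev (map gen_flip (letters w)))) (cnj (Poly_Mapping.lookup p w)))"

text \<open>
  The unital algebra homomorphism into a ring with scalar embedding \<open>emb\<close> that extends a map \<open>f\<close> on
  letters.
\<close>

definition alg_ext :: "(complex \<Rightarrow> 'r::ring_1) \<Rightarrow> ('i gen \<Rightarrow> 'r) \<Rightarrow> 'i fsa \<Rightarrow> 'r"
  where "alg_ext emb f p = (\<Sum>w\<in>Poly_Mapping.keys p.
    emb (Poly_Mapping.lookup p w) * prod_list (map f (letters w)))"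

definition star_ideal :: "'i fsa set \<Rightarrow> bool"
  where "star_ideal I \<longleftrightarrow>
    0 \<in> I \<and> (\<forall>p\<in>I. \<forall>q\<in>I. p + q \<in> I) \<and> (\<forall>p\<in>I. \<forall>q. q * p \<in> I \<and> p * q \<in> I) \<and>
    (\<forall>p\<in>I. fsa_star p \<in> I)"

definition star_ideal_generated :: "'i fsa set \<Rightarrow> 'i fsa set"
  where "star_ideal_generated R = \<Inter>{I. star_ideal I \<and> R \<subseteq> I}"


section \<open>Compact matrix quantum groups\<close>

text \<open>
  Since the entries of the fundamental representation \<open>u\<close> generate the *-algebra \<open>\<O>(G)\<close>, a compact
  matrix quantum group \<open>G\<close> is represented by the kernel \<open>I\<close> of the canonical surjection from the free
  *-algebra onto \<open>\<O>(G)\<close>. Thus \<open>\<O>(G)\<close> is the quotient by \<open>I\<close>, an identity in \<open>\<O>(G)\<close> is a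
  membership in \<open>I\<close>, and two compact matrix quantum groups are identified (by a *-isomorphism matching
  the fundamental representations entrywise) iff their ideals are equal.
\<close>

definition unitary_modulo :: "'i fsa set \<Rightarrow> ('i::finite \<Rightarrow> 'i \<Rightarrow> 'i fsa) \<Rightarrow> bool"
  where "unitary_modulo I w \<longleftrightarrow>
    (\<forall>i j. (\<Sum>k\<in>UNIV. w i k * fsa_star (w j k)) - scal (if i = j then 1 else 0) \<in> I) \<and>
    (\<forall>i j. (\<Sum>k\<in>UNIV. fsa_star (w k i) * w k j) - scal (if i = j then 1 else 0) \<in> I)"

definition pure_tensor :: "'i fsa \<Rightarrow> 'i fsa \<Rightarrow> 'i fsa2"
  where "pure_tensor p q = (\<Sum>v\<in>Poly_Mapping.keys p. \<Sum>w\<in>Poly_Mapping.keys q.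
    Poly_Mapping.single (v, w) (Poly_Mapping.lookup p v * Poly_Mapping.lookup q w))"

text \<open>\<open>I \<otimes> F + F \<otimes> I\<close>, the kernel of \<open>F \<otimes> F \<rightarrow> F/I \<otimes> F/I\<close> for the free *-algebra \<open>F\<close>.\<close>

definition tensor_kernel :: "'i fsa set \<Rightarrow> 'i fsa2 set"
  where "tensor_kernel I =
    {sum_list (map (\<lambda>(p, q). pure_tensor p q) xs) | xs. \<forall>(p, q)\<in>set xs. p \<in> I \<or> q \<in> I}"

definition comult :: "'i::finite fsa \<Rightarrow> 'i fsa2"
  where "comult = alg_ext scal (\<lambda>g. case g of
      Gen i j \<Rightarrow> \<Sum>k\<in>UNIV. pure_tensor (fund i k) (fund k j)
    | Gen_star i j \<Rightarrow> \<Sum>k\<in>UNIV. pure_tensor (fund_st i k) (fund_st k j))"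

definition hopf_counit :: "'i fsa \<Rightarrow> complex"
  where "hopf_counit = alg_ext (\<lambda>c. c) (\<lambda>g. case g of
      Gen i j \<Rightarrow> if i = j then 1 else 0 | Gen_star i j \<Rightarrow> if i = j then 1 else 0)"

text \<open>
  The quotient by \<open>I\<close> is a Hopf *-algebra with \<open>\<Delta>(u\<^sup>i\<^sub>j) = \<Sum>\<^sub>k u\<^sup>i\<^sub>k \<otimes> u\<^sup>k\<^sub>j\<close>, the matrix \<open>u\<close> is unitary and
  its transpose is similar to a unitary matrix. The antipode is given on the free algebra by a linear
  antimultiplicative lift \<open>A\<close> that descends to the quotient; its axioms are needed on generators only.
\<close>

definition is_cmqg :: "'i::finite fsa set \<Rightarrow> bool"
  where "is_cmqg I \<longleftrightarrow>
    star_ideal I \<and>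
    unitary_modulo I fund \<and>
    (\<exists>T T' :: complex ^ 'i ^ 'i. T ** T' = mat 1 \<and> T' ** T = mat 1 \<and>
       unitary_modulo I (\<lambda>i j. \<Sum>a\<in>UNIV. \<Sum>b\<in>UNIV. scal (T $ i $ a * T' $ b $ j) * fund b a)) \<and>
    comult ` I \<subseteq> tensor_kernel I \<and>
    (\<forall>p\<in>I. hopf_counit p = 0) \<and>
    (\<exists>A :: 'i fsa \<Rightarrow> 'i fsa.
       (\<forall>p q. A (p + q) = A p + A q) \<and> (\<forall>c p. A (scal c * p) = scal c * A p) \<and>
       A 1 = 1 \<and> (\<forall>p q. A (p * q) = A q * A p) \<and> A ` I \<subseteq> I \<and>
       (\<forall>i j. (\<Sum>k\<in>UNIV. A (fund i k) * fund k j) - scal (if i = j then 1 else 0) \<in> I) \<and>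
       (\<forall>i j. (\<Sum>k\<in>UNIV. fund i k * A (fund k j)) - scal (if i = j then 1 else 0) \<in> I) \<and>
       (\<forall>i j. (\<Sum>k\<in>UNIV. A (fund_st i k) * fund_st k j) - scal (if i = j then 1 else 0) \<in> I) \<and>
       (\<forall>i j. (\<Sum>k\<in>UNIV. fund_st i k * A (fund_st k j)) - scal (if i = j then 1 else 0) \<in> I))"

text \<open>The entry of \<open>u\<^sup>\<otimes>\<^sup>k\<close> at multiindices of length \<open>k\<close>.\<close>

definition fund_power :: "'i list \<Rightarrow> 'i list \<Rightarrow> 'i fsa"
  where "fund_power i j = prod_list (map2 fund i j)"

definition intertwiners :: "'i::finite fsa set \<Rightarrow> nat \<Rightarrow> nat \<Rightarrow> 'i tmat set"
  where "intertwiners I k l = {T \<in> tmats k l. \<forall>i j. length i = l \<longrightarrow> length j = k \<longrightarrow>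
    (\<Sum>p | length p = k. scal (T i p) * fund_power p j) -
    (\<Sum>q | length q = l. scal (T q j) * fund_power i q) \<in> I}"

text \<open>
  \<open>M\<^sup>-\<^sup>1 G M\<close>: the same *-algebra with fundamental representation \<open>v = M\<^sup>-\<^sup>1 u M\<close>. The new ideal consists
  of the *-polynomials that vanish at the entries of \<open>v\<close>.
\<close>

definition change_basis :: "complex ^ 'i ^ 'i \<Rightarrow> 'i::finite fsa set \<Rightarrow> 'i fsa set"
  where "change_basis M I = {p. alg_ext scal (\<lambda>g. case g of
      Gen i j \<Rightarrow> \<Sum>a\<in>UNIV. \<Sum>b\<in>UNIV. scal (matrix_inv M $ i $ a * M $ b $ j) * fund a b
    | Gen_star i j \<Rightarrow> \<Sum>a\<in>UNIV. \<Sum>b\<in>UNIV. scal (cnj (matrix_inv M $ i $ a * M $ b $ j)) * fund_st a b) p \<in> I}"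


section \<open>Quantum automorphism groups and quantum isomorphism\<close>

definition aut_relations :: "('i::finite, 'z) quantum_graph_scheme \<Rightarrow> 'i fsa set"
  where "aut_relations X =
    {(\<Sum>k\<in>UNIV. fund i k * fund_st j k) - scal (if i = j then 1 else 0) | i j. True} \<union>
    {(\<Sum>k\<in>UNIV. fund_st k i * fund k j) - scal (if i = j then 1 else 0) | i j. True} \<union>
    {(\<Sum>k\<in>UNIV. scal (star_matrix X k j) * fund i k) -
     (\<Sum>k\<in>UNIV. scal (star_matrix X i k) * fund_st k j) | i j. True} \<union>
    {(\<Sum>a\<in>UNIV. \<Sum>b\<in>UNIV. scal (mult_tmat X [i] [a, b]) * (fund a j * fund b k)) -
     (\<Sum>c\<in>UNIV. scal (mult_tmat X [c] [j, k]) * fund i c) | i j k. True} \<union>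
    {(\<Sum>k\<in>UNIV. scal (adj_tmat X [i] [k]) * fund k j) -
     (\<Sum>k\<in>UNIV. scal (adj_tmat X [k] [j]) * fund i k) | i j. True}"

definition quantum_aut :: "('i::finite, 'z) quantum_graph_scheme \<Rightarrow> 'i fsa set"
  where "quantum_aut X = star_ideal_generated (aut_relations X)"

text \<open>Isomorphisms of monoidal \<open>\<dagger>\<close>-categories with object set \<open>\<nat>\<close> that are the identity on objects.\<close>

definition monoidal_dagger_iso ::
    "'i::finite fsa set \<Rightarrow> 'j::finite fsa set \<Rightarrow> (nat \<Rightarrow> nat \<Rightarrow> 'i tmat \<Rightarrow> 'j tmat) \<Rightarrow> bool"
  where "monoidal_dagger_iso I J \<Phi> \<longleftrightarrow>
    (\<forall>k l. bij_betw (\<Phi> k l) (intertwiners I k l) (intertwiners J k l)) \<and>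
    (\<forall>k l c. \<forall>T\<in>intertwiners I k l. \<forall>R\<in>intertwiners I k l.
       \<Phi> k l (\<lambda>i j. c * T i j + R i j) = (\<lambda>i j. c * \<Phi> k l T i j + \<Phi> k l R i j)) \<and>
    (\<forall>k. \<Phi> k k (tm_id k) = tm_id k) \<and>
    (\<forall>k m l. \<forall>T\<in>intertwiners I m l. \<forall>R\<in>intertwiners I k m.
       \<Phi> k l (tm_comp m T R) = tm_comp m (\<Phi> m l T) (\<Phi> k m R)) \<and>
    (\<forall>k l k' l'. \<forall>T\<in>intertwiners I k l. \<forall>R\<in>intertwiners I k' l'.
       \<Phi> (k + k') (l + l') (tm_tensor k l T R) = tm_tensor k l (\<Phi> k l T) (\<Phi> k' l' R)) \<and>
    (\<forall>k l. \<forall>T\<in>intertwiners I k l. \<Phi> l k (tm_dagger T) = tm_dagger (\<Phi> k l T))"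

definition quantum_isomorphic ::
    "('i::finite, 'y) quantum_graph_scheme \<Rightarrow> ('j::finite, 'z) quantum_graph_scheme \<Rightarrow> bool"
  where "quantum_isomorphic X Y \<longleftrightarrow>
    is_quantum_graph X \<and> is_quantum_graph Y \<and>
    adj_tmat X \<in> intertwiners (quantum_aut X) 1 1 \<and>
    mult_tmat X \<in> intertwiners (quantum_aut X) 2 1 \<and>
    unit_tmat X \<in> intertwiners (quantum_aut X) 0 1 \<and>
    (\<exists>\<Phi>. monoidal_dagger_iso (quantum_aut X) (quantum_aut Y) \<Phi> \<and>
       \<Phi> 1 1 (adj_tmat X) = adj_tmat Y \<and>
       \<Phi> 2 1 (mult_tmat X) = mult_tmat Y \<and>
       \<Phi> 0 1 (unit_tmat X) = unit_tmat Y)"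


section \<open>Cayley graphs and their twists\<close>

definition is_character :: "('g::ab_group_add \<Rightarrow> complex) \<Rightarrow> bool"
  where "is_character f \<longleftrightarrow> f 0 = 1 \<and> (\<forall>\<alpha> \<beta>. f (\<alpha> + \<beta>) = f \<alpha> * f \<beta>)"

definition character_listing :: "('g::{finite, ab_group_add} \<Rightarrow> 'g \<Rightarrow> complex) \<Rightarrow> bool"
  where "character_listing \<tau> \<longleftrightarrow>
    bij_betw \<tau> UNIV {f. is_character f} \<and>
    (\<forall>\<mu> \<nu> \<alpha>. \<tau> \<mu> \<alpha> * \<tau> \<nu> \<alpha> = \<tau> (\<mu> + \<nu>) \<alpha>)"

definition unitary_bicharacter :: "('g::ab_group_add \<Rightarrow> 'g \<Rightarrow> complex) \<Rightarrow> bool"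
  where "unitary_bicharacter \<sigma> \<longleftrightarrow>
    (\<forall>\<mu> \<nu>. cmod (\<sigma> \<mu> \<nu>) = 1) \<and>
    (\<forall>\<mu> \<nu> \<rho>. \<sigma> (\<mu> + \<nu>) \<rho> = \<sigma> \<mu> \<rho> * \<sigma> \<nu> \<rho>) \<and>
    (\<forall>\<mu> \<nu> \<rho>. \<sigma> \<mu> (\<nu> + \<rho>) = \<sigma> \<mu> \<nu> * \<sigma> \<mu> \<rho>)"

text \<open>The algebra \<open>C(\<Gamma>)\<close> in the basis \<open>\<delta>\<^sub>\<alpha> = axis \<alpha> 1\<close>.\<close>

definition cayley :: "('g::{finite, ab_group_add}) set \<Rightarrow> 'g quantum_graph"
  where "cayley S = \<lparr>
    qmult = (\<lambda>x y. \<chi> \<alpha>. x $ \<alpha> * y $ \<alpha>),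
    qone = (\<chi> \<alpha>. 1),
    qstar = (\<lambda>x. \<chi> \<alpha>. cnj (x $ \<alpha>)),
    counit = (\<lambda>x. \<Sum>\<alpha>\<in>UNIV. x $ \<alpha>),
    adj = (\<lambda>x. \<chi> \<beta>. \<Sum>\<alpha>\<in>UNIV. (if \<beta> - \<alpha> \<in> S then 1 else 0) * x $ \<alpha>),
    onb = (\<lambda>\<alpha>. axis \<alpha> 1)\<rparr>"

definition cayley_eigenvalue ::
    "('g::{finite, ab_group_add} \<Rightarrow> 'g \<Rightarrow> complex) \<Rightarrow> 'g set \<Rightarrow> 'g \<Rightarrow> complex"
  where "cayley_eigenvalue \<tau> S \<mu> = (\<Sum>\<theta>\<in>S. \<tau> \<mu> (- \<theta>))"

text \<open>
  The twisted algebra in the linear basis of unitaries \<open>t\<^sub>\<mu> = axis \<mu> 1\<close>. Since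
  \<open>t\<^sub>\<mu> t\<^sub>-\<^sub>\<mu> = cnj (\<sigma> \<mu> (-\<mu>)) t\<^sub>0\<close>, unitarity of \<open>t\<^sub>\<mu>\<close> forces \<open>t\<^sub>\<mu>\<^sup>* = \<sigma> \<mu> (-\<mu>) t\<^sub>-\<^sub>\<mu>\<close>. As
  \<open>\<langle>t\<^sub>\<mu>, t\<^sub>\<nu>\<rangle> = N \<delta>\<^sub>\<mu>\<^sub>\<nu>\<close>, the orthonormal basis is \<open>t\<^sub>\<mu> / \<surd>N\<close>.
\<close>

definition twisted_cayley ::
    "('g::{finite, ab_group_add} \<Rightarrow> 'g \<Rightarrow> complex) \<Rightarrow> ('g \<Rightarrow> 'g \<Rightarrow> complex) \<Rightarrow> 'g set \<Rightarrow> 'g quantum_graph"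
  where "twisted_cayley \<tau> \<sigma> S = \<lparr>
    qmult = (\<lambda>x y. \<Sum>\<mu>\<in>UNIV. \<Sum>\<nu>\<in>UNIV. (x $ \<mu> * y $ \<nu> * cnj (\<sigma> \<mu> \<nu>)) *s axis (\<mu> + \<nu>) 1),
    qone = axis 0 1,
    qstar = (\<lambda>x. \<Sum>\<mu>\<in>UNIV. (cnj (x $ \<mu>) * \<sigma> \<mu> (- \<mu>)) *s axis (- \<mu>) 1),
    counit = (\<lambda>x. of_nat CARD('g) * x $ 0),
    adj = (\<lambda>x. \<Sum>\<mu>\<in>UNIV. (cayley_eigenvalue \<tau> S \<mu> * x $ \<mu>) *s axis \<mu> 1),
    onb = (\<lambda>\<mu>. axis \<mu> (of_real (1 / sqrt (real CARD('g)))))\<rparr>"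

definition fourier_matrix :: "('g::{finite, ab_group_add} \<Rightarrow> 'g \<Rightarrow> complex) \<Rightarrow> ((complex, 'g) vec, 'g) vec"
  where "fourier_matrix \<tau> = (\<chi> \<alpha> \<mu>. \<tau> \<mu> \<alpha>)"

definition sigma_multi :: "('g \<Rightarrow> 'g \<Rightarrow> complex) \<Rightarrow> 'g list \<Rightarrow> complex"
  where "sigma_multi \<sigma> i = (\<Prod>b<length i. \<Prod>a<b. \<sigma> (i ! a) (i ! b))"

definition twist_tmat :: "('g \<Rightarrow> 'g \<Rightarrow> complex) \<Rightarrow> 'g tmat \<Rightarrow> 'g tmat"
  where "twist_tmat \<sigma> T = (\<lambda>i j. sigma_multi \<sigma> i * cnj (sigma_multi \<sigma> j) * T i j)"

text \<open>
  \<open>H\<close> is the 2-cocycle twist of \<open>G\<close>, where \<open>G\<close> is written in the standard basis and \<open>H\<close> in the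
  Fourier basis: \<open>H\<close> is the compact matrix quantum group, unique by Tannaka--Krein duality, whose
  intertwiners are the twisted intertwiners of \<open>\<F>\<^sup>-\<^sup>1 G \<F>\<close>.
\<close>

definition is_cocycle_twist ::
    "('g::{finite, ab_group_add} \<Rightarrow> 'g \<Rightarrow> complex) \<Rightarrow> ('g \<Rightarrow> 'g \<Rightarrow> complex) \<Rightarrow>
     'g fsa set \<Rightarrow> 'g fsa set \<Rightarrow> bool"
  where "is_cocycle_twist \<tau> \<sigma> G H \<longleftrightarrow>
    is_cmqg H \<and>
    (\<forall>k l. intertwiners H k l =
       twist_tmat \<sigma> ` intertwiners (change_basis (fourier_matrix \<tau>) G) k l)"

end

theory Submission
  imports Defs
begin

text \<open>
  In the basis of characters the structure constants of \<open>C(\<Gamma>)\<close> are those of the twisted algebra up to the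
  phases \<open>\<sigma>\<close>. Grade the free algebra by row and column index, so that \<open>u\<^sup>i\<^sub>j\<close> has bidegree \<open>(i, j)\<close>. All
  relations of the quantum automorphism group are homogeneous. Rescale every word \<open>w\<close> by a phase \<open>\<theta>(w)\<close> subject
  to \<open>\<theta>(v w) = \<beta>(deg v, deg w) \<theta>(v) \<theta>(w)\<close> with \<open>\<beta>((i, j), (k, l)) = cnj (\<sigma> i k) * \<sigma> j l\<close>. This is a linear
  bijection of the free algebra that is multiplicative up to phases on homogeneous elements, so it
  carries a homogeneous ideal onto an ideal, and it turns the relations for the trivial bicharacter into the
  relations for \<open>\<sigma>\<close> (\<open>rescale_quantum_aut\<close>).

  That \<open>T\<close> is an intertwiner means that the entries of \<open>T u\<^sup>k - u\<^sup>l T\<close> lie in the ideal. On these entries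
  rescaling amounts to multiplying \<open>T\<close> by the phases of the cocycle twist, hence the intertwiners for \<open>\<sigma>\<close>
  are exactly the twisted intertwiners for the trivial bicharacter (\<open>intertwiners_twisted\<close>). The phases
  of a multiindex are multiplicative under concatenation only up to \<open>\<sigma>\<close> of the total degrees.
  The twist is monoidal nevertheless, because \<open>\<Gamma>\<close> acts on its Cayley graph by translations: these are
  points of the quantum group, and evaluating at them shows that an intertwiner preserves the
  total degree (\<open>intertwiner_degree\<close>).

  It remains to compare the trivial bicharacter with the classical graph. The normalized Fourier
  matrix is unitary and carries the multiplication, the unit and the adjacency operator of one to those of
  the other (\<open>conj_structure_tmats\<close>), so conjugation by it identifies the two quantum groups
  (\<open>change_basis_quantum_aut_cayley\<close>) and their intertwiners (\<open>conj_hom_intertwiner_iff\<close>). The isomorphism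
  of categories first removes the phases and then applies the Fourier matrix.

  The objects themselves need two existence arguments. The twisted graph is a quantum graph
  (\<open>is_quantum_graph_twisted\<close>): its C*-norm is the operator norm in the left regular
  representation and its projection is \<open>1/N\<close> times the sum of the \<open>\<lambda>\<^sub>\<mu> t\<^sub>\<mu> \<otimes> t\<^sub>\<mu>\<^sup>*\<close>. Its quantum
  automorphism group is a compact matrix quantum group (\<open>is_cmqg\<close>): since \<open>t\<^sub>i\<^sup>*\<close> is a phase times \<open>t\<^sub>-\<^sub>i\<close>, the
  element \<open>(u\<^sup>i\<^sub>j)\<^sup>*\<close> is a phase times \<open>u\<^sup>-\<^sup>i\<^sub>-\<^sub>j\<close>, which gives the unitarity of the conjugate matrix and the antipode.
\<close>

abbreviation lookup where "lookup \<equiv> Poly_Mapping.lookup"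
abbreviation keys where "keys \<equiv> Poly_Mapping.keys"
abbreviation single where "single \<equiv> Poly_Mapping.single"

section \<open>Additive maps on monoid algebras\<close>

text \<open>
  The linear and conjugate-linear operations on monoid algebras that occur below are sums of this form
  over the support, with a summand that is additive in the coefficient. Their additivity thus has a single proof.
\<close>

definition key_sum :: "('k \<Rightarrow> complex \<Rightarrow> 'r::comm_monoid_add) \<Rightarrow> ('k \<Rightarrow>\<^sub>0 complex) \<Rightarrow> 'r"
  where "key_sum g p = (\<Sum>w\<in>keys p. g w (lookup p w))"

lemma key_sum_single: "g w 0 = 0 \<Longrightarrow> key_sum g (single w c) = g w c"
  by (simp add: key_sum_def)

lemma key_sum_add:
  assumes "\<And>w. g w 0 = 0" "\<And>w a b. g w (a + b) = g w a + g w b"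
  shows "key_sum g (p + q) = key_sum g p + key_sum g q"
proof -
  let ?A = "keys p \<union> keys q"
  have *: "key_sum g r = (\<Sum>w\<in>?A. g w (lookup r w))" if "keys r \<subseteq> ?A" for r
    unfolding key_sum_def
    by (rule sum.mono_neutral_left) (use that assms in \<open>auto simp: in_keys_iff\<close>)
  show ?thesis
    by (subst (1 2 3) *) (auto simp: keys_add[THEN subsetD] lookup_add assms sum.distrib
        dest: keys_add[THEN subsetD])
qed

lemma poly_mapping_add_induct [case_names zero single add]:
  fixes p :: "'k \<Rightarrow>\<^sub>0 complex"
  assumes "P 0" "\<And>w c. P (single w c)" "\<And>p q. P p \<Longrightarrow> P q \<Longrightarrow> P (p + q)"
  shows "P p"
proof (induction p rule: update_induct)
  case const
  show ?case by (rule assms(1))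
next
  case (update f a b)
  have "Poly_Mapping.update a b f = single a b + f"
    using update by (intro poly_mapping_eqI)
      (auto simp: lookup_update lookup_add lookup_single when_def in_keys_iff)
  then show ?case using update assms by auto
qed

lemma additive_eqI:
  fixes F G :: "('k \<Rightarrow>\<^sub>0 complex) \<Rightarrow> 'r::group_add"
  assumes "\<And>p q. F (p + q) = F p + F q" "\<And>p q. G (p + q) = G p + G q"
    and "\<And>w c. F (single w c) = G (single w c)"
  shows "F p = G p"
proof (induction p rule: poly_mapping_add_induct)
  case zero
  have "F 0 = 0" "G 0 = 0"
    using assms(1)[of 0 0] assms(2)[of 0 0] by (metis add_0_right add_left_cancel)+
  then show ?case by simp
qed (auto simp: assms)

lemma additive_zero:
  fixes F :: "'a::group_add \<Rightarrow> 'r::group_add"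
  assumes "\<And>p q. F (p + q) = F p + F q"
  shows "F 0 = 0"
  using assms[of 0 0] by (metis add_0_right add_left_cancel)

lemma additive_minus:
  fixes F :: "'a::group_add \<Rightarrow> 'r::group_add"
  assumes "\<And>p q. F (p + q) = F p + F q"
  shows "F (p - q) = F p - F q"
  using assms[of "p - q" q] by (simp add: algebra_simps eq_diff_eq)

lemma additive_sum:
  fixes F :: "'a::ab_group_add \<Rightarrow> 'r::ab_group_add"
  assumes "\<And>p q. F (p + q) = F p + F q"
  shows "F (\<Sum>x\<in>A. f x) = (\<Sum>x\<in>A. F (f x))"
  by (induction A rule: infinite_finite_induct) (auto simp: assms additive_zero[of F])

subsection \<open>Scalars\<close>

lemma scal_0 [simp]: "scal 0 = 0"
  and scal_1 [simp]: "scal 1 = 1"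
  and scal_mult_single: "scal c * single w d = single w (c * d)"
  by (simp_all add: scal_def mult_single)

lemma scal_add: "scal (a + b) = scal a + scal b"
  and scal_diff: "scal (a - b) = scal a - scal b"
  and scal_minus: "scal (- a) = - scal a"
  by (simp_all add: scal_def single_add single_diff single_uminus)

lemma scal_mult: "scal a * scal b = scal (a * b)"
  by (simp add: scal_def mult_single)

lemma scal_scal: "scal a * (scal b * p) = scal (a * b) * p"
  by (simp add: scal_mult mult.assoc[symmetric])

lemma scal_sum: "scal (\<Sum>x\<in>A. f x) = (\<Sum>x\<in>A. scal (f x))"
  by (rule additive_sum[of scal, OF scal_add])

lemma scal_central: "p * scal c = scal c * p"
  by (rule additive_eqI[of "\<lambda>p. p * scal c" "\<lambda>p. scal c * p"])
    (simp_all add: ring_distribs scal_def mult_single mult.commute)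

lemma mult_scal_left: "p * (scal c * q) = scal c * (p * q)"
  by (metis mult.assoc scal_central)

lemmas scal_simps = scal_scal mult.assoc
  mult_scal_left[of "fund i j" for i j] mult_scal_left[of "fund_st i j" for i j]

subsection \<open>Conjugate-linear and linear anti-homomorphisms induced by words\<close>

text \<open>
  With \<open>h\<close> the conjugation this gives the involutions of the free algebra and of its tensor square, with \<open>h\<close>
  the identity it gives the antipode.
\<close>

definition anti_push :: "(complex \<Rightarrow> complex) \<Rightarrow> ('k \<Rightarrow> 'l) \<Rightarrow> ('k \<Rightarrow>\<^sub>0 complex) \<Rightarrow> ('l \<Rightarrow>\<^sub>0 complex)"
  where "anti_push h \<iota> = key_sum (\<lambda>w c. single (\<iota> w) (h c))"

locale anti_hom =
  fixes h :: "complex \<Rightarrow> complex" and \<iota> :: "'k::monoid_add \<Rightarrow> 'l::monoid_add"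
  assumes h_add: "\<And>a b. h (a + b) = h a + h b"
    and h_mult: "\<And>a b. h (a * b) = h a * h b"
    and h_1: "h 1 = 1"
    and \<iota>_add: "\<And>v w. \<iota> (v + w) = \<iota> w + \<iota> v"
    and \<iota>_0: "\<iota> 0 = 0"
begin

lemma h_0: "h 0 = 0"
  by (rule additive_zero[of h, OF h_add])

lemma push_single: "anti_push h \<iota> (single w c) = single (\<iota> w) (h c)"
  by (simp add: anti_push_def key_sum_single h_0)

lemma push_add: "anti_push h \<iota> (p + q) = anti_push h \<iota> p + anti_push h \<iota> q"
  unfolding anti_push_def by (rule key_sum_add) (simp_all add: h_0 h_add single_add)

lemmas push_zero = additive_zero[of "anti_push h \<iota>", OF push_add]
lemmas push_minus = additive_minus[of "anti_push h \<iota>", OF push_add]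
lemmas push_sum = additive_sum[of "anti_push h \<iota>", OF push_add]

lemma push_scal: "anti_push h \<iota> (scal c) = scal (h c)"
  by (simp add: scal_def push_single \<iota>_0)

lemma push_one: "anti_push h \<iota> 1 = 1"
  using push_scal[of 1] by (simp add: h_1)

lemma push_mult: "anti_push h \<iota> (p * q) = anti_push h \<iota> q * anti_push h \<iota> p"
proof (induction p rule: poly_mapping_add_induct)
  case (single v c)
  show ?case
    by (rule additive_eqI[of "\<lambda>q. anti_push h \<iota> (Poly_Mapping.single v c * q)"])
      (simp_all add: push_add ring_distribs mult_single push_single \<iota>_add h_mult mult.commute)
qed (simp_all add: push_add ring_distribs push_zero)

lemma push_scal_mult: "anti_push h \<iota> (scal c * p) = scal (h c) * anti_push h \<iota> p"
  by (simp add: push_mult push_scal scal_central)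

end

definition word_star :: "'i gen word \<Rightarrow> 'i gen word"
  where "word_star w = Word (rev (map gen_flip (letters w)))"

lemma gen_flip_flip [simp]: "gen_flip (gen_flip g) = g"
  by (cases g) auto

lemma word_star_word_star [simp]: "word_star (word_star w) = w"
  by (cases w) (simp add: word_star_def rev_map comp_def)

lemma fsa_star_eq: "fsa_star = anti_push cnj word_star"
  by (auto simp: fsa_star_def anti_push_def key_sum_def word_star_def)

interpretation fstar: anti_hom cnj word_star
  by standard (auto simp: word_star_def plus_word_def zero_word_def)

lemmas fsa_star_simps =
  fstar.push_add[folded fsa_star_eq] fstar.push_zero[folded fsa_star_eq] fstar.push_minus[folded fsa_star_eq]
  fstar.push_sum[folded fsa_star_eq] fstar.push_scal[folded fsa_star_eq] fstar.push_one[folded fsa_star_eq]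
  fstar.push_mult[folded fsa_star_eq] fstar.push_single[folded fsa_star_eq]

lemma fsa_star_fund [simp]: "fsa_star (fund i j) = fund_st i j"
  and fsa_star_fund_st [simp]: "fsa_star (fund_st i j) = fund i j"
  by (simp_all add: fund_def fund_st_def fsa_star_simps word_star_def)

lemma fsa_star_scal_mult: "fsa_star (scal c * p) = scal (cnj c) * fsa_star p"
  by (simp add: fsa_star_simps scal_central)

lemma fsa_star_star [simp]: "fsa_star (fsa_star p) = p"
  by (rule additive_eqI[of "\<lambda>p. fsa_star (fsa_star p)" "\<lambda>p. p"]) (simp_all add: fsa_star_simps)

subsection \<open>Homomorphisms out of the free algebra\<close>

lemma single_Word_Cons:
  "single (Word (g # gs)) (c :: complex) = single (Word [g]) 1 * single (Word gs) c"
  by (simp add: mult_single plus_word_def)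

definition letter :: "'i gen \<Rightarrow> 'i fsa"
  where "letter g = single (Word [g]) 1"

lemma letter_simps: "letter (Gen i j) = fund i j" "letter (Gen_star i j) = fund_st i j"
  by (simp_all add: letter_def fund_def fund_st_def)

lemma fsa_induct [case_names scal fund fund_st add mult]:
  assumes "\<And>c. P (scal c)" "\<And>i j. P (fund i j)" "\<And>i j. P (fund_st i j)"
    and "\<And>p q. P p \<Longrightarrow> P q \<Longrightarrow> P (p + q)" "\<And>p q. P p \<Longrightarrow> P q \<Longrightarrow> P (p * q)"
  shows "P p"
proof (induction p rule: poly_mapping_add_induct)
  case zero
  show ?case using assms(1)[of 0] by simp
next
  case (single w c)
  have "P (Poly_Mapping.single (Word gs) c)" for gs
  proof (induction gs)
    case Nil
    show ?case using assms(1)[of c] by (simp add: scal_def zero_word_def)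
  next
    case (Cons g gs)
    have "P (letter g)"
      by (cases g) (simp_all add: letter_simps assms)
    then show ?case
      using Cons assms(5) by (subst single_Word_Cons) (simp add: letter_def)
  qed
  then show ?case by (metis word.collapse)
qed (simp add: assms)

text \<open>
  The values of characters, the comultiplication and the changes of basis are all given on generators. Scalars
  have to be central in the target for the extension to be multiplicative.
\<close>

locale scalar_embedding =
  fixes emb :: "complex \<Rightarrow> 'r::ring_1"
  assumes emb_add: "emb (a + b) = emb a + emb b"
    and emb_mult: "emb (a * b) = emb a * emb b"
    and emb_1: "emb 1 = 1"
    and emb_central: "x * emb c = emb c * x"
begin

lemma emb_0: "emb 0 = 0"
  by (rule additive_zero[of emb, OF emb_add])

lemma ext_eq: "alg_ext emb f = key_sum (\<lambda>w c. emb c * prod_list (map f (letters w)))"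
  by (auto simp: alg_ext_def key_sum_def)

lemma ext_single: "alg_ext emb f (single w c) = emb c * prod_list (map f (letters w))"
  unfolding ext_eq by (rule key_sum_single) (simp add: emb_0)

lemma ext_add: "alg_ext emb f (p + q) = alg_ext emb f p + alg_ext emb f q"
  unfolding ext_eq by (rule key_sum_add) (simp_all add: emb_0 emb_add ring_distribs)

lemma ext_zero: "alg_ext emb f 0 = 0"
  and ext_minus: "alg_ext emb f (p - q) = alg_ext emb f p - alg_ext emb f q"
  and ext_sum: "alg_ext emb f (\<Sum>x\<in>A. g x) = (\<Sum>x\<in>A. alg_ext emb f (g x))"
  by (rule additive_zero[of "alg_ext emb f", OF ext_add] additive_minus[of "alg_ext emb f", OF ext_add]
      additive_sum[of "alg_ext emb f", OF ext_add])+

lemma ext_scal: "alg_ext emb f (scal c) = emb c"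
  by (simp add: scal_def ext_single zero_word_def)

lemma ext_one: "alg_ext emb f 1 = 1"
  using ext_scal[of f 1] by (simp add: emb_1)

lemma ext_letter:
  "alg_ext emb f (fund i j) = f (Gen i j)" "alg_ext emb f (fund_st i j) = f (Gen_star i j)"
  by (simp_all add: fund_def fund_st_def ext_single emb_1)

lemma ext_mult: "alg_ext emb f (p * q) = alg_ext emb f p * alg_ext emb f q"
proof (induction p rule: poly_mapping_add_induct)
  case (single v c)
  have *: "emb (c * d) * (x * y) = (emb c * x) * (emb d * y)" for d x y
  proof -
    have "x * (emb d * y) = emb d * (x * y)"
      by (metis emb_central mult.assoc)
    then show ?thesis by (simp add: emb_mult mult.assoc)
  qed
  show ?case
    by (rule additive_eqI[of "\<lambda>q. alg_ext emb f (Poly_Mapping.single v c * q)"])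
      (simp_all add: ext_add ring_distribs mult_single ext_single plus_word_def *)
qed (simp_all add: ext_add ring_distribs ext_zero)

lemmas ext_simps = ext_add ext_zero ext_minus ext_sum ext_scal ext_one ext_letter ext_mult

lemma ext_star:
  assumes st_add: "\<And>x y. st (x + y) = st x + st y"
    and st_mult: "\<And>x y. st (x * y) = st y * st x"
    and st_emb: "\<And>c. st (emb c) = emb (cnj c)"
    and st_f: "\<And>g. f (gen_flip g) = st (f g)"
  shows "alg_ext emb f (fsa_star p) = st (alg_ext emb f p)"
proof (induction p rule: fsa_induct)
  case (fund i j)
  show ?case using st_f[of "Gen i j"] by (simp add: ext_simps)
next
  case (fund_st i j)
  show ?case using st_f[of "Gen_star i j"] by (simp add: ext_simps)
qed (simp_all add: fsa_star_simps ext_simps st_add st_mult st_emb)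

end

interpretation scal: scalar_embedding scal
  by standard (simp_all add: scal_add scal_mult, rule scal_central)

interpretation complex_id: scalar_embedding "\<lambda>c::complex. c"
  by standard simp_all


section \<open>Congruence modulo an ideal\<close>

locale two_sided_ideal =
  fixes I :: "'r::ring_1 set"
  assumes zero_mem: "0 \<in> I"
    and add_mem: "p \<in> I \<Longrightarrow> q \<in> I \<Longrightarrow> p + q \<in> I"
    and left_mem: "p \<in> I \<Longrightarrow> q * p \<in> I"
    and right_mem: "p \<in> I \<Longrightarrow> p * q \<in> I"
begin

lemma minus_mem: "p \<in> I \<Longrightarrow> - p \<in> I"
  using left_mem[of p "-1"] by simp

lemma sum_mem: "(\<And>x. x \<in> A \<Longrightarrow> f x \<in> I) \<Longrightarrow> (\<Sum>x\<in>A. f x) \<in> I"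
  by (induction A rule: infinite_finite_induct) (auto simp: zero_mem add_mem)

definition eqv (infix "\<doteq>" 50)
  where "p \<doteq> q \<longleftrightarrow> p - q \<in> I"

lemma eqv_refl [simp, intro!]: "p \<doteq> p"
  by (simp add: eqv_def zero_mem)

lemma eqv_sym: "p \<doteq> q \<Longrightarrow> q \<doteq> p"
  unfolding eqv_def using minus_mem by fastforce

lemma eqv_trans [trans]: "p \<doteq> q \<Longrightarrow> q \<doteq> r \<Longrightarrow> p \<doteq> r"
  unfolding eqv_def using add_mem[of "p - q" "q - r"] by simp

lemma eqv_eq_trans [trans]: "p \<doteq> q \<Longrightarrow> q = r \<Longrightarrow> p \<doteq> r"
  and eq_eqv_trans [trans]: "p = q \<Longrightarrow> q \<doteq> r \<Longrightarrow> p \<doteq> r"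
  by simp_all

lemma eqv_mult:
  assumes "p \<doteq> q" "p' \<doteq> q'"
  shows "p * p' \<doteq> q * q'"
proof -
  have "p * p' - q * q' = (p - q) * p' + q * (p' - q')"
    by (simp add: algebra_simps)
  then show ?thesis
    using assms add_mem left_mem right_mem by (simp add: eqv_def)
qed

lemma eqv_sum: "(\<And>x. x \<in> A \<Longrightarrow> f x \<doteq> g x) \<Longrightarrow> (\<Sum>x\<in>A. f x) \<doteq> (\<Sum>x\<in>A. g x)"
  unfolding eqv_def sum_subtractf[symmetric] by (rule sum_mem)

lemma eqv_mult_left: "p \<doteq> q \<Longrightarrow> r * p \<doteq> r * q"
  and eqv_mult_right: "p \<doteq> q \<Longrightarrow> p * r \<doteq> q * r"
  by (simp_all add: eqv_mult)

end

locale fsa_ideal =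
  fixes I :: "'i::finite fsa set"
  assumes star_ideal: "star_ideal I"
begin

sublocale two_sided_ideal I
  using star_ideal by unfold_locales (auto simp: star_ideal_def)

lemma star_mem: "p \<in> I \<Longrightarrow> fsa_star p \<in> I"
  using star_ideal by (auto simp: star_ideal_def)

lemma eqv_star: "p \<doteq> q \<Longrightarrow> fsa_star p \<doteq> fsa_star q"
  unfolding eqv_def using star_mem by (fastforce simp flip: fsa_star_simps(3))

lemma scal_mem_iff: "c \<noteq> 0 \<Longrightarrow> scal c * p \<in> I \<longleftrightarrow> p \<in> I"
  using left_mem[of "scal c * p" "scal (1 / c)"] left_mem[of p "scal c"]
  by (auto simp: scal_scal)

end

text \<open>
  This reduces an inclusion of an ideal given by generators into the preimage of another ideal to a check on
  the generators. The map may be multiplicative, as the comultiplication is, or antimultiplicative, as the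
  antipode is.
\<close>

lemma star_ideal_preimage:
  assumes J: "two_sided_ideal J" and st: "\<And>x. x \<in> J \<Longrightarrow> st x \<in> J"
    and add: "\<And>p q. h (p + q) = h p + h q"
    and mult: "\<And>p q. h (p * q) = h p * h q \<or> h (p * q) = h q * h p"
    and star: "\<And>p. h (fsa_star p) = st (h p)"
  shows "star_ideal {p. h p \<in> J}"
proof -
  interpret two_sided_ideal J by fact
  have "h 0 = 0" using add[of 0 0] by (metis add_0_right add_left_cancel)
  moreover have "h (q * p) \<in> J" "h (p * q) \<in> J" if "h p \<in> J" for p q
    using mult[of p q] mult[of q p] left_mem[OF that] right_mem[OF that] by auto
  ultimately show ?thesis
    by (auto simp: star_ideal_def add star st zero_mem add_mem)
qed

lemma star_ideal_star_ideal_generated: "star_ideal (star_ideal_generated R)"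
  by (auto simp: star_ideal_def star_ideal_generated_def)

lemma quantum_aut_subset_iff:
  assumes "star_ideal J"
  shows "quantum_aut X \<subseteq> J \<longleftrightarrow> aut_relations X \<subseteq> J"
  using assms by (auto simp: quantum_aut_def star_ideal_generated_def)

lemma fsa_ideal_quantum_aut: "fsa_ideal (quantum_aut X)"
  by standard (simp add: quantum_aut_def star_ideal_star_ideal_generated)

section \<open>Intertwiners and the relations of quantum automorphism groups\<close>

lemma lists_length_0: "{p. length p = 0} = {[]}"
  by auto

lemma sum_lists_Suc:
  fixes f :: "'i::finite list \<Rightarrow> 'a::comm_monoid_add"
  shows "(\<Sum>p | length p = Suc n. f p) = (\<Sum>a\<in>UNIV. \<Sum>p | length p = n. f (a # p))"
proof -
  have "(\<Sum>p | length p = Suc n. f p) = (\<Sum>(a, p)\<in>UNIV \<times> {p. length p = n}. f (a # p))"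
    by (rule sum.reindex_bij_witness[of _ "\<lambda>(a, p). a # p" "\<lambda>p. (hd p, tl p)"])
      (auto simp: length_Suc_conv)
  then show ?thesis by (simp add: sum.cartesian_product)
qed

lemma finite_lists_length [simp]: "finite {p :: 'i::finite list. length p = n}"
  using finite_lists_length_eq[of "UNIV :: 'i set" n] by simp

lemma sum_lists_0: "(\<Sum>p | length p = 0. f p) = f []"
  and sum_lists_1: "(\<Sum>p | length p = 1. g p) = (\<Sum>a\<in>UNIV. g [a])"
  and sum_lists_2: "(\<Sum>p | length p = 2. h p) = (\<Sum>a\<in>UNIV. \<Sum>b\<in>UNIV. h [a, b])"
  for g h :: "'i::finite list \<Rightarrow> 'a::comm_monoid_add"
  by (simp_all add: lists_length_0 sum_lists_Suc numeral_2_eq_2 del: length_0_conv)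

lemma fund_power_Nil [simp]: "fund_power [] [] = 1"
  and fund_power_Cons [simp]: "fund_power (a # p) (b # q) = fund a b * fund_power p q"
  by (simp_all add: fund_power_def)

text \<open>
  The \<open>(i, j)\<close> entry of \<open>T u\<^sup>k - u\<^sup>l T\<close>, where the powers are tensor powers.
\<close>

definition intertwining_defect :: "nat \<Rightarrow> nat \<Rightarrow> 'i::finite tmat \<Rightarrow> 'i list \<Rightarrow> 'i list \<Rightarrow> 'i fsa"
  where "intertwining_defect k l T i j =
    (\<Sum>p | length p = k. scal (T i p) * fund_power p j) -
    (\<Sum>q | length q = l. scal (T q j) * fund_power i q)"

lemma intertwiners_eq: "intertwiners I k l = {T \<in> tmats k l.
    \<forall>i j. length i = l \<longrightarrow> length j = k \<longrightarrow> intertwining_defect k l T i j \<in> I}"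
  by (simp add: intertwiners_def intertwining_defect_def)

lemma all_lists_1: "(\<forall>p. length p = 1 \<longrightarrow> P p) \<longleftrightarrow> (\<forall>a. P [a])"
  and all_lists_2: "(\<forall>p. length p = 2 \<longrightarrow> P p) \<longleftrightarrow> (\<forall>a b. P [a, b])"
  by (auto simp: length_Suc_conv numeral_2_eq_2)

lemma intertwiners_1_1: "T \<in> intertwiners I 1 1 \<longleftrightarrow> T \<in> tmats 1 1 \<and>
    (\<forall>i j. (\<Sum>k\<in>UNIV. scal (T [i] [k]) * fund k j) - (\<Sum>k\<in>UNIV. scal (T [k] [j]) * fund i k) \<in> I)"
proof -
  have "T \<in> intertwiners I 1 1 \<longleftrightarrow> T \<in> tmats 1 1 \<and>
    (\<forall>i. length i = 1 \<longrightarrow> (\<forall>j. length j = 1 \<longrightarrow> intertwining_defect 1 1 T i j \<in> I))"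
    by (auto simp: intertwiners_eq)
  then show ?thesis
    unfolding all_lists_1 intertwining_defect_def sum_lists_1 by simp
qed

lemma intertwiners_2_1: "T \<in> intertwiners I 2 1 \<longleftrightarrow> T \<in> tmats 2 1 \<and>
    (\<forall>i j k. (\<Sum>a\<in>UNIV. \<Sum>b\<in>UNIV. scal (T [i] [a, b]) * (fund a j * fund b k)) -
      (\<Sum>c\<in>UNIV. scal (T [c] [j, k]) * fund i c) \<in> I)"
proof -
  have "T \<in> intertwiners I 2 1 \<longleftrightarrow> T \<in> tmats 2 1 \<and>
    (\<forall>i. length i = 1 \<longrightarrow> (\<forall>j. length j = 2 \<longrightarrow> intertwining_defect 2 1 T i j \<in> I))"
    by (auto simp: intertwiners_eq)
  then show ?thesis
    unfolding all_lists_1 all_lists_2 intertwining_defect_def sum_lists_1 sum_lists_2 by simp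
qed

lemma intertwiners_0_1: "T \<in> intertwiners I 0 1 \<longleftrightarrow> T \<in> tmats 0 1 \<and>
    (\<forall>i. scal (T [i] []) - (\<Sum>c\<in>UNIV. scal (T [c] []) * fund i c) \<in> I)"
proof -
  have "T \<in> intertwiners I 0 1 \<longleftrightarrow> T \<in> tmats 0 1 \<and>
    (\<forall>i. length i = 1 \<longrightarrow> intertwining_defect 0 1 T i [] \<in> I)"
    by (auto simp: intertwiners_eq)
  then show ?thesis
    unfolding all_lists_1 intertwining_defect_def sum_lists_1 sum_lists_0 by simp
qed

lemma mult_tmat_tmats: "mult_tmat X \<in> tmats 2 1"
  and unit_tmat_tmats: "unit_tmat X \<in> tmats 0 1"
  and adj_tmat_tmats: "adj_tmat X \<in> tmats 1 1"
  by (auto simp: tmats_def mult_tmat_def unit_tmat_def adj_tmat_def split: list.splits)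

lemma unitary_modulo_fund: "unitary_modulo I fund \<longleftrightarrow>
    (\<forall>i j. (\<Sum>k\<in>UNIV. fund i k * fund_st j k) - scal (if i = j then 1 else 0) \<in> I) \<and>
    (\<forall>i j. (\<Sum>k\<in>UNIV. fund_st k i * fund k j) - scal (if i = j then 1 else 0) \<in> I)"
  by (simp add: unitary_modulo_def)

lemma family_subset_iff:
  "{u. \<exists>i j. u = f i j} \<subseteq> J \<longleftrightarrow> (\<forall>i j. f i j \<in> J)"
  "{u. \<exists>i j k. u = g i j k} \<subseteq> J \<longleftrightarrow> (\<forall>i j k. g i j k \<in> J)"
  by auto

text \<open>
  Written with intertwiners, the relations for the multiplication and for the adjacency operator can be carried along a
  change of basis without looking at their coefficients.
\<close>

lemma aut_relations_subset_iff: "aut_relations X \<subseteq> J \<longleftrightarrow>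
    unitary_modulo J fund \<and>
    (\<forall>i j. (\<Sum>k\<in>UNIV. scal (star_matrix X k j) * fund i k) -
      (\<Sum>k\<in>UNIV. scal (star_matrix X i k) * fund_st k j) \<in> J) \<and>
    mult_tmat X \<in> intertwiners J 2 1 \<and> adj_tmat X \<in> intertwiners J 1 1"
  unfolding aut_relations_def unitary_modulo_fund intertwiners_2_1 intertwiners_1_1
  by (simp only: Un_subset_iff family_subset_iff mult_tmat_tmats adj_tmat_tmats conj_assoc simp_thms)

section \<open>Bicharacters\<close>

locale bicharacter =
  fixes \<sigma> :: "'g::{finite, ab_group_add} \<Rightarrow> 'g \<Rightarrow> complex"
  assumes unitary_bicharacter: "unitary_bicharacter \<sigma>"
begin

lemma add_left: "\<sigma> (\<mu> + \<nu>) \<rho> = \<sigma> \<mu> \<rho> * \<sigma> \<nu> \<rho>"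
  and add_right: "\<sigma> \<mu> (\<nu> + \<rho>) = \<sigma> \<mu> \<nu> * \<sigma> \<mu> \<rho>"
  and norm_1: "cmod (\<sigma> \<mu> \<nu>) = 1"
  using unitary_bicharacter by (auto simp: unitary_bicharacter_def)

lemma nz [simp]: "\<sigma> \<mu> \<nu> \<noteq> 0"
  using norm_1[of \<mu> \<nu>] by auto

lemma zero_left [simp]: "\<sigma> 0 \<nu> = 1"
  and zero_right [simp]: "\<sigma> \<nu> 0 = 1"
  using add_left[of 0 0 \<nu>] add_right[of \<nu> 0 0] by auto

lemma cnj: "cnj (\<sigma> \<mu> \<nu>) = 1 / \<sigma> \<mu> \<nu>"
  using norm_1[of \<mu> \<nu>] complex_norm_square[of "\<sigma> \<mu> \<nu>"] by (simp add: field_simps)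

lemma minus_left: "\<sigma> (- \<mu>) \<nu> = 1 / \<sigma> \<mu> \<nu>"
  and minus_right: "\<sigma> \<mu> (- \<nu>) = 1 / \<sigma> \<mu> \<nu>"
  using add_left[of \<mu> "- \<mu>" \<nu>] add_right[of \<mu> \<nu> "- \<nu>"] by (auto simp: field_simps)

lemma diff_left: "\<sigma> (\<mu> - \<rho>) \<nu> = \<sigma> \<mu> \<nu> / \<sigma> \<rho> \<nu>"
  and diff_right: "\<sigma> \<mu> (\<nu> - \<rho>) = \<sigma> \<mu> \<nu> / \<sigma> \<mu> \<rho>"
  using add_left[of \<mu> "- \<rho>" \<nu>] add_right[of \<mu> \<nu> "- \<rho>"] by (auto simp: minus_left minus_right)

lemmas simps = add_left add_right cnj minus_left minus_right diff_left diff_right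

end

text \<open>
  A named constant: for a lambda abstraction the rewrite rules for bicharacters would specialize to \<open>1 = 1\<close>.
\<close>

definition trivial_bicharacter :: "'g \<Rightarrow> 'g \<Rightarrow> complex"
  where "trivial_bicharacter \<mu> \<nu> = 1"

lemma unitary_bicharacter_trivial: "unitary_bicharacter trivial_bicharacter"
  by (simp add: unitary_bicharacter_def trivial_bicharacter_def)

lemma unitary_bicharacter_cnj: "unitary_bicharacter \<sigma> \<Longrightarrow> unitary_bicharacter (\<lambda>\<mu> \<nu>. cnj (\<sigma> \<mu> \<nu>))"
  by (simp add: unitary_bicharacter_def)

lemma unitary_bicharacter_mult:
  "unitary_bicharacter \<sigma> \<Longrightarrow> unitary_bicharacter \<sigma>' \<Longrightarrow> unitary_bicharacter (\<lambda>\<mu> \<nu>. \<sigma> \<mu> \<nu> * \<sigma>' \<mu> \<nu>)"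
  by (simp add: unitary_bicharacter_def norm_mult)

section \<open>The twisted group algebra in coordinates\<close>

lemma sum_group_shift:
  fixes f :: "'g::{finite, ab_group_add} \<Rightarrow> 'a::comm_monoid_add"
  shows "(\<Sum>a\<in>UNIV. f (a + c)) = (\<Sum>a\<in>UNIV. f a)" "(\<Sum>a\<in>UNIV. f (c + a)) = (\<Sum>a\<in>UNIV. f a)"
    "(\<Sum>a\<in>UNIV. f (a - c)) = (\<Sum>a\<in>UNIV. f a)" "(\<Sum>a\<in>UNIV. f (c - a)) = (\<Sum>a\<in>UNIV. f a)"
    "(\<Sum>a\<in>UNIV. f (- a)) = (\<Sum>a\<in>UNIV. f a)"
proof -
  show "(\<Sum>a\<in>UNIV. f (a + c)) = (\<Sum>a\<in>UNIV. f a)"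
    by (rule sum.reindex_bij_witness[of _ "\<lambda>a. a - c" "\<lambda>a. a + c"]) auto
  show "(\<Sum>a\<in>UNIV. f (c + a)) = (\<Sum>a\<in>UNIV. f a)"
    by (rule sum.reindex_bij_witness[of _ "\<lambda>a. a - c" "\<lambda>a. c + a"]) auto
  show "(\<Sum>a\<in>UNIV. f (a - c)) = (\<Sum>a\<in>UNIV. f a)"
    by (rule sum.reindex_bij_witness[of _ "\<lambda>a. a + c" "\<lambda>a. a - c"]) auto
  show "(\<Sum>a\<in>UNIV. f (c - a)) = (\<Sum>a\<in>UNIV. f a)"
    by (rule sum.reindex_bij_witness[of _ "\<lambda>a. c - a" "\<lambda>a. c - a"]) auto
  show "(\<Sum>a\<in>UNIV. f (- a)) = (\<Sum>a\<in>UNIV. f a)"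
    by (rule sum.reindex_bij_witness[of _ "\<lambda>a. - a" "\<lambda>a. - a"]) auto
qed

lemma sum_sum_if_add:
  fixes f :: "'g::{finite, ab_group_add} \<Rightarrow> 'g \<Rightarrow> 'a::comm_monoid_add"
  shows "(\<Sum>a\<in>UNIV. \<Sum>b\<in>UNIV. if a + b = c then f a b else 0) = (\<Sum>a\<in>UNIV. f a (c - a))"
proof (rule sum.cong[OF refl])
  fix a
  have "(\<Sum>b\<in>UNIV. if a + b = c then f a b else 0) = (\<Sum>b\<in>UNIV. if b = c - a then f a b else 0)"
    by (intro sum.cong) (auto simp: algebra_simps)
  then show "(\<Sum>b\<in>UNIV. if a + b = c then f a b else 0) = f a (c - a)" by simp
qed

lemma if_zero:
  "(if P then x else 0) * y = (if P then x * y else 0)"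
  "y * (if P then x else 0) = (if P then y * x else 0)"
  "cnj (if P then c else 0) = (if P then cnj c else 0)"
  "scal (if P then c else 0) = (if P then scal c else 0)"
  for x y :: "'a::mult_zero"
  by auto

context bicharacter
begin

lemma qmult_nth: "qmult (twisted_cayley \<tau> \<sigma> S) x y $ \<kappa> =
    (\<Sum>\<mu>\<in>UNIV. x $ \<mu> * y $ (\<kappa> - \<mu>) * cnj (\<sigma> \<mu> (\<kappa> - \<mu>)))"
proof -
  have "qmult (twisted_cayley \<tau> \<sigma> S) x y $ \<kappa> =
      (\<Sum>\<mu>\<in>UNIV. \<Sum>\<nu>\<in>UNIV. if \<mu> + \<nu> = \<kappa> then x $ \<mu> * y $ \<nu> * cnj (\<sigma> \<mu> \<nu>) else 0)"
    by (auto simp: twisted_cayley_def axis_def intro!: sum.cong)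
  then show ?thesis by (simp add: sum_sum_if_add)
qed

lemma qstar_nth: "qstar (twisted_cayley \<tau> \<sigma> S) x $ \<kappa> = cnj (x $ (- \<kappa>)) * \<sigma> (- \<kappa>) \<kappa>"
proof -
  have "qstar (twisted_cayley \<tau> \<sigma> S) x $ \<kappa> =
      (\<Sum>\<mu>\<in>UNIV. if \<mu> = - \<kappa> then cnj (x $ \<mu>) * \<sigma> \<mu> (- \<mu>) else 0)"
    unfolding twisted_cayley_def
    by (simp only: quantum_set.simps quantum_graph.simps sum_component vector_smult_component, intro sum.cong)
      (auto simp: axis_def)
  then show ?thesis by simp
qed

lemma adj_nth: "adj (twisted_cayley \<tau> \<sigma> S) x $ \<kappa> = cayley_eigenvalue \<tau> S \<kappa> * x $ \<kappa>"
  by (simp add: twisted_cayley_def axis_def if_zero)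

lemma onb_nth: "onb (twisted_cayley \<tau> \<sigma> S) a $ \<kappa> = (if \<kappa> = a then of_real (1 / sqrt (real CARD('g))) else 0)"
  by (simp add: twisted_cayley_def axis_def)

lemma counit_twisted: "counit (twisted_cayley \<tau> \<sigma> S) x = of_nat CARD('g) * x $ 0"
  by (simp add: twisted_cayley_def)

lemma qinner_twisted: "qinner (twisted_cayley \<tau> \<sigma> S) x y = of_nat CARD('g) * (\<Sum>\<mu>\<in>UNIV. cnj (x $ \<mu>) * y $ \<mu>)"
proof -
  have "(\<Sum>\<mu>\<in>UNIV. qstar (twisted_cayley \<tau> \<sigma> S) x $ \<mu> * y $ (0 - \<mu>) * cnj (\<sigma> \<mu> (0 - \<mu>))) =
      (\<Sum>\<mu>\<in>UNIV. cnj (x $ (- \<mu>)) * y $ (- \<mu>))"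
    by (intro sum.cong) (simp_all add: qstar_nth simps)
  also have "\<dots> = (\<Sum>\<mu>\<in>UNIV. cnj (x $ \<mu>) * y $ \<mu>)"
    by (rule sum_group_shift)
  finally show ?thesis
    by (simp add: qinner_def counit_twisted qmult_nth)
qed

lemma onb_coord_twisted:
  "onb_coord (twisted_cayley \<tau> \<sigma> S) c v = of_real (sqrt (real CARD('g))) * v $ c"
proof -
  let ?N = "real CARD('g)"
  have "(\<Sum>\<mu>\<in>UNIV. cnj (onb (twisted_cayley \<tau> \<sigma> S) c $ \<mu>) * v $ \<mu>) = of_real (1 / sqrt ?N) * v $ c"
    by (simp add: twisted_cayley_def axis_def if_zero)
  moreover have "of_nat CARD('g) * of_real (1 / sqrt ?N) = (of_real (sqrt ?N) :: complex)"
  proof -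
    have "(of_nat CARD('g) :: complex) = of_real ?N" by simp
    then show ?thesis
      by (simp only: of_real_mult[symmetric]) (simp add: real_div_sqrt)
  qed
  ultimately show ?thesis
    unfolding onb_coord_def qinner_twisted by (simp only: mult.assoc[symmetric])
qed

lemma sqrt_card: "of_real (sqrt (real CARD('g))) * of_real (1 / sqrt (real CARD('g))) = (1 :: complex)"
  unfolding of_real_mult[symmetric] by simp

lemma star_matrix_twisted:
  "star_matrix (twisted_cayley \<tau> \<sigma> S) i j = (if i = - j then \<sigma> j (- j) else 0)"
  unfolding star_matrix_def onb_coord_twisted qstar_nth
  using sqrt_card by (auto simp: twisted_cayley_def axis_def mult.assoc[symmetric] simp del: of_real_divide)

lemma mult_tmat_twisted:
  "mult_tmat (twisted_cayley \<tau> \<sigma> S) [c] [a, b] =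
    (if a + b = c then of_real (1 / sqrt (real CARD('g))) * cnj (\<sigma> a b) else 0)"
proof -
  let ?X = "twisted_cayley \<tau> \<sigma> S"
  have "qmult ?X (onb ?X a) (onb ?X b) $ c = (if a + b = c then
      of_real (1 / sqrt (real CARD('g))) * (of_real (1 / sqrt (real CARD('g))) * cnj (\<sigma> a b)) else 0)"
  proof -
    have "onb ?X a $ \<mu> * onb ?X b $ (c - \<mu>) * cnj (\<sigma> \<mu> (c - \<mu>)) = (if \<mu> = a then if a + b = c then
      of_real (1 / sqrt (real CARD('g))) * (of_real (1 / sqrt (real CARD('g))) * cnj (\<sigma> a b)) else 0
      else 0)" for \<mu>
      by (auto simp: onb_nth algebra_simps)
    then show ?thesis
      unfolding qmult_nth by simp
  qed
  then show ?thesis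
    using sqrt_card
    by (simp add: mult_tmat_def onb_coord_twisted mult.assoc[symmetric] del: of_real_divide)
qed

lemma adj_tmat_twisted:
  "adj_tmat (twisted_cayley \<tau> \<sigma> S) [c] [a] = (if a = c then cayley_eigenvalue \<tau> S c else 0)"
proof -
  let ?X = "twisted_cayley \<tau> \<sigma> S"
  have "adj ?X (onb ?X a) $ c = (if a = c then of_real (1 / sqrt (real CARD('g))) * cayley_eigenvalue \<tau> S c else 0)"
    by (simp add: adj_nth onb_nth)
  then show ?thesis
    using sqrt_card
    by (simp add: adj_tmat_def onb_coord_twisted mult.assoc[symmetric] del: of_real_divide)
qed

lemma unit_tmat_twisted:
  "unit_tmat (twisted_cayley \<tau> \<sigma> S) [c] [] = (if c = 0 then of_real (sqrt (real CARD('g))) else 0)"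
  by (simp add: unit_tmat_def onb_coord_twisted) (simp add: twisted_cayley_def axis_def)

end

text \<open>
  The relations of the twisted graph written out. The relation with \<open>F\<close> says that \<open>(u\<^sup>i\<^sub>j)\<^sup>*\<close> is a
  phase times \<open>u\<^sup>-\<^sup>i\<^sub>-\<^sub>j\<close>, because \<open>F\<close> sends the basis vector \<open>t\<^sub>j\<close> to a multiple of \<open>t\<^sub>-\<^sub>j\<close>. The normalization \<open>1 / sqrt N\<close> of the
  basis is a common factor of both sides of the multiplication relation.
\<close>

definition twisted_relations ::
    "('g::{finite, ab_group_add} \<Rightarrow> 'g \<Rightarrow> complex) \<Rightarrow> ('g \<Rightarrow> complex) \<Rightarrow> 'g fsa set \<Rightarrow> bool"
  where "twisted_relations \<sigma> lam J \<longleftrightarrow>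
    unitary_modulo J fund \<and>
    (\<forall>i j. fund_st i j - scal (\<sigma> i i * cnj (\<sigma> j j)) * fund (- i) (- j) \<in> J) \<and>
    (\<forall>i j k. (\<Sum>a\<in>UNIV. scal (cnj (\<sigma> a (i - a))) * (fund a j * fund (i - a) k)) -
      scal (cnj (\<sigma> j k)) * fund i (j + k) \<in> J) \<and>
    (\<forall>i j. scal (lam i - lam j) * fund i j \<in> J)"

lemma aut_relations_twisted_iff:
  assumes \<sigma>: "unitary_bicharacter \<sigma>" and J: "star_ideal J"
  shows "aut_relations (twisted_cayley \<tau> \<sigma> S) \<subseteq> J \<longleftrightarrow>
    twisted_relations \<sigma> (cayley_eigenvalue \<tau> S) J"
proof -
  interpret bicharacter \<sigma> by standard fact
  interpret fsa_ideal J by standard fact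
  let ?X = "twisted_cayley \<tau> \<sigma> S" and ?lam = "cayley_eigenvalue \<tau> S"
  let ?r = "of_real (1 / sqrt (real CARD('a))) :: complex"
  have star1: "(\<Sum>k\<in>UNIV. scal (star_matrix ?X k j) * fund i k) = scal (\<sigma> j (- j)) * fund i (- j)" for i j
    by (simp add: star_matrix_twisted if_zero)
  have eq_minus: "i = - k \<longleftrightarrow> k = - i" for i k :: 'a
    by auto
  have star2: "(\<Sum>k\<in>UNIV. scal (star_matrix ?X i k) * fund_st k j) = scal (\<sigma> (- i) i) * fund_st (- i) j" for i j
    by (simp add: star_matrix_twisted eq_minus[of i] if_zero)
  have star3: "scal (\<sigma> j (- j)) * fund (- i) (- j) - scal (\<sigma> i (- i)) * fund_st i j =
      scal (- \<sigma> i (- i)) * (fund_st i j - scal (\<sigma> i i * cnj (\<sigma> j j)) * fund (- i) (- j))" for i j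
    by (simp add: right_diff_distrib scal_scal simps scal_minus)
  have "scal (\<sigma> j (- j)) * fund (- i) (- j) - scal (\<sigma> i (- i)) * fund_st i j \<in> J \<longleftrightarrow>
      fund_st i j - scal (\<sigma> i i * cnj (\<sigma> j j)) * fund (- i) (- j) \<in> J" for i j
    unfolding star3 by (rule scal_mem_iff) simp
  then have star: "(\<forall>i j. (\<Sum>k\<in>UNIV. scal (star_matrix ?X k j) * fund i k) -
      (\<Sum>k\<in>UNIV. scal (star_matrix ?X i k) * fund_st k j) \<in> J) \<longleftrightarrow>
    (\<forall>i j. fund_st i j - scal (\<sigma> i i * cnj (\<sigma> j j)) * fund (- i) (- j) \<in> J)"
    unfolding star1 star2 by (metis minus_minus)
  have mult1: "(\<Sum>a\<in>UNIV. \<Sum>b\<in>UNIV. scal (mult_tmat ?X [i] [a, b]) * (fund a j * fund b k)) =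
      scal ?r * (\<Sum>a\<in>UNIV. scal (cnj (\<sigma> a (i - a))) * (fund a j * fund (i - a) k))" for i j k
    by (simp add: mult_tmat_twisted if_zero sum_sum_if_add
        sum_distrib_left scal_scal)
  have mult2: "(\<Sum>c\<in>UNIV. scal (mult_tmat ?X [c] [j, k]) * fund i c) =
      scal ?r * (scal (cnj (\<sigma> j k)) * fund i (j + k))" for i j k
    by (simp add: mult_tmat_twisted if_zero scal_scal)
  have mult: "(mult_tmat ?X \<in> intertwiners J 2 1) \<longleftrightarrow>
    (\<forall>i j k. (\<Sum>a\<in>UNIV. scal (cnj (\<sigma> a (i - a))) * (fund a j * fund (i - a) k)) -
      scal (cnj (\<sigma> j k)) * fund i (j + k) \<in> J)"
    unfolding intertwiners_2_1 mult1 mult2 right_diff_distrib[symmetric]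
    by (subst scal_mem_iff) (simp, simp only: mult_tmat_tmats simp_thms)
  have adj1: "(\<Sum>k\<in>UNIV. scal (adj_tmat ?X [i] [k]) * fund k j) = scal (?lam i) * fund i j" for i j
    by (simp add: adj_tmat_twisted if_zero)
  have adj2: "(\<Sum>k\<in>UNIV. scal (adj_tmat ?X [k] [j]) * fund i k) = scal (?lam j) * fund i j" for i j
    by (simp add: adj_tmat_twisted if_zero)
  have adj: "(adj_tmat ?X \<in> intertwiners J 1 1) \<longleftrightarrow> (\<forall>i j. scal (?lam i - ?lam j) * fund i j \<in> J)"
    unfolding intertwiners_1_1 adj1 adj2 by (simp only: adj_tmat_tmats scal_diff left_diff_distrib simp_thms)
  show ?thesis
    unfolding aut_relations_subset_iff twisted_relations_def star mult adj ..
qed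


section \<open>Rescaling words by a bicharacter of their bidegree\<close>

text \<open>
  This is the grading dual to the left and right multiplication of the quantum group by the translations in \<open>\<Gamma>\<close>,
  which are diagonal in the basis of characters.
\<close>

fun letter_degree :: "'g::ab_group_add gen \<Rightarrow> 'g \<times> 'g"
  where "letter_degree (Gen i j) = (i, j)"
  | "letter_degree (Gen_star i j) = (- i, - j)"

definition list_degree :: "'g::ab_group_add gen list \<Rightarrow> 'g \<times> 'g"
  where "list_degree gs = sum_list (map letter_degree gs)"

lemma list_degree_simps [simp]:
  "list_degree [] = 0" "list_degree (g # gs) = letter_degree g + list_degree gs"
  "list_degree (gs @ hs) = list_degree gs + list_degree hs"
  by (simp_all add: list_degree_def)

lemma letter_degree_flip [simp]: "letter_degree (gen_flip g) = - letter_degree g"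
  by (cases g) auto

lemma list_degree_rev_flip: "list_degree (rev (map gen_flip gs)) = - list_degree gs"
  by (induction gs) auto

definition homogeneous :: "'g::ab_group_add \<times> 'g \<Rightarrow> 'g fsa \<Rightarrow> bool"
  where "homogeneous d p \<longleftrightarrow> (\<forall>w\<in>keys p. list_degree (letters w) = d)"

lemma homogeneous_0: "homogeneous d 0"
  and homogeneous_add: "homogeneous d p \<Longrightarrow> homogeneous d q \<Longrightarrow> homogeneous d (p + q)"
  and homogeneous_uminus: "homogeneous d p \<Longrightarrow> homogeneous d (- p)"
  and homogeneous_single: "list_degree (letters w) = d \<Longrightarrow> homogeneous d (single w c)"
  using keys_add[of p q] by (auto simp: homogeneous_def in_keys_iff split: if_splits)

lemma homogeneous_diff: "homogeneous d p \<Longrightarrow> homogeneous d q \<Longrightarrow> homogeneous d (p - q)"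
  using homogeneous_add[OF _ homogeneous_uminus, of d p q] by simp

lemma homogeneous_sum: "(\<And>x. x \<in> A \<Longrightarrow> homogeneous d (f x)) \<Longrightarrow> homogeneous d (\<Sum>x\<in>A. f x)"
  by (induction A rule: infinite_finite_induct) (auto intro: homogeneous_0 homogeneous_add)

lemma homogeneous_mult:
  assumes "homogeneous d p" "homogeneous e q"
  shows "homogeneous (d + e) (p * q)"
  using assms keys_mult[of p q] by (fastforce simp: homogeneous_def plus_word_def)

lemma homogeneous_scal: "homogeneous 0 (scal c)"
  unfolding scal_def by (rule homogeneous_single) (simp add: zero_word_def)

lemma homogeneous_1: "homogeneous 0 1"
  using homogeneous_scal[of 1] by simp

lemma homogeneous_scal_mult: "homogeneous d p \<Longrightarrow> homogeneous d (scal c * p)"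
  using homogeneous_mult[OF homogeneous_scal] by fastforce

lemma homogeneous_fund: "homogeneous (i, j) (fund i j)"
  and homogeneous_fund_st: "homogeneous (- i, - j) (fund_st i j)"
  by (auto simp: fund_def fund_st_def intro!: homogeneous_single)

lemma homogeneous_star:
  assumes "homogeneous d p"
  shows "homogeneous (- d) (fsa_star p)"
  unfolding fsa_star_def
  using assms by (intro homogeneous_sum homogeneous_single) (simp add: list_degree_rev_flip homogeneous_def)

lemma sum_single_keys: "(\<Sum>w\<in>keys p. single w (lookup p w)) = (p :: 'k \<Rightarrow>\<^sub>0 complex)"
proof -
  have "key_sum single p = p"
    by (rule additive_eqI[of "key_sum single" "\<lambda>p. p"])
      (simp_all add: key_sum_add[of single] key_sum_single single_add)
  then show ?thesis by (simp add: key_sum_def)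
qed

locale graded_phase = bicharacter \<beta>
  for \<beta> :: "('g::{finite, ab_group_add}) \<times> 'g \<Rightarrow> 'g \<times> 'g \<Rightarrow> complex"
begin

text \<open>
  The phase of a starred generator is forced by the relation that makes it proportional to \<open>u\<^sup>-\<^sup>i\<^sub>-\<^sub>j\<close>: both have to
  acquire phases whose quotient is the change of the proportionality factor.
\<close>

definition letter_phase :: "'g gen \<Rightarrow> complex"
  where "letter_phase g = (case g of Gen i j \<Rightarrow> 1 | Gen_star i j \<Rightarrow> \<beta> (i, j) (i, j))"

fun list_phase :: "'g gen list \<Rightarrow> complex"
  where "list_phase [] = 1"
  | "list_phase (g # gs) = letter_phase g * \<beta> (letter_degree g) (list_degree gs) * list_phase gs"

lemma list_phase_append:
  "list_phase (gs @ hs) = list_phase gs * list_phase hs * \<beta> (list_degree gs) (list_degree hs)"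
  by (induction gs) (simp_all add: simps)

lemma cnj_letter_phase: "letter_phase (gen_flip g) = cnj (letter_phase g) * \<beta> (letter_degree g) (letter_degree g)"
proof -
  have "\<beta> (- i, - j) (- i, - j) = \<beta> (i, j) (i, j)" for i j
    using minus_left[of "(i, j)" "(- i, - j)"] minus_right[of "(i, j)" "(i, j)"] by simp
  then show ?thesis
    by (cases g) (simp_all add: letter_phase_def cnj)
qed

lemma list_phase_nz: "list_phase gs \<noteq> 0"
  by (induction gs) (auto simp: letter_phase_def split: gen.splits)

lemma list_phase_star:
  "list_phase (rev (map gen_flip gs)) = cnj (list_phase gs) * \<beta> (list_degree gs) (list_degree gs)"
proof (induction gs)
  case (Cons g gs)
  then show ?case
    by (simp add: list_phase_append list_degree_rev_flip cnj_letter_phase simps list_phase_nz)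
qed simp

definition rescale :: "'g fsa \<Rightarrow> 'g fsa"
  where "rescale = key_sum (\<lambda>w c. single w (list_phase (letters w) * c))"

lemma rescale_single: "rescale (single w c) = single w (list_phase (letters w) * c)"
  by (simp add: rescale_def key_sum_single)

lemma rescale_add: "rescale (p + q) = rescale p + rescale q"
  unfolding rescale_def by (rule key_sum_add) (simp_all add: ring_distribs single_add)

lemmas rescale_zero = additive_zero[of rescale, OF rescale_add]
lemmas rescale_minus = additive_minus[of rescale, OF rescale_add]
lemmas rescale_sum = additive_sum[of rescale, OF rescale_add]

text \<open>
  Up to the cocycle \<open>\<beta>\<close>, rescaling is multiplicative. On the rescaled algebra the original product therefore becomes the
  product twisted by \<open>\<beta>\<close>.
\<close>

lemma rescale_mult:
  assumes "homogeneous d p" "homogeneous e q"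
  shows "rescale (p * q) = scal (\<beta> d e) * (rescale p * rescale q)"
proof -
  have *: "rescale (single v a * single w b) =
      scal (\<beta> d e) * (rescale (single v a) * rescale (single w b))"
    if "v \<in> keys p" "w \<in> keys q" for v w a b
    using that assms
    by (simp add: rescale_single mult_single plus_word_def list_phase_append homogeneous_def scal_mult_single
        algebra_simps)
  have "rescale ((\<Sum>v\<in>keys p. single v (lookup p v)) * (\<Sum>w\<in>keys q. single w (lookup q w))) =
    scal (\<beta> d e) * (rescale (\<Sum>v\<in>keys p. single v (lookup p v)) * rescale (\<Sum>w\<in>keys q. single w (lookup q w)))"
    unfolding sum_product rescale_sum unfolding sum_distrib_left by (intro sum.cong refl *)
  then show ?thesis by (simp add: sum_single_keys)
qed

lemma rescale_star:
  assumes "homogeneous d p"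
  shows "rescale (fsa_star p) = scal (\<beta> d d) * fsa_star (rescale p)"
proof -
  have "rescale (fsa_star (single v a)) = scal (\<beta> d d) * fsa_star (rescale (single v a))"
    if "v \<in> keys p" for v a
    using that assms
    by (simp add: rescale_single fsa_star_simps word_star_def list_phase_star homogeneous_def scal_mult_single mult_ac)
  then have "rescale (fsa_star (\<Sum>v\<in>keys p. single v (lookup p v))) =
    scal (\<beta> d d) * fsa_star (rescale (\<Sum>v\<in>keys p. single v (lookup p v)))"
    by (simp add: fsa_star_simps rescale_sum sum_distrib_left)
  then show ?thesis by (simp add: sum_single_keys)
qed

lemma rescale_scal: "rescale (scal c) = scal c"
  and rescale_fund: "rescale (fund i j) = fund i j"
  and rescale_fund_st: "rescale (fund_st i j) = scal (\<beta> (i, j) (i, j)) * fund_st i j"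
  by (simp_all add: scal_def rescale_single zero_word_def fund_def fund_st_def letter_phase_def mult_single plus_word_def)

lemma rescale_scal_mult: "rescale (scal c * p) = scal c * rescale p"
  by (rule additive_eqI[of "\<lambda>p. rescale (scal c * p)" "\<lambda>p. scal c * rescale p"])
    (simp_all add: rescale_add ring_distribs scal_mult_single rescale_single mult.left_commute)

text \<open>
  Rescaling is multiplicative only up to phases that depend on the degrees, so the preimage of an ideal need not be an
  ideal. The sums of homogeneous elements in the preimage do form one.
\<close>

inductive_set homogeneous_span :: "'g fsa set \<Rightarrow> 'g fsa set"
  for J where
    zero: "0 \<in> homogeneous_span J"
  | add: "homogeneous d x \<Longrightarrow> rescale x \<in> J \<Longrightarrow> y \<in> homogeneous_span J \<Longrightarrow> x + y \<in> homogeneous_span J"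

lemma homogeneous_span_add:
  "p \<in> homogeneous_span J \<Longrightarrow> q \<in> homogeneous_span J \<Longrightarrow> p + q \<in> homogeneous_span J"
  by (induction p rule: homogeneous_span.induct) (auto simp: add.assoc intro: homogeneous_span.intros)

lemma homogeneous_span_base: "homogeneous d x \<Longrightarrow> rescale x \<in> J \<Longrightarrow> x \<in> homogeneous_span J"
  using homogeneous_span.intros by fastforce

lemma star_ideal_homogeneous_span:
  assumes "star_ideal J"
  shows "star_ideal (homogeneous_span J)"
proof -
  interpret fsa_ideal J by standard fact
  have single: "single v c * p \<in> homogeneous_span J \<and> p * single v c \<in> homogeneous_span J"
    if "p \<in> homogeneous_span J" for v c p
    using that
  proof (induction p rule: homogeneous_span.induct)
    case zero
    show ?case by (simp add: homogeneous_span.zero)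
  next
    case (add d x y)
    have v: "homogeneous (list_degree (letters v)) (single v c)"
      by (simp add: homogeneous_single)
    show ?case
      using add unfolding ring_distribs
      by (intro conjI homogeneous_span.add[OF homogeneous_mult[OF v add(1)]]
          homogeneous_span.add[OF homogeneous_mult[OF add(1) v]])
        (simp_all add: rescale_mult[OF v] rescale_mult[OF _ v] left_mem right_mem)
  qed
  have "q * p \<in> homogeneous_span J \<and> p * q \<in> homogeneous_span J" if "p \<in> homogeneous_span J" for p q
    by (induction q rule: poly_mapping_add_induct)
      (use that in \<open>auto simp: single ring_distribs homogeneous_span.zero intro: homogeneous_span_add\<close>)
  moreover have "fsa_star p \<in> homogeneous_span J" if "p \<in> homogeneous_span J" for p
    using that
  proof (induction p rule: homogeneous_span.induct)
    case zero
    show ?case by (simp add: fsa_star_simps homogeneous_span.zero)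
  next
    case (add d x y)
    then show ?case
      unfolding fsa_star_simps
      by (intro homogeneous_span.add[OF homogeneous_star[OF add(1)]])
        (simp_all add: rescale_star left_mem star_mem)
  qed
  ultimately show ?thesis
    by (auto simp: star_ideal_def homogeneous_span.zero homogeneous_span_add)
qed

lemma rescale_homogeneous_span:
  assumes "star_ideal J" "p \<in> homogeneous_span J"
  shows "rescale p \<in> J"
  using assms(2)
proof (induction p rule: homogeneous_span.induct)
  case zero
  show ?case using assms(1) by (simp add: rescale_zero star_ideal_def)
next
  case (add d x y)
  then show ?case using assms(1) by (simp add: rescale_add star_ideal_def)
qed

end

text \<open>
  The twist is two-sided: rows are twisted by the conjugate of \<open>\<sigma>\<close> and columns by \<open>\<sigma>\<close> itself, in agreement with the
  phases that \<open>twist_tmat\<close> puts on outputs and inputs.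
\<close>

definition bidegree_phase :: "('g \<Rightarrow> 'g \<Rightarrow> complex) \<Rightarrow> 'g \<times> 'g \<Rightarrow> 'g \<times> 'g \<Rightarrow> complex"
  where "bidegree_phase \<sigma> d e = cnj (\<sigma> (fst d) (fst e)) * \<sigma> (snd d) (snd e)"

lemma bidegree_phase_Pair [simp]: "bidegree_phase \<sigma> (i, j) (k, l) = cnj (\<sigma> i k) * \<sigma> j l"
  by (simp add: bidegree_phase_def)

lemma graded_phase_bidegree_phase: "unitary_bicharacter \<sigma> \<Longrightarrow> graded_phase (bidegree_phase \<sigma>)"
  by standard (simp add: unitary_bicharacter_def bidegree_phase_def norm_mult)

abbreviation "rescale_by \<sigma> \<equiv> graded_phase.rescale (bidegree_phase \<sigma>)"

lemma twisted_relations_quantum_aut: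
  "unitary_bicharacter \<sigma> \<Longrightarrow>
    twisted_relations \<sigma> (cayley_eigenvalue \<tau> S) (quantum_aut (twisted_cayley \<tau> \<sigma> S))"
  using quantum_aut_subset_iff aut_relations_twisted_iff fsa_ideal_quantum_aut[THEN fsa_ideal.star_ideal]
  by blast

lemma quantum_aut_twisted_subset:
  "unitary_bicharacter \<sigma> \<Longrightarrow> star_ideal J \<Longrightarrow> twisted_relations \<sigma> (cayley_eigenvalue \<tau> S) J \<Longrightarrow>
    quantum_aut (twisted_cayley \<tau> \<sigma> S) \<subseteq> J"
  using quantum_aut_subset_iff aut_relations_twisted_iff by blast

text \<open>
  Each defining relation is homogeneous and goes to a multiple of the corresponding relation for the product bicharacter.
  In the unitarity relations the phase is the same for every summand, and it is \<open>1\<close> on the diagonal, where the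
  constant term is present.
\<close>

lemma rescale_quantum_aut:
  fixes \<sigma> \<sigma>' :: "'g::{finite, ab_group_add} \<Rightarrow> 'g \<Rightarrow> complex"
  assumes \<sigma>: "unitary_bicharacter \<sigma>" and \<sigma>': "unitary_bicharacter \<sigma>'"
    and p: "p \<in> quantum_aut (twisted_cayley \<tau> \<sigma> S)"
  shows "rescale_by \<sigma>' p \<in> quantum_aut (twisted_cayley \<tau> (\<lambda>\<mu> \<nu>. \<sigma> \<mu> \<nu> * \<sigma>' \<mu> \<nu>) S)"
proof -
  let ?J = "quantum_aut (twisted_cayley \<tau> (\<lambda>\<mu> \<nu>. \<sigma> \<mu> \<nu> * \<sigma>' \<mu> \<nu>) S)"
  let ?lam = "cayley_eigenvalue \<tau> S"
  interpret s: bicharacter \<sigma> by standard fact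
  interpret s': bicharacter \<sigma>' by standard fact
  interpret g: graded_phase "bidegree_phase \<sigma>'"
    using \<sigma>' by (rule graded_phase_bidegree_phase)
  interpret J: fsa_ideal ?J by (rule fsa_ideal_quantum_aut)
  have rel: "twisted_relations (\<lambda>\<mu> \<nu>. \<sigma> \<mu> \<nu> * \<sigma>' \<mu> \<nu>) ?lam ?J"
    by (intro twisted_relations_quantum_aut unitary_bicharacter_mult \<sigma> \<sigma>')
  note rescale_simps = g.rescale_minus g.rescale_sum g.rescale_scal g.rescale_scal_mult
    g.rescale_fund g.rescale_fund_st
    g.rescale_mult[OF homogeneous_fund homogeneous_fund] g.rescale_mult[OF homogeneous_fund homogeneous_fund_st]
    g.rescale_mult[OF homogeneous_fund_st homogeneous_fund]
  note homogeneous_intros = homogeneous_diff homogeneous_sum homogeneous_scal_mult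
  have "twisted_relations \<sigma> ?lam (g.homogeneous_span ?J)"
    unfolding twisted_relations_def unitary_modulo_fund
  proof (intro conjI allI)
    fix i j :: 'g
    show "(\<Sum>k\<in>UNIV. fund i k * fund_st j k) - scal (if i = j then 1 else 0) \<in> g.homogeneous_span ?J" (is "?x \<in> _")
    proof (rule g.homogeneous_span_base)
      show "homogeneous (i - j, 0) ?x"
      proof (intro homogeneous_intros)
        show "homogeneous (i - j, 0) (fund i k * fund_st j k)" for k
          using homogeneous_mult[OF homogeneous_fund homogeneous_fund_st, of i k j k] by simp
      qed (auto simp: homogeneous_1 homogeneous_0 zero_prod_def[symmetric])
      have "rescale_by \<sigma>' ?x =
        scal (\<sigma>' i j / \<sigma>' j j) * ?x"
        by (auto simp: rescale_simps scal_simps s'.simps sum_distrib_left right_diff_distrib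
            simp del: scal_1 simp: scal_mult)
      then show "rescale_by \<sigma>' ?x \<in> ?J"
        using rel by (simp add: twisted_relations_def unitary_modulo_fund J.left_mem)
    qed
    show "(\<Sum>k\<in>UNIV. fund_st k i * fund k j) - scal (if i = j then 1 else 0) \<in> g.homogeneous_span ?J" (is "?x \<in> _")
    proof (rule g.homogeneous_span_base)
      show "homogeneous (0, j - i) ?x"
      proof (intro homogeneous_intros)
        show "homogeneous (0, j - i) (fund_st k i * fund k j)" for k
          using homogeneous_mult[OF homogeneous_fund_st homogeneous_fund, of k i k j] by simp
      qed (auto simp: homogeneous_1 homogeneous_0 zero_prod_def[symmetric])
      have "rescale_by \<sigma>' ?x =
        scal (\<sigma>' i i / \<sigma>' i j) * ?x"
        by (auto simp: rescale_simps scal_simps s'.simps sum_distrib_left right_diff_distrib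
            simp del: scal_1 simp: scal_mult)
      then show "rescale_by \<sigma>' ?x \<in> ?J"
        using rel by (simp add: twisted_relations_def unitary_modulo_fund J.left_mem)
    qed
    show "fund_st i j - scal (\<sigma> i i * cnj (\<sigma> j j)) * fund (- i) (- j) \<in> g.homogeneous_span ?J" (is "?x \<in> _")
    proof (rule g.homogeneous_span_base)
      show "homogeneous (- i, - j) ?x"
        by (intro homogeneous_intros homogeneous_fund homogeneous_fund_st)
      have "rescale_by \<sigma>' ?x =
        scal (\<sigma>' j j / \<sigma>' i i) *
          (fund_st i j - scal (\<sigma> i i * \<sigma>' i i * cnj (\<sigma> j j * \<sigma>' j j)) * fund (- i) (- j))"
        by (simp add: rescale_simps scal_simps s'.simps s.cnj right_diff_distrib)
      then show "rescale_by \<sigma>' ?x \<in> ?J"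
        using rel by (simp add: twisted_relations_def J.left_mem)
    qed
    show "scal (?lam i - ?lam j) * fund i j \<in> g.homogeneous_span ?J" (is "?x \<in> _")
    proof (rule g.homogeneous_span_base)
      show "homogeneous (i, j) ?x"
        by (intro homogeneous_intros homogeneous_fund)
      show "rescale_by \<sigma>' ?x \<in> ?J"
        using rel by (simp add: twisted_relations_def rescale_simps)
    qed
    fix k
    let ?x = "(\<Sum>a\<in>UNIV. scal (cnj (\<sigma> a (i - a))) * (fund a j * fund (i - a) k)) -
      scal (cnj (\<sigma> j k)) * fund i (j + k)"
    show "?x \<in> g.homogeneous_span ?J"
    proof (rule g.homogeneous_span_base)
      show "homogeneous (i, j + k) ?x"
        using homogeneous_mult[OF homogeneous_fund homogeneous_fund, of _ j _ k]
        by (intro homogeneous_intros homogeneous_fund) (metis add_Pair diff_add_cancel add.commute)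
      have "rescale_by \<sigma>' ?x = scal (\<sigma>' j k) *
        ((\<Sum>a\<in>UNIV. scal (cnj (\<sigma> a (i - a) * \<sigma>' a (i - a))) * (fund a j * fund (i - a) k)) -
          scal (cnj (\<sigma> j k * \<sigma>' j k)) * fund i (j + k))"
        by (simp add: rescale_simps scal_simps s'.cnj s.cnj right_diff_distrib sum_distrib_left)
      then show "rescale_by \<sigma>' ?x \<in> ?J"
        using rel by (simp add: twisted_relations_def J.left_mem)
    qed
  qed
  then have "quantum_aut (twisted_cayley \<tau> \<sigma> S) \<subseteq> g.homogeneous_span ?J"
    by (intro quantum_aut_twisted_subset \<sigma> g.star_ideal_homogeneous_span J.star_ideal)
  then show ?thesis
    using p g.rescale_homogeneous_span J.star_ideal by blast
qed

section \<open>Twisting intertwiners\<close>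

lemma sigma_multi_Nil [simp]: "sigma_multi \<sigma> [] = 1"
  by (simp add: sigma_multi_def)

context bicharacter
begin

lemma sigma_multi_Cons [simp]: "sigma_multi \<sigma> (a # p) = \<sigma> a (sum_list p) * sigma_multi \<sigma> p"
proof -
  have "(\<Prod>b<length p. \<sigma> a (p ! b)) = \<sigma> a (sum_list p)"
    by (induction p) (simp_all add: prod.lessThan_Suc_shift simps del: prod.lessThan_Suc)
  then show ?thesis
    by (simp add: sigma_multi_def prod.lessThan_Suc_shift prod.distrib del: prod.lessThan_Suc)
qed

lemma sigma_multi_append:
  "sigma_multi \<sigma> (p @ q) = sigma_multi \<sigma> p * sigma_multi \<sigma> q * \<sigma> (sum_list p) (sum_list q)"
  by (induction p) (simp_all add: simps)

lemma sigma_multi_nz [simp]: "sigma_multi \<sigma> p \<noteq> 0"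
  by (induction p) auto

lemma cnj_sigma_multi: "cnj (sigma_multi \<sigma> p) = 1 / sigma_multi \<sigma> p"
  by (induction p) (simp_all add: cnj)

lemma rescale_fund_power:
  assumes "length p = length q"
  shows "rescale_by \<sigma> (fund_power p q) = scal (cnj (sigma_multi \<sigma> p) * sigma_multi \<sigma> q) * fund_power p q"
proof -
  interpret g: graded_phase "bidegree_phase \<sigma>"
    using unitary_bicharacter by (rule graded_phase_bidegree_phase)
  show ?thesis using assms
  proof (induction p q rule: list_induct2)
    case Nil
    show ?case using g.rescale_scal[of 1] by simp
  next
    case (Cons a p b q)
    have "homogeneous (sum_list p, sum_list q) (fund_power p q)"
      using Cons(1)
    proof (induction p q rule: list_induct2)
      case Nil
      show ?case using homogeneous_scal[of 1] by (simp add: zero_prod_def)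
    next
      case (Cons a p b q)
      then show ?case using homogeneous_mult[OF homogeneous_fund, of _ _ a b] by fastforce
    qed
    then show ?case
      using Cons by (simp add: g.rescale_mult[OF homogeneous_fund] g.rescale_fund scal_simps
          algebra_simps)
  qed
qed

end

text \<open>
  The monomial of row multiindex \<open>p\<close> and column multiindex \<open>j\<close> is rescaled by \<open>cnj \<sigma>\<^sub>p \<sigma>\<^sub>j\<close>. Multiplied by \<open>\<sigma>\<^sub>i cnj \<sigma>\<^sub>j\<close>,
  the rescaled \<open>(i, j)\<close> defect of \<open>T\<close> is the defect of the twisted \<open>T\<close>.
\<close>

lemma twist_tmat_intertwiner:
  fixes \<sigma> \<sigma>' :: "'g::{finite, ab_group_add} \<Rightarrow> 'g \<Rightarrow> complex"
  assumes \<sigma>: "unitary_bicharacter \<sigma>" and \<sigma>': "unitary_bicharacter \<sigma>'"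
    and T: "T \<in> intertwiners (quantum_aut (twisted_cayley \<tau> \<sigma> S)) k l"
  shows "twist_tmat \<sigma>' T \<in> intertwiners (quantum_aut (twisted_cayley \<tau> (\<lambda>\<mu> \<nu>. \<sigma> \<mu> \<nu> * \<sigma>' \<mu> \<nu>) S)) k l"
proof -
  let ?J = "quantum_aut (twisted_cayley \<tau> (\<lambda>\<mu> \<nu>. \<sigma> \<mu> \<nu> * \<sigma>' \<mu> \<nu>) S)"
  interpret s': bicharacter \<sigma>' by standard fact
  interpret g: graded_phase "bidegree_phase \<sigma>'"
    using \<sigma>' by (rule graded_phase_bidegree_phase)
  interpret J: fsa_ideal ?J by (rule fsa_ideal_quantum_aut)
  show ?thesis
    unfolding intertwiners_eq
  proof (intro CollectI conjI allI impI)
    show "twist_tmat \<sigma>' T \<in> tmats k l"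
      using T by (auto simp: intertwiners_eq tmats_def twist_tmat_def)
    fix i j :: "'g list"
    assume l: "length i = l" and k: "length j = k"
    then have "rescale_by \<sigma>' (intertwining_defect k l T i j) \<in> ?J"
      using T by (intro rescale_quantum_aut \<sigma> \<sigma>') (simp add: intertwiners_eq)
    moreover have "intertwining_defect k l (twist_tmat \<sigma>' T) i j =
      scal (sigma_multi \<sigma>' i / sigma_multi \<sigma>' j) * rescale_by \<sigma>' (intertwining_defect k l T i j)"
    proof -
      let ?c = "sigma_multi \<sigma>' i / sigma_multi \<sigma>' j"
      have 1: "scal (twist_tmat \<sigma>' T i p) * fund_power p j =
          scal ?c * (scal (T i p) * rescale_by \<sigma>' (fund_power p j))" if "length p = k" for p
        using that k by (simp add: s'.rescale_fund_power scal_scal twist_tmat_def s'.cnj_sigma_multi mult.commute)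
      have 2: "scal (twist_tmat \<sigma>' T q j) * fund_power i q =
          scal ?c * (scal (T q j) * rescale_by \<sigma>' (fund_power i q))" if "length q = l" for q
        using that l by (simp add: s'.rescale_fund_power scal_scal twist_tmat_def s'.cnj_sigma_multi mult.commute)
      show ?thesis
        by (simp add: intertwining_defect_def g.rescale_minus g.rescale_sum g.rescale_scal_mult
            right_diff_distrib sum_distrib_left 1 2)
    qed
    ultimately show "intertwining_defect k l (twist_tmat \<sigma>' T) i j \<in> ?J"
      by (simp add: J.left_mem)
  qed
qed

lemma twist_tmat_cnj:
  fixes \<sigma> :: "'g::{finite, ab_group_add} \<Rightarrow> 'g \<Rightarrow> complex"
  assumes "unitary_bicharacter \<sigma>"
  shows "twist_tmat \<sigma> (twist_tmat (\<lambda>\<mu> \<nu>. cnj (\<sigma> \<mu> \<nu>)) T) = T"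
    and "twist_tmat (\<lambda>\<mu> \<nu>. cnj (\<sigma> \<mu> \<nu>)) (twist_tmat \<sigma> T) = T"
proof -
  interpret bicharacter \<sigma> by standard fact
  have "sigma_multi (\<lambda>\<mu> \<nu>. cnj (\<sigma> \<mu> \<nu>)) p = cnj (sigma_multi \<sigma> p)" for p
    by (simp add: sigma_multi_def)
  then show "twist_tmat \<sigma> (twist_tmat (\<lambda>\<mu> \<nu>. cnj (\<sigma> \<mu> \<nu>)) T) = T"
    "twist_tmat (\<lambda>\<mu> \<nu>. cnj (\<sigma> \<mu> \<nu>)) (twist_tmat \<sigma> T) = T"
    by (auto simp: twist_tmat_def cnj_sigma_multi)
qed

text \<open>
  Twisting by the conjugate bicharacter leads back, so the inclusion of the previous lemma is an equality.
\<close>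

lemma intertwiners_twisted:
  fixes \<sigma> :: "'g::{finite, ab_group_add} \<Rightarrow> 'g \<Rightarrow> complex"
  assumes "unitary_bicharacter \<sigma>"
  shows "intertwiners (quantum_aut (twisted_cayley \<tau> \<sigma> S)) k l =
    twist_tmat \<sigma> ` intertwiners (quantum_aut (twisted_cayley \<tau> trivial_bicharacter S)) k l"
proof -
  interpret bicharacter \<sigma> by standard fact
  have *: "(\<lambda>\<mu> \<nu>. \<sigma> \<mu> \<nu> * cnj (\<sigma> \<mu> \<nu>)) = trivial_bicharacter" "(\<lambda>\<mu> \<nu>. trivial_bicharacter \<mu> \<nu> * \<sigma> \<mu> \<nu>) = \<sigma>"
    by (simp_all add: fun_eq_iff trivial_bicharacter_def cnj)
  show ?thesis
    using twist_tmat_intertwiner[OF unitary_bicharacter_trivial assms]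
      twist_tmat_intertwiner[OF assms unitary_bicharacter_cnj[OF assms]] twist_tmat_cnj(1)[OF assms, symmetric]
    by (fastforce simp: *)
qed


lemma fsa_star_fund_mult: "fsa_star (fund i j * q) = fsa_star q * fund_st i j"
  by (simp add: fsa_star_simps)

section \<open>Tensor products and the comultiplication\<close>

lemma pure_tensor_key_sum:
  "pure_tensor p q = key_sum (\<lambda>v a. key_sum (\<lambda>w b. single (v, w) (a * b)) q) p"
  by (simp add: pure_tensor_def key_sum_def)

lemma pure_tensor_single: "pure_tensor (single v a) (single w b) = single (v, w) (a * b)"
  by (simp add: pure_tensor_key_sum key_sum_single key_sum_def[of "\<lambda>w b. 0"])

lemma pure_tensor_add_right: "pure_tensor p (q + r) = pure_tensor p q + pure_tensor p r"
  by (simp add: pure_tensor_key_sum key_sum_add ring_distribs single_add)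
    (simp add: key_sum_def sum.distrib)

lemma pure_tensor_add_left: "pure_tensor (p + q) r = pure_tensor p r + pure_tensor q r"
  unfolding pure_tensor_key_sum
  by (rule key_sum_add) (simp_all add: key_sum_def sum.distrib ring_distribs single_add)

lemmas pure_tensor_simps =
  additive_zero[of "pure_tensor p" for p, OF pure_tensor_add_right]
  additive_zero[of "\<lambda>p. pure_tensor p q" for q, OF pure_tensor_add_left]
  additive_minus[of "pure_tensor p" for p, OF pure_tensor_add_right]
  additive_minus[of "\<lambda>p. pure_tensor p q" for q, OF pure_tensor_add_left]
  additive_sum[of "pure_tensor p" for p, OF pure_tensor_add_right]
  additive_sum[of "\<lambda>p. pure_tensor p q" for q, OF pure_tensor_add_left]

lemma pure_tensor_mult: "pure_tensor p q * pure_tensor p' q' = pure_tensor (p * p') (q * q')"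
proof (induction p rule: poly_mapping_add_induct)
  case p: (single v a)
  show ?case
  proof (induction q rule: poly_mapping_add_induct)
    case q: (single w b)
    show ?case
    proof (induction p' rule: poly_mapping_add_induct)
      case p': (single v' a')
      show ?case
        by (induction q' rule: poly_mapping_add_induct)
          (simp_all add: pure_tensor_single mult_single pure_tensor_simps pure_tensor_add_left
            pure_tensor_add_right ring_distribs mult_ac)
    qed (simp_all add: pure_tensor_simps pure_tensor_add_left ring_distribs)
  qed (simp_all add: pure_tensor_simps pure_tensor_add_right ring_distribs)
qed (simp_all add: pure_tensor_simps pure_tensor_add_left ring_distribs)

lemma pure_tensor_scal: "pure_tensor (scal a) (scal b) = scal (a * b)"
  by (simp add: scal_def pure_tensor_single zero_prod_def)

lemma pure_tensor_scal_1: "pure_tensor (scal c) 1 = scal c" "pure_tensor 1 (scal c) = scal c"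
  using pure_tensor_scal[of c 1] pure_tensor_scal[of 1 c] by simp_all

lemma pure_tensor_scal_left: "pure_tensor (scal c * p) q = scal c * pure_tensor p q"
  and pure_tensor_scal_right: "pure_tensor p (scal c * q) = scal c * pure_tensor p q"
  by (metis pure_tensor_mult pure_tensor_scal scal_1 mult_1_left mult_1_right)+

definition tensor_star :: "'i fsa2 \<Rightarrow> 'i fsa2"
  where "tensor_star = anti_push cnj (map_prod word_star word_star)"

interpretation tensor_star: anti_hom cnj "map_prod word_star word_star :: 'i gen word \<times> 'i gen word \<Rightarrow> _"
  by standard (auto simp: word_star_def plus_word_def zero_word_def zero_prod_def)

lemmas tensor_star_simps =
  tensor_star.push_add[folded tensor_star_def] tensor_star.push_zero[folded tensor_star_def]
  tensor_star.push_sum[folded tensor_star_def]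
  tensor_star.push_scal[folded tensor_star_def] tensor_star.push_mult[folded tensor_star_def]
  tensor_star.push_single[folded tensor_star_def]

lemma tensor_star_pure_tensor: "tensor_star (pure_tensor p q) = pure_tensor (fsa_star p) (fsa_star q)"
proof (induction p rule: poly_mapping_add_induct)
  case (single v a)
  show ?case
    by (induction q rule: poly_mapping_add_induct)
      (simp_all add: pure_tensor_single pure_tensor_simps pure_tensor_add_right tensor_star_simps fsa_star_simps)
qed (simp_all add: pure_tensor_simps pure_tensor_add_left tensor_star_simps fsa_star_simps)

lemma comult_add: "comult (p + q) = comult p + comult q"
  and comult_minus: "comult (p - q) = comult p - comult q"
  and comult_mult: "comult (p * q) = comult p * comult q"
  and comult_sum: "comult (\<Sum>x\<in>A. h x) = (\<Sum>x\<in>A. comult (h x))"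
  and comult_scal: "comult (scal c) = scal c"
  and comult_fund: "comult (fund i j) = (\<Sum>k\<in>UNIV. pure_tensor (fund i k) (fund k j))"
  and comult_fund_st: "comult (fund_st i j) = (\<Sum>k\<in>UNIV. pure_tensor (fund_st i k) (fund_st k j))"
  by (simp_all add: comult_def scal.ext_simps)

lemma comult_star: "comult (fsa_star p) = tensor_star (comult p)"
  unfolding comult_def
proof (rule scal.ext_star)
  fix g :: "'a gen"
  show "(case gen_flip g of
      Gen i j \<Rightarrow> \<Sum>k\<in>UNIV. pure_tensor (fund i k) (fund k j)
    | Gen_star i j \<Rightarrow> \<Sum>k\<in>UNIV. pure_tensor (fund_st i k) (fund_st k j)) =
    tensor_star (case g of
      Gen i j \<Rightarrow> \<Sum>k\<in>UNIV. pure_tensor (fund i k) (fund k j)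
    | Gen_star i j \<Rightarrow> \<Sum>k\<in>UNIV. pure_tensor (fund_st i k) (fund_st k j))"
    by (cases g) (simp_all add: tensor_star_simps tensor_star_pure_tensor)
qed (simp_all add: tensor_star_simps)

lemma tensor_kernel_induct [consumes 1, case_names zero add]:
  assumes "x \<in> tensor_kernel I" "P 0"
    and add: "\<And>p q y. p \<in> I \<or> q \<in> I \<Longrightarrow> y \<in> tensor_kernel I \<Longrightarrow> P y \<Longrightarrow> P (pure_tensor p q + y)"
  shows "P x"
proof -
  have "P (sum_list (map (\<lambda>(p, q). pure_tensor p q) xs))" if "\<forall>(p, q)\<in>set xs. p \<in> I \<or> q \<in> I" for xs
    using that
  proof (induction xs)
    case (Cons pq xs)
    have "sum_list (map (\<lambda>(p, q). pure_tensor p q) xs) \<in> tensor_kernel I"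
      using Cons.prems by (auto simp: tensor_kernel_def)
    with Cons add show ?case by (auto split: prod.splits)
  qed (simp add: assms)
  then show ?thesis using assms(1) by (auto simp: tensor_kernel_def)
qed

lemma pure_tensor_add_mem:
  assumes "p \<in> I \<or> q \<in> I" "y \<in> tensor_kernel I"
  shows "pure_tensor p q + y \<in> tensor_kernel I"
proof -
  obtain xs where "\<forall>(p, q)\<in>set xs. p \<in> I \<or> q \<in> I" "y = sum_list (map (\<lambda>(p, q). pure_tensor p q) xs)"
    using assms(2) by (auto simp: tensor_kernel_def)
  then show ?thesis
    using assms(1) by (auto simp: tensor_kernel_def intro!: exI[of _ "(p, q) # xs"])
qed

lemma tensor_kernel_zero: "0 \<in> tensor_kernel I"
  by (auto simp: tensor_kernel_def intro!: exI[of _ "[]"])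

lemma pure_tensor_mem: "p \<in> I \<or> q \<in> I \<Longrightarrow> pure_tensor p q \<in> tensor_kernel I"
  using pure_tensor_add_mem[OF _ tensor_kernel_zero] by fastforce

lemma tensor_kernel_add:
  "x \<in> tensor_kernel I \<Longrightarrow> y \<in> tensor_kernel I \<Longrightarrow> x + y \<in> tensor_kernel I"
  by (induction x rule: tensor_kernel_induct) (auto simp: add.assoc pure_tensor_add_mem)

lemma two_sided_ideal_tensor_kernel:
  assumes "two_sided_ideal I"
  shows "two_sided_ideal (tensor_kernel I)"
proof -
  interpret two_sided_ideal I by fact
  have single: "single vw c * x \<in> tensor_kernel I \<and> x * single vw c \<in> tensor_kernel I"
    if "x \<in> tensor_kernel I" for x vw c
    using that
  proof (induction x rule: tensor_kernel_induct)
    case zero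
    show ?case by (simp add: tensor_kernel_zero)
  next
    case (add p q y)
    have "single vw c = pure_tensor (single (fst vw) c) (single (snd vw) 1)"
      by (simp add: pure_tensor_single)
    moreover have "a * p \<in> I \<or> b * q \<in> I" "p * a \<in> I \<or> q * b \<in> I" for a b
      using add(1) left_mem right_mem by blast+
    ultimately show ?case
      using add by (simp add: ring_distribs pure_tensor_mult pure_tensor_add_mem)
  qed
  have *: "y * x \<in> tensor_kernel I \<and> x * y \<in> tensor_kernel I" if "x \<in> tensor_kernel I" for x y
    by (induction y rule: poly_mapping_add_induct)
      (use that in \<open>auto simp: ring_distribs tensor_kernel_zero single tensor_kernel_add\<close>)
  show ?thesis
    by standard (use * in \<open>auto simp: tensor_kernel_zero tensor_kernel_add\<close>)
qed

lemma (in fsa_ideal) tensor_star_mem: "x \<in> tensor_kernel I \<Longrightarrow> tensor_star x \<in> tensor_kernel I"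
  by (induction x rule: tensor_kernel_induct)
    (auto simp: tensor_star_simps tensor_kernel_zero tensor_star_pure_tensor star_mem intro!: pure_tensor_add_mem)

lemma (in fsa_ideal) star_ideal_comult_preimage: "star_ideal {p. comult p \<in> tensor_kernel I}"
  by (rule star_ideal_preimage[where st = tensor_star])
    (simp_all add: two_sided_ideal_tensor_kernel two_sided_ideal_axioms tensor_star_mem
      comult_add comult_mult comult_star)

section \<open>The Hopf algebra of the twisted Cayley graph\<close>

text \<open>
  The entry \<open>S(u\<^sup>i\<^sub>j)\<close> is \<open>(u\<^sup>j\<^sub>i)\<^sup>*\<close> by unitarity. That \<open>S\<close> sends \<open>(u\<^sup>i\<^sub>j)\<^sup>*\<close> back to \<open>u\<^sup>j\<^sub>i\<close> reflects that the canonical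
  functional is a trace: the square of the antipode is the identity.
\<close>

fun gen_antipode :: "'i gen \<Rightarrow> 'i gen"
  where "gen_antipode (Gen i j) = Gen_star j i"
  | "gen_antipode (Gen_star i j) = Gen j i"

definition word_antipode :: "'i gen word \<Rightarrow> 'i gen word"
  where "word_antipode w = Word (rev (map gen_antipode (letters w)))"

definition antipode :: "'i fsa \<Rightarrow> 'i fsa"
  where "antipode = anti_push (\<lambda>c. c) word_antipode"

interpretation antipode: anti_hom "\<lambda>c. c" word_antipode
  by standard (auto simp: word_antipode_def plus_word_def zero_word_def)

lemmas antipode_simps =
  antipode.push_add[folded antipode_def] antipode.push_zero[folded antipode_def]
  antipode.push_minus[folded antipode_def]
  antipode.push_sum[folded antipode_def] antipode.push_one[folded antipode_def]
  antipode.push_scal[folded antipode_def] antipode.push_scal_mult[folded antipode_def]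
  antipode.push_mult[folded antipode_def] antipode.push_single[folded antipode_def]

lemma antipode_fund [simp]: "antipode (fund i j) = fund_st j i"
  and antipode_fund_st [simp]: "antipode (fund_st i j) = fund j i"
  by (simp_all add: fund_def fund_st_def antipode_simps word_antipode_def)

lemma antipode_fund_mult [simp]: "antipode (fund i j * q) = antipode q * fund_st j i"
  and antipode_fund_st_mult [simp]: "antipode (fund_st i j * q) = antipode q * fund j i"
  by (simp_all add: antipode_simps)

lemma antipode_star: "antipode (fsa_star p) = fsa_star (antipode p)"
proof -
  have *: "gen_antipode (gen_flip g) = gen_flip (gen_antipode g)" for g :: "'a gen"
    by (cases g) auto
  show ?thesis
    by (rule additive_eqI[of "\<lambda>p. antipode (fsa_star p)" "\<lambda>p. fsa_star (antipode p)"])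
      (simp_all add: * antipode_simps fsa_star_simps word_star_def word_antipode_def rev_map comp_def)
qed

text \<open>
  The value at the diagonal matrix with entries \<open>ch i\<close>. If \<open>ch\<close> is the character \<open>\<lambda>\<mu>. \<tau> \<mu> \<alpha>\<close>, this matrix is the translation by \<open>\<alpha>\<close> in the
  basis of characters; if \<open>ch\<close> is constantly \<open>1\<close>, the value is the counit of the Hopf algebra.
\<close>

definition evaluation :: "('g \<Rightarrow> complex) \<Rightarrow> 'g fsa \<Rightarrow> complex"
  where "evaluation ch = alg_ext (\<lambda>c. c) (\<lambda>g. case g of
      Gen i j \<Rightarrow> if i = j then ch i else 0 | Gen_star i j \<Rightarrow> if i = j then cnj (ch i) else 0)"

lemma hopf_counit_eq: "hopf_counit = evaluation (\<lambda>i. 1)"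
  unfolding hopf_counit_def evaluation_def complex_cnj_one ..

lemma evaluation_add: "evaluation ch (p + q) = evaluation ch p + evaluation ch q"
  and evaluation_minus: "evaluation ch (p - q) = evaluation ch p - evaluation ch q"
  and evaluation_mult: "evaluation ch (p * q) = evaluation ch p * evaluation ch q"
  and evaluation_sum: "evaluation ch (\<Sum>x\<in>A. h x) = (\<Sum>x\<in>A. evaluation ch (h x))"
  and evaluation_scal: "evaluation ch (scal c) = c"
  and evaluation_zero: "evaluation ch 0 = 0"
  and evaluation_one: "evaluation ch 1 = 1"
  and evaluation_fund: "evaluation ch (fund i j) = (if i = j then ch i else 0)"
  and evaluation_fund_st: "evaluation ch (fund_st i j) = (if i = j then cnj (ch i) else 0)"
  by (simp_all add: evaluation_def complex_id.ext_simps)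

lemmas evaluation_simps = evaluation_add evaluation_minus evaluation_mult evaluation_sum evaluation_scal
  evaluation_zero evaluation_one evaluation_fund evaluation_fund_st

lemma evaluation_star: "evaluation ch (fsa_star p) = cnj (evaluation ch p)"
  unfolding evaluation_def
proof (rule complex_id.ext_star)
  fix g :: "'a gen"
  show "(case gen_flip g of Gen i j \<Rightarrow> if i = j then ch i else 0 | Gen_star i j \<Rightarrow> if i = j then cnj (ch i) else 0) =
    cnj (case g of Gen i j \<Rightarrow> if i = j then ch i else 0 | Gen_star i j \<Rightarrow> if i = j then cnj (ch i) else 0)"
    by (cases g) auto
qed simp_all

lemma star_ideal_evaluation_kernel: "star_ideal {p. evaluation ch p \<in> {0}}"
  by (rule star_ideal_preimage[where st = cnj])
    (auto simp: two_sided_ideal_def evaluation_add evaluation_mult evaluation_star)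

locale twisted_ideal = bicharacter \<sigma> + fsa_ideal J
  for \<sigma> :: "'g::{finite, ab_group_add} \<Rightarrow> 'g \<Rightarrow> complex" and J :: "'g fsa set" +
  fixes lam :: "'g \<Rightarrow> complex"
  assumes relations: "twisted_relations \<sigma> lam J"
    and least: "star_ideal I \<Longrightarrow> twisted_relations \<sigma> lam I \<Longrightarrow> J \<subseteq> I"
begin

notation eqv (infix "\<doteq>" 50)

lemma fund_fund_st: "(\<Sum>k\<in>UNIV. fund i k * fund_st j k) \<doteq> scal (if i = j then 1 else 0)"
  and fund_st_fund: "(\<Sum>k\<in>UNIV. fund_st k i * fund k j) \<doteq> scal (if i = j then 1 else 0)"
  and fund_st_eqv: "fund_st i j \<doteq> scal (\<sigma> i i * cnj (\<sigma> j j)) * fund (- i) (- j)"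
  and fund_mult: "(\<Sum>a\<in>UNIV. scal (cnj (\<sigma> a (i - a))) * (fund a j * fund (i - a) k)) \<doteq>
      scal (cnj (\<sigma> j k)) * fund i (j + k)"
  and fund_adj: "scal (lam i - lam j) * fund i j \<in> J"
  using relations unfolding twisted_relations_def unitary_modulo_fund eqv_def by blast+

lemma fund_eqv: "fund i j \<doteq> scal (cnj (\<sigma> i i) * \<sigma> j j) * fund_st (- i) (- j)"
  using eqv_star[OF fund_st_eqv[of i j]] by (simp add: fsa_star_scal_mult)

text \<open>
  Every factor is a phase times the adjoint of the generator with negated indices, which turns the sum into a row of \<open>u u\<^sup>*\<close>;
  the phases that depend on the summation index cancel.
\<close>

lemma fund_st_fund_transpose: "(\<Sum>k\<in>UNIV. fund_st i k * fund j k) \<doteq> scal (if i = j then 1 else 0)"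
proof -
  have "(\<Sum>k\<in>UNIV. fund_st i k * fund j k) \<doteq> (\<Sum>k\<in>UNIV. scal (\<sigma> i i * cnj (\<sigma> k k)) * fund (- i) (- k) *
      (scal (cnj (\<sigma> j j) * \<sigma> k k) * fund_st (- j) (- k)))"
    by (intro eqv_sum eqv_mult fund_st_eqv fund_eqv)
  also have "\<dots> = scal (\<sigma> i i * cnj (\<sigma> j j)) * (\<Sum>k\<in>UNIV. fund (- i) (- k) * fund_st (- j) (- k))"
    by (simp add: sum_distrib_left scal_simps cnj)
  also have "(\<Sum>k\<in>UNIV. fund (- i) (- k) * fund_st (- j) (- k)) = (\<Sum>k\<in>UNIV. fund (- i) k * fund_st (- j) k)"
    by (rule sum_group_shift)
  also have "scal (\<sigma> i i * cnj (\<sigma> j j)) * \<dots> \<doteq> scal (\<sigma> i i * cnj (\<sigma> j j)) * scal (if - i = - j then 1 else 0)"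
    by (intro eqv_mult_left fund_fund_st)
  also have "\<dots> = scal (if i = j then 1 else 0)"
    by (simp add: scal_mult cnj)
  finally show ?thesis .
qed

lemma fund_fund_st_transpose: "(\<Sum>k\<in>UNIV. fund k i * fund_st k j) \<doteq> scal (if i = j then 1 else 0)"
proof -
  have "(\<Sum>k\<in>UNIV. fund k i * fund_st k j) \<doteq> (\<Sum>k\<in>UNIV. scal (cnj (\<sigma> k k) * \<sigma> i i) * fund_st (- k) (- i) *
      (scal (\<sigma> k k * cnj (\<sigma> j j)) * fund (- k) (- j)))"
    by (intro eqv_sum eqv_mult fund_st_eqv fund_eqv)
  also have "\<dots> = scal (\<sigma> i i * cnj (\<sigma> j j)) * (\<Sum>k\<in>UNIV. fund_st (- k) (- i) * fund (- k) (- j))"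
    by (simp add: sum_distrib_left scal_simps cnj)
  also have "(\<Sum>k\<in>UNIV. fund_st (- k) (- i) * fund (- k) (- j)) = (\<Sum>k\<in>UNIV. fund_st k (- i) * fund k (- j))"
    by (rule sum_group_shift)
  also have "scal (\<sigma> i i * cnj (\<sigma> j j)) * \<dots> \<doteq> scal (\<sigma> i i * cnj (\<sigma> j j)) * scal (if - i = - j then 1 else 0)"
    by (intro eqv_mult_left fund_st_fund)
  also have "\<dots> = scal (if i = j then 1 else 0)"
    by (simp add: scal_mult cnj)
  finally show ?thesis .
qed

text \<open>
  The conjugating matrices are monomial and chosen such that the \<open>(i, j)\<close> entry of the conjugated transpose is
  congruent to \<open>(u\<^sup>j\<^sub>i)\<^sup>*\<close>. So the asserted unitarity is that of \<open>u\<close> with its two halves exchanged.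
\<close>

lemma unitary_transpose:
  "\<exists>T T' :: ((complex, 'g) vec, 'g) vec. T ** T' = mat 1 \<and> T' ** T = mat 1 \<and>
    unitary_modulo J (\<lambda>i j. \<Sum>a\<in>UNIV. \<Sum>b\<in>UNIV. scal (T $ i $ a * T' $ b $ j) * fund b a)"
proof (intro exI conjI)
  let ?T = "(\<chi> i a. if a = - i then cnj (\<sigma> i i) else 0) :: ((complex, 'g) vec, 'g) vec"
  let ?T' = "(\<chi> b j. if b = - j then \<sigma> j j else 0) :: ((complex, 'g) vec, 'g) vec"
  show T: "?T ** ?T' = mat 1"
    by (simp add: vec_eq_iff matrix_matrix_mult_def mat_def if_zero cnj)
  then show "?T' ** ?T = mat 1"
    by (simp add: matrix_left_right_inverse)
  have w: "(\<Sum>a\<in>UNIV. \<Sum>b\<in>UNIV. scal (?T $ i $ a * ?T' $ b $ j) * fund b a) =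
      scal (\<sigma> j j * cnj (\<sigma> i i)) * fund (- j) (- i)" for i j
  proof -
    have "scal (?T $ i $ a * ?T' $ b $ j) * fund b a =
        (if b = - j then if a = - i then scal (\<sigma> j j * cnj (\<sigma> i i)) * fund (- j) (- i) else 0 else 0)" for a b
      by (simp add: mult.commute)
    then show ?thesis by simp
  qed
  have w1: "scal (\<sigma> j j * cnj (\<sigma> i i)) * fund (- j) (- i) \<doteq> fund_st j i" for i j
    using eqv_sym fund_st_eqv by blast
  have w2: "fsa_star (scal (\<sigma> j j * cnj (\<sigma> i i)) * fund (- j) (- i)) \<doteq> fund j i" for i j
    using eqv_star[OF w1] by simp
  show "unitary_modulo J (\<lambda>i j. \<Sum>a\<in>UNIV. \<Sum>b\<in>UNIV. scal (?T $ i $ a * ?T' $ b $ j) * fund b a)"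
    unfolding unitary_modulo_def w eqv_def[symmetric]
  proof (intro conjI allI)
    fix i j
    show "(\<Sum>k\<in>UNIV. scal (\<sigma> k k * cnj (\<sigma> i i)) * fund (- k) (- i) *
        fsa_star (scal (\<sigma> k k * cnj (\<sigma> j j)) * fund (- k) (- j))) \<doteq> scal (if i = j then 1 else 0)"
      by (rule eqv_trans[OF eqv_sum[OF eqv_mult[OF w1 w2]] fund_st_fund])
    show "(\<Sum>k\<in>UNIV. fsa_star (scal (\<sigma> i i * cnj (\<sigma> k k)) * fund (- i) (- k)) *
        (scal (\<sigma> j j * cnj (\<sigma> k k)) * fund (- j) (- k))) \<doteq> scal (if i = j then 1 else 0)"
      by (rule eqv_trans[OF eqv_sum[OF eqv_mult[OF w2 w1]] fund_fund_st])
  qed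
qed

text \<open>
  The image of \<open>1\<close> under the coaction acts as a unit on the image of the coaction. This is the multiplication relation with \<open>j = 0\<close>;
  multiplying it by \<open>u\<^sup>*\<close> and summing isolates the coefficients of that image.
\<close>

lemma fund_unit: "fund i 0 \<doteq> scal (if i = 0 then 1 else 0)"
proof -
  \<comment> \<open>The column \<open>0\<close> of \<open>u\<^sup>*\<close> is multiplied on, so that only the summand with \<open>a = i\<close> survives.\<close>
  let ?x = "\<Sum>k\<in>UNIV. (\<Sum>a\<in>UNIV. scal (cnj (\<sigma> a (i - a))) * (fund a 0 * fund (i - a) k)) * fund_st 0 k"
  have "?x = (\<Sum>k\<in>UNIV. \<Sum>a\<in>UNIV. scal (cnj (\<sigma> a (i - a))) * fund a 0 * (fund (i - a) k * fund_st 0 k))"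
    by (simp add: sum_distrib_right mult.assoc)
  also have "\<dots> = (\<Sum>a\<in>UNIV. scal (cnj (\<sigma> a (i - a))) * fund a 0 * (\<Sum>k\<in>UNIV. fund (i - a) k * fund_st 0 k))"
    by (subst sum.swap) (simp add: sum_distrib_left)
  also have "\<dots> \<doteq> (\<Sum>a\<in>UNIV. scal (cnj (\<sigma> a (i - a))) * fund a 0 * scal (if i - a = 0 then 1 else 0))"
    by (intro eqv_sum eqv_mult_left fund_fund_st)
  also have "\<dots> = fund i 0"
    by (simp add: if_zero)
  finally have 1: "?x \<doteq> fund i 0" .
  have "?x \<doteq> (\<Sum>k\<in>UNIV. scal (cnj (\<sigma> 0 k)) * fund i (0 + k) * fund_st 0 k)"
    by (intro eqv_sum eqv_mult_right fund_mult)
  also have "\<dots> \<doteq> scal (if i = 0 then 1 else 0)"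
    using fund_fund_st[of i 0] by simp
  finally show ?thesis using 1 eqv_sym eqv_trans by blast
qed

text \<open>
  The adjoint of the multiplication is an intertwiner as well: apply the star to the multiplication relation and multiply by \<open>u \<otimes> u\<close> on
  the left and by \<open>u\<close> on the right.
\<close>

lemma fund_comult:
  "(\<Sum>a\<in>UNIV. scal (\<sigma> a (i - a)) * (fund j a * fund k (i - a))) \<doteq> scal (\<sigma> j k) * fund (j + k) i"
proof -
  let ?s = "\<lambda>a b n. scal (\<sigma> a (n - a)) * (fund j b * scal (if k = n - a then 1 else 0) * fund_st a b * fund n i)"
  let ?t = "\<lambda>a b c n. scal (\<sigma> a (n - a)) * (fund j b * (fund k c * fund_st (n - a) c) * fund_st a b * fund n i)"
  let ?x = "\<Sum>b\<in>UNIV. \<Sum>c\<in>UNIV. \<Sum>n\<in>UNIV. fund j b * fund k c *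
    fsa_star (\<Sum>a\<in>UNIV. scal (cnj (\<sigma> a (n - a))) * (fund a b * fund (n - a) c)) * fund n i"
  have "?x \<doteq> (\<Sum>b\<in>UNIV. \<Sum>c\<in>UNIV. \<Sum>n\<in>UNIV. fund j b * fund k c *
      fsa_star (scal (cnj (\<sigma> b c)) * fund n (b + c)) * fund n i)"
    by (intro eqv_sum eqv_mult_right eqv_mult_left eqv_star fund_mult)
  also have "\<dots> = (\<Sum>b\<in>UNIV. \<Sum>c\<in>UNIV. scal (\<sigma> b c) * (fund j b * fund k c) *
      (\<Sum>n\<in>UNIV. fund_st n (b + c) * fund n i))"
    by (simp add: fsa_star_scal_mult scal_simps sum_distrib_left)
  also have "\<dots> \<doteq> (\<Sum>b\<in>UNIV. \<Sum>c\<in>UNIV. scal (\<sigma> b c) * (fund j b * fund k c) * scal (if b + c = i then 1 else 0))"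
    by (intro eqv_sum eqv_mult_left fund_st_fund)
  also have "\<dots> = (\<Sum>a\<in>UNIV. scal (\<sigma> a (i - a)) * (fund j a * fund k (i - a)))"
    by (simp add: if_zero sum_sum_if_add)
  finally have 1: "?x \<doteq> (\<Sum>a\<in>UNIV. scal (\<sigma> a (i - a)) * (fund j a * fund k (i - a)))" .
  have "?x = (\<Sum>b\<in>UNIV. \<Sum>c\<in>UNIV. \<Sum>n\<in>UNIV. \<Sum>a\<in>UNIV.
      ?t a b c n)"
    by (simp add: fsa_star_simps fsa_star_scal_mult scal_simps sum_distrib_left sum_distrib_right)
  also have "\<dots> = (\<Sum>b\<in>UNIV. \<Sum>n\<in>UNIV. \<Sum>c\<in>UNIV. \<Sum>a\<in>UNIV.
      ?t a b c n)"
    by (rule sum.cong[OF refl], rule sum.swap)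
  also have "\<dots> = (\<Sum>b\<in>UNIV. \<Sum>n\<in>UNIV. \<Sum>a\<in>UNIV. \<Sum>c\<in>UNIV.
      ?t a b c n)"
    by (rule sum.cong[OF refl], rule sum.cong[OF refl], rule sum.swap)
  also have "\<dots> = (\<Sum>b\<in>UNIV. \<Sum>n\<in>UNIV. \<Sum>a\<in>UNIV.
      scal (\<sigma> a (n - a)) * (fund j b * (\<Sum>c\<in>UNIV. fund k c * fund_st (n - a) c) * fund_st a b * fund n i))"
    by (simp add: sum_distrib_left sum_distrib_right)
  also have "\<dots> \<doteq> (\<Sum>b\<in>UNIV. \<Sum>n\<in>UNIV. \<Sum>a\<in>UNIV.
      ?s a b n)"
    by (intro eqv_sum eqv_mult_left eqv_mult_right fund_fund_st)
  also have "\<dots> = (\<Sum>b\<in>UNIV. \<Sum>a\<in>UNIV. \<Sum>n\<in>UNIV.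
      ?s a b n)"
    by (rule sum.cong[OF refl], rule sum.swap)
  also have "\<dots> = (\<Sum>b\<in>UNIV. \<Sum>a\<in>UNIV. scal (\<sigma> a k) * (fund j b * fund_st a b * fund (a + k) i))"
  proof (intro sum.cong refl)
    fix a b
    have "(\<Sum>n\<in>UNIV. ?s a b n) =
      (\<Sum>n\<in>UNIV. if n = a + k then scal (\<sigma> a k) * (fund j b * fund_st a b * fund (a + k) i) else 0)"
      by (intro sum.cong) (auto simp: algebra_simps)
    then show "(\<Sum>n\<in>UNIV. ?s a b n) =
      scal (\<sigma> a k) * (fund j b * fund_st a b * fund (a + k) i)"
      by simp
  qed
  also have "\<dots> = (\<Sum>a\<in>UNIV. scal (\<sigma> a k) * ((\<Sum>b\<in>UNIV. fund j b * fund_st a b) * fund (a + k) i))"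
    by (subst sum.swap) (simp add: sum_distrib_left sum_distrib_right)
  also have "\<dots> \<doteq> (\<Sum>a\<in>UNIV. scal (\<sigma> a k) * (scal (if j = a then 1 else 0) * fund (a + k) i))"
    by (intro eqv_sum eqv_mult_left eqv_mult_right fund_fund_st)
  also have "\<dots> = scal (\<sigma> j k) * fund (j + k) i"
    by (simp add: if_zero)
  finally show ?thesis using 1 eqv_sym eqv_trans by blast
qed

text \<open>
  The antipode sends the multiplication relation to the star of the relation in \<open>fund_comult\<close>, and the unitarity relations to
  those of the transposed matrix.
\<close>

lemma antipode_mem:
  assumes "p \<in> J"
  shows "antipode p \<in> J"
proof -
  let ?I = "{p. antipode p \<in> J}"
  have "star_ideal ?I"
    by (rule star_ideal_preimage[where st = fsa_star])
      (simp_all add: two_sided_ideal_axioms star_mem antipode_simps antipode_star)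
  moreover have "twisted_relations \<sigma> lam ?I"
    unfolding twisted_relations_def unitary_modulo_fund mem_Collect_eq
  proof (intro conjI allI)
    fix i j k
    show "antipode ((\<Sum>k\<in>UNIV. fund i k * fund_st j k) - scal (if i = j then 1 else 0)) \<in> J"
      using fund_fund_st_transpose[of j i] by (simp add: antipode_simps(1-7) eqv_def eq_commute)
    show "antipode ((\<Sum>k\<in>UNIV. fund_st k i * fund k j) - scal (if i = j then 1 else 0)) \<in> J"
      using fund_st_fund_transpose[of j i] by (simp add: antipode_simps(1-7) eqv_def eq_commute)
    have "antipode (fund_st i j - scal (\<sigma> i i * cnj (\<sigma> j j)) * fund (- i) (- j)) =
        fund j i - scal (cnj (\<sigma> j j) * \<sigma> i i) * fund_st (- j) (- i)"
      by (simp add: antipode_simps(1-7) mult.commute)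
    then show "antipode (fund_st i j - scal (\<sigma> i i * cnj (\<sigma> j j)) * fund (- i) (- j)) \<in> J"
      using fund_eqv[of j i] by (simp add: eqv_def)
    have "antipode ((\<Sum>a\<in>UNIV. scal (cnj (\<sigma> a (i - a))) * (fund a j * fund (i - a) k)) -
        scal (cnj (\<sigma> j k)) * fund i (j + k)) =
      fsa_star ((\<Sum>a\<in>UNIV. scal (\<sigma> a (i - a)) * (fund j a * fund k (i - a))) - scal (\<sigma> j k) * fund (j + k) i)"
      by (simp add: antipode_simps(1-7) fsa_star_simps(1-4) fsa_star_scal_mult fsa_star_fund_mult)
    then show "antipode ((\<Sum>a\<in>UNIV. scal (cnj (\<sigma> a (i - a))) * (fund a j * fund (i - a) k)) -
        scal (cnj (\<sigma> j k)) * fund i (j + k)) \<in> J"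
      using fund_comult star_mem by (simp add: eqv_def)
    show "antipode (scal (lam i - lam j) * fund i j) \<in> J"
    proof (cases "lam i = lam j")
      case False
      then have "fund j i \<in> J"
        using fund_adj[of j i] by (subst (asm) scal_mem_iff) auto
      then show ?thesis using star_mem left_mem by (fastforce simp: antipode_simps(1-7))
    qed (simp add: antipode_simps(1-7) zero_mem)
  qed
  ultimately show ?thesis using least assms by blast
qed

lemma evaluation_vanishes:
  assumes ch: "\<And>\<mu> \<nu>. ch (\<mu> + \<nu>) = ch \<mu> * ch \<nu>" "\<And>\<mu>. cmod (ch \<mu>) = 1" and p: "p \<in> J"
  shows "evaluation ch p = 0"
proof -
  have ch0: "ch 0 = 1"
    using ch(1)[of 0 0] ch(2)[of 0] by auto
  have unit: "ch \<mu> * cnj (ch \<mu>) = 1" for \<mu>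
    using ch(2)[of \<mu>] complex_norm_square[of "ch \<mu>"] by simp
  have neg: "cnj (ch \<mu>) = ch (- \<mu>)" for \<mu>
    using ch(1)[of \<mu> "- \<mu>"] ch0 unit[of \<mu>] by (metis add.right_inverse mult.left_commute mult.right_neutral)
  have "twisted_relations \<sigma> lam {p. evaluation ch p \<in> {0}}"
    unfolding twisted_relations_def unitary_modulo_fund mem_Collect_eq singleton_iff
  proof (intro conjI allI)
    fix i j k
    show "evaluation ch ((\<Sum>k\<in>UNIV. fund i k * fund_st j k) - scal (if i = j then 1 else 0)) = 0"
      by (auto simp: evaluation_simps if_zero unit)
    show "evaluation ch ((\<Sum>k\<in>UNIV. fund_st k i * fund k j) - scal (if i = j then 1 else 0)) = 0"
      by (auto simp: evaluation_simps if_zero unit mult.commute)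
    show "evaluation ch (fund_st i j - scal (\<sigma> i i * cnj (\<sigma> j j)) * fund (- i) (- j)) = 0"
      by (auto simp: evaluation_simps neg cnj)
    show "evaluation ch (scal (lam i - lam j) * fund i j) = 0"
      by (auto simp: evaluation_simps)
    have "(\<Sum>a\<in>UNIV. cnj (\<sigma> a (i - a)) * ((if a = j then ch a else 0) * (if i - a = k then ch (i - a) else 0))) =
      (\<Sum>a\<in>UNIV. if a = j then cnj (\<sigma> j k) * (if i = j + k then ch i else 0) else 0)"
      by (intro sum.cong) (auto simp: ch(1)[symmetric] algebra_simps)
    then show "evaluation ch ((\<Sum>a\<in>UNIV. scal (cnj (\<sigma> a (i - a))) * (fund a j * fund (i - a) k)) -
        scal (cnj (\<sigma> j k)) * fund i (j + k)) = 0"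
      by (simp add: evaluation_simps)
  qed
  then show ?thesis using least[OF star_ideal_evaluation_kernel] p by blast
qed

text \<open>
  In each relation the two legs of the tensor product are rewritten one after the other, with the relation itself used in each leg.
\<close>

lemma comult_mem:
  assumes "p \<in> J"
  shows "comult p \<in> tensor_kernel J"
proof -
  interpret tk: two_sided_ideal "tensor_kernel J"
    by (intro two_sided_ideal_tensor_kernel two_sided_ideal_axioms)
  let ?I = "{p. comult p \<in> tensor_kernel J}"
  have eqv_left: "tk.eqv (pure_tensor p q) (pure_tensor p' q)" if "p \<doteq> p'" for p p' q
    using that pure_tensor_mem[of "p - p'" J q] by (simp add: eqv_def tk.eqv_def pure_tensor_simps)
  have eqv_right: "tk.eqv (pure_tensor p q) (pure_tensor p q')" if "q \<doteq> q'" for p q q'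
    using that pure_tensor_mem[of p J "q - q'"] by (simp add: eqv_def tk.eqv_def pure_tensor_simps)
  have "twisted_relations \<sigma> lam ?I"
    unfolding twisted_relations_def unitary_modulo_fund mem_Collect_eq
  proof (intro conjI allI)
    fix i j k :: 'g
    let ?u = "\<lambda>k a b. pure_tensor (fund i a * fund_st j b) (fund a k * fund_st b k)"
    let ?v = "\<lambda>k a b. pure_tensor (fund_st k a * fund k b) (fund_st a i * fund b j)"
    let ?t = "\<lambda>a b c. pure_tensor (scal (cnj (\<sigma> a (i - a))) * (fund a b * fund (i - a) c)) (fund b j * fund c k)"
    have "comult (\<Sum>k\<in>UNIV. fund i k * fund_st j k) =
        (\<Sum>k\<in>UNIV. \<Sum>a\<in>UNIV. \<Sum>b\<in>UNIV. ?u k a b)"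
      by (simp only: comult_sum comult_mult comult_fund comult_fund_st sum_product pure_tensor_mult)
    also have "\<dots> = (\<Sum>a\<in>UNIV. \<Sum>k\<in>UNIV. \<Sum>b\<in>UNIV. ?u k a b)"
      by (rule sum.swap)
    also have "\<dots> = (\<Sum>a\<in>UNIV. \<Sum>b\<in>UNIV. \<Sum>k\<in>UNIV. ?u k a b)"
      by (rule sum.cong[OF refl], rule sum.swap)
    also have "\<dots> = (\<Sum>a\<in>UNIV. \<Sum>b\<in>UNIV. pure_tensor (fund i a * fund_st j b) (\<Sum>k\<in>UNIV. fund a k * fund_st b k))"
      by (simp only: pure_tensor_simps)
    also have "tk.eqv \<dots> (\<Sum>a\<in>UNIV. \<Sum>b\<in>UNIV. pure_tensor (fund i a * fund_st j b) (scal (if a = b then 1 else 0)))"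
      by (intro tk.eqv_sum eqv_right fund_fund_st)
    also have "\<dots> = (\<Sum>a\<in>UNIV. \<Sum>b\<in>UNIV. if b = a then pure_tensor (fund i a * fund_st j a) 1 else 0)"
      by (intro sum.cong refl) (auto simp: pure_tensor_simps)
    also have "\<dots> = pure_tensor (\<Sum>a\<in>UNIV. fund i a * fund_st j a) 1"
      by (simp add: pure_tensor_simps)
    also have "tk.eqv \<dots> (pure_tensor (scal (if i = j then 1 else 0)) 1)"
      by (intro eqv_left fund_fund_st)
    finally show "comult ((\<Sum>k\<in>UNIV. fund i k * fund_st j k) - scal (if i = j then 1 else 0)) \<in> tensor_kernel J"
      by (simp only: tk.eqv_def comult_minus comult_scal pure_tensor_scal_1)
    have "comult (\<Sum>k\<in>UNIV. fund_st k i * fund k j) =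
        (\<Sum>k\<in>UNIV. \<Sum>a\<in>UNIV. \<Sum>b\<in>UNIV. ?v k a b)"
      by (simp only: comult_sum comult_mult comult_fund comult_fund_st sum_product pure_tensor_mult)
    also have "\<dots> = (\<Sum>a\<in>UNIV. \<Sum>k\<in>UNIV. \<Sum>b\<in>UNIV. ?v k a b)"
      by (rule sum.swap)
    also have "\<dots> = (\<Sum>a\<in>UNIV. \<Sum>b\<in>UNIV. \<Sum>k\<in>UNIV. ?v k a b)"
      by (rule sum.cong[OF refl], rule sum.swap)
    also have "\<dots> = (\<Sum>a\<in>UNIV. \<Sum>b\<in>UNIV. pure_tensor (\<Sum>k\<in>UNIV. fund_st k a * fund k b) (fund_st a i * fund b j))"
      by (simp only: pure_tensor_simps)
    also have "tk.eqv \<dots> (\<Sum>a\<in>UNIV. \<Sum>b\<in>UNIV. pure_tensor (scal (if a = b then 1 else 0)) (fund_st a i * fund b j))"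
      by (intro tk.eqv_sum eqv_left fund_st_fund)
    also have "\<dots> = (\<Sum>a\<in>UNIV. \<Sum>b\<in>UNIV. if b = a then pure_tensor 1 (fund_st a i * fund a j) else 0)"
      by (intro sum.cong refl) (auto simp: pure_tensor_simps)
    also have "\<dots> = pure_tensor 1 (\<Sum>a\<in>UNIV. fund_st a i * fund a j)"
      by (simp add: pure_tensor_simps)
    also have "tk.eqv \<dots> (pure_tensor 1 (scal (if i = j then 1 else 0)))"
      by (intro eqv_right fund_st_fund)
    finally show "comult ((\<Sum>k\<in>UNIV. fund_st k i * fund k j) - scal (if i = j then 1 else 0)) \<in> tensor_kernel J"
      by (simp only: tk.eqv_def comult_minus comult_scal pure_tensor_scal_1)
    have "tk.eqv (comult (fund_st i j)) (\<Sum>k\<in>UNIV. pure_tensor (scal (\<sigma> i i * cnj (\<sigma> k k)) * fund (- i) (- k)) (fund_st k j))"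
      unfolding comult_fund_st by (intro tk.eqv_sum eqv_left fund_st_eqv)
    also have "tk.eqv \<dots> (\<Sum>k\<in>UNIV. pure_tensor (scal (\<sigma> i i * cnj (\<sigma> k k)) * fund (- i) (- k))
        (scal (\<sigma> k k * cnj (\<sigma> j j)) * fund (- k) (- j)))"
      by (intro tk.eqv_sum eqv_right fund_st_eqv)
    also have "\<dots> = scal (\<sigma> i i * cnj (\<sigma> j j)) * (\<Sum>k\<in>UNIV. pure_tensor (fund (- i) (- k)) (fund (- k) (- j)))"
      by (simp add: pure_tensor_scal_left pure_tensor_scal_right scal_scal sum_distrib_left cnj)
    also have "(\<Sum>k\<in>UNIV. pure_tensor (fund (- i) (- k)) (fund (- k) (- j))) =
        (\<Sum>k\<in>UNIV. pure_tensor (fund (- i) k) (fund k (- j)))"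
      by (rule sum_group_shift)
    finally show "comult (fund_st i j - scal (\<sigma> i i * cnj (\<sigma> j j)) * fund (- i) (- j)) \<in> tensor_kernel J"
      by (simp only: tk.eqv_def comult_minus comult_mult comult_scal comult_fund)
    have "scal (lam i - lam j) * pure_tensor (fund i k) (fund k j) =
        pure_tensor (scal (lam i - lam k) * fund i k) (fund k j) +
        pure_tensor (fund i k) (scal (lam k - lam j) * fund k j)" for k
      unfolding pure_tensor_scal_left pure_tensor_scal_right by (simp add: scal_diff left_diff_distrib)
    then show "comult (scal (lam i - lam j) * fund i j) \<in> tensor_kernel J"
      by (simp add: comult_mult comult_scal comult_fund sum_distrib_left tk.sum_mem tk.add_mem
          pure_tensor_mem fund_adj)
    have "comult (\<Sum>a\<in>UNIV. scal (cnj (\<sigma> a (i - a))) * (fund a j * fund (i - a) k)) =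
        (\<Sum>a\<in>UNIV. \<Sum>b\<in>UNIV. \<Sum>c\<in>UNIV.
          ?t a b c)"
      unfolding comult_sum comult_mult comult_fund comult_scal sum_product pure_tensor_mult
      by (simp only: sum_distrib_left pure_tensor_scal_left)
    also have "\<dots> = (\<Sum>b\<in>UNIV. \<Sum>a\<in>UNIV. \<Sum>c\<in>UNIV.
          ?t a b c)"
      by (rule sum.swap)
    also have "\<dots> = (\<Sum>b\<in>UNIV. \<Sum>c\<in>UNIV. \<Sum>a\<in>UNIV.
          ?t a b c)"
      by (rule sum.cong[OF refl], rule sum.swap)
    also have "\<dots> = (\<Sum>b\<in>UNIV. \<Sum>c\<in>UNIV.
          pure_tensor (\<Sum>a\<in>UNIV. scal (cnj (\<sigma> a (i - a))) * (fund a b * fund (i - a) c)) (fund b j * fund c k))"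
      by (simp only: pure_tensor_simps)
    also have "tk.eqv \<dots> (\<Sum>b\<in>UNIV. \<Sum>c\<in>UNIV.
          pure_tensor (scal (cnj (\<sigma> b c)) * fund i (b + c)) (fund b j * fund c k))"
      by (intro tk.eqv_sum eqv_left fund_mult)
    also have "\<dots> = (\<Sum>b\<in>UNIV. \<Sum>d\<in>UNIV.
          pure_tensor (scal (cnj (\<sigma> b (d - b))) * fund i (b + (d - b))) (fund b j * fund (d - b) k))"
      by (intro sum.cong refl sum_group_shift[symmetric])
    also have "\<dots> = (\<Sum>b\<in>UNIV. \<Sum>d\<in>UNIV.
          pure_tensor (fund i d) (scal (cnj (\<sigma> b (d - b))) * (fund b j * fund (d - b) k)))"
      by (simp add: pure_tensor_scal_left pure_tensor_scal_right)
    also have "\<dots> = (\<Sum>d\<in>UNIV. \<Sum>b\<in>UNIV.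
          pure_tensor (fund i d) (scal (cnj (\<sigma> b (d - b))) * (fund b j * fund (d - b) k)))"
      by (rule sum.swap)
    also have "\<dots> = (\<Sum>d\<in>UNIV.
          pure_tensor (fund i d) (\<Sum>b\<in>UNIV. scal (cnj (\<sigma> b (d - b))) * (fund b j * fund (d - b) k)))"
      by (simp only: pure_tensor_simps)
    also have "tk.eqv \<dots> (\<Sum>d\<in>UNIV. pure_tensor (fund i d) (scal (cnj (\<sigma> j k)) * fund d (j + k)))"
      by (intro tk.eqv_sum eqv_right fund_mult)
    also have "\<dots> = comult (scal (cnj (\<sigma> j k)) * fund i (j + k))"
      by (simp only: comult_mult comult_scal comult_fund sum_distrib_left pure_tensor_scal_right)
    finally show "comult ((\<Sum>a\<in>UNIV. scal (cnj (\<sigma> a (i - a))) * (fund a j * fund (i - a) k)) -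
        scal (cnj (\<sigma> j k)) * fund i (j + k)) \<in> tensor_kernel J"
      by (simp only: tk.eqv_def comult_minus)
  qed
  then show ?thesis using least[OF star_ideal_comult_preimage] assms by blast
qed

theorem is_cmqg: "is_cmqg J"
  unfolding is_cmqg_def
proof (intro conjI exI[of _ antipode])
  show "star_ideal J" by (rule star_ideal)
  show "unitary_modulo J fund" using relations by (simp add: twisted_relations_def)
  show "\<exists>T T' :: ((complex, 'g) vec, 'g) vec. T ** T' = mat 1 \<and> T' ** T = mat 1 \<and>
       unitary_modulo J (\<lambda>i j. \<Sum>a\<in>UNIV. \<Sum>b\<in>UNIV. scal (T $ i $ a * T' $ b $ j) * fund b a)"
    by (rule unitary_transpose)
  show "comult ` J \<subseteq> tensor_kernel J" using comult_mem by blast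
  show "\<forall>p\<in>J. hopf_counit p = 0" using evaluation_vanishes[of "\<lambda>i. 1"] by (simp add: hopf_counit_eq)
  show "antipode ` J \<subseteq> J" using antipode_mem by blast
  show "\<forall>p q. antipode (p * q) = antipode q * antipode p" by (simp add: antipode_simps)
qed (use fund_fund_st fund_st_fund fund_st_fund_transpose fund_fund_st_transpose
  in \<open>simp_all add: antipode_simps(1-7) eqv_def\<close>)

end

lemma twisted_ideal_quantum_aut:
  assumes "unitary_bicharacter \<sigma>"
  shows "twisted_ideal \<sigma> (quantum_aut (twisted_cayley \<tau> \<sigma> S)) (cayley_eigenvalue \<tau> S)"
proof -
  interpret bicharacter \<sigma> by standard fact
  interpret fsa_ideal "quantum_aut (twisted_cayley \<tau> \<sigma> S)" by (rule fsa_ideal_quantum_aut)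
  show ?thesis
    by standard (use assms twisted_relations_quantum_aut quantum_aut_twisted_subset in blast)+
qed


section \<open>Unitary change of basis\<close>

definition unitary_kernel :: "('i::finite \<Rightarrow> 'i \<Rightarrow> complex) \<Rightarrow> bool"
  where "unitary_kernel W \<longleftrightarrow>
    (\<forall>i j. (\<Sum>a\<in>UNIV. W i a * cnj (W j a)) = (if i = j then 1 else 0)) \<and>
    (\<forall>a b. (\<Sum>i\<in>UNIV. cnj (W i a) * W i b) = (if a = b then 1 else 0))"

definition adjoint_kernel :: "('i \<Rightarrow> 'i \<Rightarrow> complex) \<Rightarrow> 'i \<Rightarrow> 'i \<Rightarrow> complex"
  where "adjoint_kernel W a i = cnj (W i a)"

lemma adjoint_adjoint [simp]: "adjoint_kernel (adjoint_kernel W) = W"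
  by (simp add: adjoint_kernel_def fun_eq_iff)

lemma unitary_adjoint: "unitary_kernel W \<Longrightarrow> unitary_kernel (adjoint_kernel W)"
  by (simp add: unitary_kernel_def adjoint_kernel_def)

text \<open>
  The matrices of all tensor powers of \<open>W\<close> at once; multiindices of different lengths give \<open>0\<close>.
\<close>

fun tensor_power :: "('i \<Rightarrow> 'i \<Rightarrow> complex) \<Rightarrow> 'i tmat"
  where "tensor_power W [] [] = 1"
  | "tensor_power W (a # p) (b # q) = W a b * tensor_power W p q"
  | "tensor_power W _ _ = 0"

lemma tensor_power_length: "length p \<noteq> length q \<Longrightarrow> tensor_power W p q = 0"
  by (induction W p q rule: tensor_power.induct) auto

lemma tensor_power_adjoint: "tensor_power (adjoint_kernel W) p q = cnj (tensor_power W q p)"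
  by (induction W q p rule: tensor_power.induct) (auto simp: adjoint_kernel_def)

lemma tensor_power_append:
  "length p = length q \<Longrightarrow> tensor_power W (p @ p') (q @ q') = tensor_power W p q * tensor_power W p' q'"
  by (induction p q rule: list_induct2) auto

lemma tensor_power_unitary:
  fixes W :: "'i::finite \<Rightarrow> 'i \<Rightarrow> complex"
  assumes "unitary_kernel W"
  shows "(\<Sum>q | length q = n. tensor_power W p q * cnj (tensor_power W r q)) =
    (if p = r \<and> length p = n then 1 else 0)"
proof (induction n arbitrary: p r)
  case 0
  show ?case
    by (cases p; cases r) (simp_all add: lists_length_0 del: length_0_conv)
next
  case (Suc n)
  have "(\<Sum>q | length q = n. tensor_power W (a # p) (b # q) * cnj (tensor_power W (c # r) (b # q))) =
      W a b * cnj (W c b) * (\<Sum>q | length q = n. tensor_power W p q * cnj (tensor_power W r q))" for a b c p r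
    by (simp add: sum_distrib_left algebra_simps)
  then have "(\<Sum>q | length q = Suc n. tensor_power W (a # p) q * cnj (tensor_power W (c # r) q)) =
      (\<Sum>b\<in>UNIV. W a b * cnj (W c b)) * (if p = r \<and> length p = n then 1 else 0)" for a c p r
    unfolding sum_lists_Suc Suc by (simp add: sum_distrib_right)
  then show ?case
    using assms by (cases p; cases r) (auto simp: unitary_kernel_def sum_lists_Suc)
qed

lemma tensor_power_unitary':
  fixes W :: "'i::finite \<Rightarrow> 'i \<Rightarrow> complex"
  assumes "unitary_kernel W"
  shows "(\<Sum>q | length q = n. cnj (tensor_power W q p) * tensor_power W q r) =
    (if p = r \<and> length p = n then 1 else 0)"
  using tensor_power_unitary[OF unitary_adjoint[OF assms], where n = n and p = p and r = r] by (simp add: tensor_power_adjoint)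

text \<open>
  The operator \<open>V\<^sup>\<otimes>\<^sup>l T (V\<^sup>\<otimes>\<^sup>k)\<^sup>*\<close>.
\<close>

definition tm_conj :: "('i::finite \<Rightarrow> 'i \<Rightarrow> complex) \<Rightarrow> nat \<Rightarrow> nat \<Rightarrow> 'i tmat \<Rightarrow> 'i tmat"
  where "tm_conj V k l T = (\<lambda>i j. \<Sum>p | length p = l. \<Sum>q | length q = k.
    tensor_power V i p * T p q * cnj (tensor_power V j q))"

lemma tm_conj_tmats: "tm_conj V k l T \<in> tmats k l"
proof -
  have "length i = l \<and> length j = k" if "tm_conj V k l T i j \<noteq> 0" for i j
  proof (rule ccontr)
    assume "\<not> (length i = l \<and> length j = k)"
    then have "tensor_power V i p * T p q * cnj (tensor_power V j q) = 0" if "length p = l" "length q = k" for p q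
      using that tensor_power_length[of i p V] tensor_power_length[of j q V] by auto
    then have "tm_conj V k l T i j = 0"
      unfolding tm_conj_def by (intro sum.neutral ballI) auto
    with that show False by simp
  qed
  then show ?thesis by (auto simp: tmats_def)
qed

lemma tmats_zero: "T \<in> tmats k l \<Longrightarrow> \<not> (length i = l \<and> length j = k) \<Longrightarrow> T i j = 0"
  by (auto simp: tmats_def)

lemma tm_conj_adjoint_left:
  fixes W :: "'i::finite \<Rightarrow> 'i \<Rightarrow> complex"
  assumes W: "unitary_kernel W" and i: "length i = l"
  shows "(\<Sum>a | length a = l. tensor_power W i a * tm_conj (adjoint_kernel W) k l T a p) =
    (\<Sum>q | length q = k. T i q * tensor_power W q p)"
proof -
  let ?t = "\<lambda>a r q. tensor_power W i a * cnj (tensor_power W r a) * (T r q * tensor_power W q p)"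
  have "(\<Sum>a | length a = l. tensor_power W i a * tm_conj (adjoint_kernel W) k l T a p) =
    (\<Sum>a | length a = l. \<Sum>r | length r = l. \<Sum>q | length q = k.
      ?t a r q)"
    by (simp add: tm_conj_def tensor_power_adjoint sum_distrib_left mult_ac)
  also have "\<dots> = (\<Sum>r | length r = l. \<Sum>a | length a = l. \<Sum>q | length q = k.
      ?t a r q)"
    by (rule sum.swap)
  also have "\<dots> = (\<Sum>r | length r = l. (\<Sum>a | length a = l. tensor_power W i a * cnj (tensor_power W r a)) *
      (\<Sum>q | length q = k. T r q * tensor_power W q p))"
    by (simp add: sum_product)
  also have "\<dots> = (\<Sum>r | length r = l. if i = r then \<Sum>q | length q = k. T r q * tensor_power W q p else 0)"
    unfolding tensor_power_unitary[OF W] using i by (intro sum.cong) auto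
  also have "\<dots> = (\<Sum>q | length q = k. T i q * tensor_power W q p)"
    using i by simp
  finally show ?thesis .
qed

lemma tm_conj_adjoint_right:
  fixes W :: "'i::finite \<Rightarrow> 'i \<Rightarrow> complex"
  assumes W: "unitary_kernel W" and j: "length j = k"
  shows "(\<Sum>b | length b = k. tm_conj (adjoint_kernel W) k l T q b * cnj (tensor_power W j b)) =
    (\<Sum>r | length r = l. cnj (tensor_power W r q) * T r j)"
proof -
  let ?t = "\<lambda>b r s. cnj (tensor_power W r q) * T r s * (tensor_power W s b * cnj (tensor_power W j b))"
  have "(\<Sum>b | length b = k. tm_conj (adjoint_kernel W) k l T q b * cnj (tensor_power W j b)) =
    (\<Sum>b | length b = k. \<Sum>r | length r = l. \<Sum>s | length s = k.
      ?t b r s)"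
    by (simp add: tm_conj_def tensor_power_adjoint sum_distrib_left sum_distrib_right mult_ac)
  also have "\<dots> = (\<Sum>r | length r = l. \<Sum>b | length b = k. \<Sum>s | length s = k.
      ?t b r s)"
    by (rule sum.swap)
  also have "\<dots> = (\<Sum>r | length r = l. \<Sum>s | length s = k. \<Sum>b | length b = k.
      ?t b r s)"
    by (rule sum.cong[OF refl], rule sum.swap)
  also have "\<dots> = (\<Sum>r | length r = l. \<Sum>s | length s = k.
      cnj (tensor_power W r q) * T r s * (if s = j \<and> length s = k then 1 else 0))"
    unfolding sum_distrib_left[symmetric] tensor_power_unitary[OF W] ..
  also have "\<dots> = (\<Sum>r | length r = l. \<Sum>s | length s = k. if s = j then cnj (tensor_power W r q) * T r j else 0)"
    by (intro sum.cong) auto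
  also have "\<dots> = (\<Sum>r | length r = l. cnj (tensor_power W r q) * T r j)"
    using j by simp
  finally show ?thesis .
qed

lemma tm_conj_inverse:
  fixes W :: "'i::finite \<Rightarrow> 'i \<Rightarrow> complex"
  assumes W: "unitary_kernel W" and T: "T \<in> tmats k l"
  shows "tm_conj W k l (tm_conj (adjoint_kernel W) k l T) = T"
proof (intro ext)
  fix i j :: "'i list"
  show "tm_conj W k l (tm_conj (adjoint_kernel W) k l T) i j = T i j"
  proof (cases "length i = l \<and> length j = k")
    case False
    then show ?thesis
      using tmats_zero[OF T] tmats_zero[OF tm_conj_tmats] by metis
  next
    case True
    have "tm_conj W k l (tm_conj (adjoint_kernel W) k l T) i j = (\<Sum>p | length p = l. tensor_power W i p *
        (\<Sum>q | length q = k. tm_conj (adjoint_kernel W) k l T p q * cnj (tensor_power W j q)))"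
      by (simp add: tm_conj_def[of W] sum_distrib_left mult_ac)
    also have "\<dots> = (\<Sum>p | length p = l. \<Sum>r | length r = l.
        tensor_power W i p * cnj (tensor_power W r p) * T r j)"
      unfolding tm_conj_adjoint_right[OF W conjunct2[OF True]] by (simp add: sum_distrib_left mult_ac)
    also have "\<dots> = (\<Sum>r | length r = l. \<Sum>p | length p = l.
        tensor_power W i p * cnj (tensor_power W r p) * T r j)"
      by (rule sum.swap)
    also have "\<dots> = (\<Sum>r | length r = l. (if i = r \<and> length i = l then 1 else 0) * T r j)"
      unfolding sum_distrib_right[symmetric] tensor_power_unitary[OF W] ..
    also have "\<dots> = (\<Sum>r | length r = l. if r = i then T i j else 0)"
      using True by (intro sum.cong) auto
    also have "\<dots> = T i j" using True by simp
    finally show ?thesis .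
  qed
qed

subsection \<open>The induced homomorphism\<close>

text \<open>
  The *-homomorphism that sends the matrix \<open>u\<close> to \<open>W u W\<^sup>*\<close>.
\<close>

definition conj_hom :: "('i::finite \<Rightarrow> 'i \<Rightarrow> complex) \<Rightarrow> 'i fsa \<Rightarrow> 'i fsa"
  where "conj_hom W = alg_ext scal (\<lambda>g. case g of
      Gen i j \<Rightarrow> \<Sum>a\<in>UNIV. \<Sum>b\<in>UNIV. scal (W i a * cnj (W j b)) * fund a b
    | Gen_star i j \<Rightarrow> \<Sum>a\<in>UNIV. \<Sum>b\<in>UNIV. scal (cnj (W i a * cnj (W j b))) * fund_st a b)"

lemma conj_hom_add: "conj_hom W (p + q) = conj_hom W p + conj_hom W q"
  and conj_hom_minus: "conj_hom W (p - q) = conj_hom W p - conj_hom W q"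
  and conj_hom_mult: "conj_hom W (p * q) = conj_hom W p * conj_hom W q"
  and conj_hom_sum: "conj_hom W (\<Sum>x\<in>A. h x) = (\<Sum>x\<in>A. conj_hom W (h x))"
  and conj_hom_scal: "conj_hom W (scal c) = scal c"
  unfolding conj_hom_def by (rule scal.ext_add scal.ext_minus scal.ext_mult scal.ext_sum scal.ext_scal)+

lemma conj_hom_fund: "conj_hom W (fund i j) = (\<Sum>a\<in>UNIV. \<Sum>b\<in>UNIV. scal (W i a * cnj (W j b)) * fund a b)"
  and conj_hom_fund_st: "conj_hom W (fund_st i j) =
    (\<Sum>a\<in>UNIV. \<Sum>b\<in>UNIV. scal (cnj (W i a) * W j b) * fund_st a b)"
  by (simp_all add: conj_hom_def scal.ext_simps)

lemmas conj_hom_simps = conj_hom_add conj_hom_minus conj_hom_mult conj_hom_sum conj_hom_scal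

lemma conj_hom_star: "conj_hom W (fsa_star p) = fsa_star (conj_hom W p)"
  unfolding conj_hom_def
proof (rule scal.ext_star)
  fix g :: "'a gen"
  show "(case gen_flip g of
      Gen i j \<Rightarrow> \<Sum>a\<in>UNIV. \<Sum>b\<in>UNIV. scal (W i a * cnj (W j b)) * fund a b
    | Gen_star i j \<Rightarrow> \<Sum>a\<in>UNIV. \<Sum>b\<in>UNIV. scal (cnj (W i a * cnj (W j b))) * fund_st a b) =
    fsa_star (case g of
      Gen i j \<Rightarrow> \<Sum>a\<in>UNIV. \<Sum>b\<in>UNIV. scal (W i a * cnj (W j b)) * fund a b
    | Gen_star i j \<Rightarrow> \<Sum>a\<in>UNIV. \<Sum>b\<in>UNIV. scal (cnj (W i a * cnj (W j b))) * fund_st a b)"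
    by (cases g) (simp_all add: fsa_star_simps(4) fsa_star_scal_mult)
qed (simp_all add: fsa_star_simps)

lemma (in fsa_ideal) star_ideal_conj_hom_preimage: "star_ideal {p. conj_hom W p \<in> I}"
  by (rule star_ideal_preimage[where st = fsa_star])
    (simp_all add: two_sided_ideal_axioms star_mem conj_hom_simps conj_hom_star)

lemma scal_sum_sum_delta:
  fixes f :: "'i::finite \<Rightarrow> 'i \<Rightarrow> 'i fsa"
  shows "(\<Sum>c\<in>UNIV. \<Sum>d\<in>UNIV. scal ((if i = c then 1 else 0) * (if j = d then 1 else 0)) * f c d) = f i j"
proof -
  have "(\<Sum>c\<in>UNIV. \<Sum>d\<in>UNIV. scal ((if i = c then 1 else 0) * (if j = d then 1 else 0)) * f c d) =
      (\<Sum>c\<in>UNIV. \<Sum>d\<in>UNIV. if d = j then (if c = i then f i j else 0) else 0)"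
    by (intro sum.cong) auto
  then show ?thesis by simp
qed

lemma sum_swap_inner:
  fixes f :: "'i::finite \<Rightarrow> 'i \<Rightarrow> 'i \<Rightarrow> 'i \<Rightarrow> 'a::comm_monoid_add"
  shows "(\<Sum>a\<in>UNIV. \<Sum>b\<in>UNIV. \<Sum>c\<in>UNIV. \<Sum>d\<in>UNIV. f a b c d) = (\<Sum>c\<in>UNIV. \<Sum>d\<in>UNIV. \<Sum>a\<in>UNIV. \<Sum>b\<in>UNIV. f a b c d)"
proof -
  have "(\<Sum>a\<in>UNIV. \<Sum>b\<in>UNIV. \<Sum>c\<in>UNIV. \<Sum>d\<in>UNIV. f a b c d) = (\<Sum>a\<in>UNIV. \<Sum>c\<in>UNIV. \<Sum>b\<in>UNIV. \<Sum>d\<in>UNIV. f a b c d)"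
    by (rule sum.cong[OF refl], rule sum.swap)
  also have "\<dots> = (\<Sum>c\<in>UNIV. \<Sum>a\<in>UNIV. \<Sum>b\<in>UNIV. \<Sum>d\<in>UNIV. f a b c d)"
    by (rule sum.swap)
  also have "\<dots> = (\<Sum>c\<in>UNIV. \<Sum>a\<in>UNIV. \<Sum>d\<in>UNIV. \<Sum>b\<in>UNIV. f a b c d)"
    by (rule sum.cong[OF refl], rule sum.cong[OF refl], rule sum.swap)
  also have "\<dots> = (\<Sum>c\<in>UNIV. \<Sum>d\<in>UNIV. \<Sum>a\<in>UNIV. \<Sum>b\<in>UNIV. f a b c d)"
    by (rule sum.cong[OF refl], rule sum.swap)
  finally show ?thesis .
qed

lemma conj_hom_inverse:
  assumes W: "unitary_kernel W"
  shows "conj_hom (adjoint_kernel W) (conj_hom W p) = p"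
proof (induction p rule: fsa_induct)
  case (fund i j)
  have "conj_hom (adjoint_kernel W) (conj_hom W (fund i j)) =
      (\<Sum>a\<in>UNIV. \<Sum>b\<in>UNIV. \<Sum>c\<in>UNIV. \<Sum>d\<in>UNIV.
        scal (W i a * cnj (W j b) * (cnj (W c a) * W d b)) * fund c d)"
    by (simp add: conj_hom_fund conj_hom_simps adjoint_kernel_def sum_distrib_left scal_scal)
  also have "\<dots> = (\<Sum>c\<in>UNIV. \<Sum>d\<in>UNIV. \<Sum>a\<in>UNIV. \<Sum>b\<in>UNIV.
        scal ((W i a * cnj (W c a)) * (W d b * cnj (W j b))) * fund c d)"
    by (subst sum_swap_inner) (simp add: mult_ac)
  also have "\<dots> = (\<Sum>c\<in>UNIV. \<Sum>d\<in>UNIV.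
        scal ((\<Sum>a\<in>UNIV. W i a * cnj (W c a)) * (\<Sum>b\<in>UNIV. W d b * cnj (W j b))) * fund c d)"
    by (simp only: sum_product) (simp only: scal_sum sum_distrib_right)
  also have "\<dots> = fund i j"
    using W scal_sum_sum_delta[of i j fund] by (simp add: unitary_kernel_def eq_commute[of _ j])
  finally show ?case .
next
  case (fund_st i j)
  have "conj_hom (adjoint_kernel W) (conj_hom W (fund_st i j)) =
      (\<Sum>a\<in>UNIV. \<Sum>b\<in>UNIV. \<Sum>c\<in>UNIV. \<Sum>d\<in>UNIV.
        scal (cnj (W i a) * W j b * (W c a * cnj (W d b))) * fund_st c d)"
    by (simp add: conj_hom_fund_st conj_hom_simps adjoint_kernel_def sum_distrib_left scal_scal)
  also have "\<dots> = (\<Sum>c\<in>UNIV. \<Sum>d\<in>UNIV. \<Sum>a\<in>UNIV. \<Sum>b\<in>UNIV.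
        scal ((W c a * cnj (W i a)) * (W j b * cnj (W d b))) * fund_st c d)"
    by (subst sum_swap_inner) (simp add: mult_ac)
  also have "\<dots> = (\<Sum>c\<in>UNIV. \<Sum>d\<in>UNIV.
        scal ((\<Sum>a\<in>UNIV. W c a * cnj (W i a)) * (\<Sum>b\<in>UNIV. W j b * cnj (W d b))) * fund_st c d)"
    by (simp only: sum_product) (simp only: scal_sum sum_distrib_right)
  also have "\<dots> = fund_st i j"
    using W scal_sum_sum_delta[of i j fund_st] by (simp add: unitary_kernel_def eq_commute[of _ i])
  finally show ?case .
qed (simp_all add: conj_hom_simps)

lemma conj_hom_fund_power:
  fixes W :: "'i::finite \<Rightarrow> 'i \<Rightarrow> complex"
  assumes "length p = n" "length j = n"
  shows "conj_hom W (fund_power p j) = (\<Sum>a | length a = n. \<Sum>b | length b = n.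
    scal (tensor_power W p a * cnj (tensor_power W j b)) * fund_power a b)"
  using assms
proof (induction n arbitrary: p j)
  case 0
  then show ?case
    using conj_hom_scal[of W 1] by (simp add: sum_lists_0)
next
  case (Suc n)
  obtain c p' d j' where [simp]: "p = c # p'" "j = d # j'"
    using Suc.prems by (metis length_Suc_conv)
  have "conj_hom W (fund_power p j) = (\<Sum>a\<in>UNIV. \<Sum>b\<in>UNIV. scal (W c a * cnj (W d b)) * fund a b) *
      (\<Sum>a' | length a' = n. \<Sum>b' | length b' = n.
        scal (tensor_power W p' a' * cnj (tensor_power W j' b')) * fund_power a' b')"
    using Suc by (simp add: conj_hom_mult conj_hom_fund)
  also have "\<dots> = (\<Sum>a\<in>UNIV. \<Sum>a' | length a' = n. \<Sum>b\<in>UNIV. \<Sum>b' | length b' = n.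
      scal (W c a * cnj (W d b)) * fund a b *
      (scal (tensor_power W p' a' * cnj (tensor_power W j' b')) * fund_power a' b'))"
    by (simp only: sum_product)
  also have "\<dots> = (\<Sum>a | length a = Suc n. \<Sum>b | length b = Suc n.
      scal (tensor_power W p a * cnj (tensor_power W j b)) * fund_power a b)"
    by (simp add: sum_lists_Suc scal_simps mult_ac)
  finally show ?case .
qed

lemma conj_hom_unitary_modulo:
  assumes W: "unitary_kernel W" and J: "fsa_ideal J" and u: "unitary_modulo J fund"
  shows "unitary_modulo {p. conj_hom W p \<in> J} fund"
proof -
  interpret fsa_ideal J by fact
  have u1: "eqv (\<Sum>k\<in>UNIV. fund i k * fund_st j k) (scal (if i = j then 1 else 0))"
    and u2: "eqv (\<Sum>k\<in>UNIV. fund_st k i * fund k j) (scal (if i = j then 1 else 0))" for i j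
    using u by (simp_all add: unitary_modulo_fund eqv_def)
  have sum3: "(\<Sum>k\<in>UNIV. \<Sum>a\<in>UNIV. \<Sum>c\<in>UNIV. \<Sum>b\<in>UNIV. \<Sum>d\<in>UNIV. f k a b c d) =
      (\<Sum>a\<in>UNIV. \<Sum>c\<in>UNIV. \<Sum>b\<in>UNIV. \<Sum>d\<in>UNIV. \<Sum>k\<in>UNIV. f k a b c d)"
    for f :: "'a \<Rightarrow> 'a \<Rightarrow> 'a \<Rightarrow> 'a \<Rightarrow> 'a \<Rightarrow> 'a fsa"
    by (subst sum.swap, rule sum.cong[OF refl], subst sum.swap, rule sum.cong[OF refl],
      subst sum.swap, rule sum.cong[OF refl], rule sum.swap)
  show ?thesis
    unfolding unitary_modulo_fund mem_Collect_eq
  proof (intro conjI allI)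
    fix i j
    have "conj_hom W (\<Sum>k\<in>UNIV. fund i k * fund_st j k) = (\<Sum>k\<in>UNIV. \<Sum>a\<in>UNIV. \<Sum>c\<in>UNIV. \<Sum>b\<in>UNIV. \<Sum>d\<in>UNIV.
        scal (W i a * cnj (W j c) * (W k d * cnj (W k b))) * (fund a b * fund_st c d))"
      by (simp add: conj_hom_sum conj_hom_mult conj_hom_fund conj_hom_fund_st sum_product scal_simps mult_ac)
    also have "\<dots> = (\<Sum>a\<in>UNIV. \<Sum>c\<in>UNIV. \<Sum>b\<in>UNIV. \<Sum>d\<in>UNIV.
        scal (W i a * cnj (W j c) * (\<Sum>k\<in>UNIV. cnj (W k b) * W k d)) * (fund a b * fund_st c d))"
      by (subst sum3) (simp add: sum_distrib_left sum_distrib_right scal_sum mult_ac)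
    also have "\<dots> = (\<Sum>a\<in>UNIV. \<Sum>c\<in>UNIV. \<Sum>b\<in>UNIV. \<Sum>d\<in>UNIV.
        if d = b then scal (W i a * cnj (W j c)) * (fund a b * fund_st c b) else 0)"
      using W by (intro sum.cong) (auto simp: unitary_kernel_def)
    also have "\<dots> = (\<Sum>a\<in>UNIV. \<Sum>c\<in>UNIV. scal (W i a * cnj (W j c)) * (\<Sum>b\<in>UNIV. fund a b * fund_st c b))"
      by (simp add: sum_distrib_left)
    also have "eqv \<dots> (\<Sum>a\<in>UNIV. \<Sum>c\<in>UNIV. scal (W i a * cnj (W j c)) * scal (if a = c then 1 else 0))"
      by (intro eqv_sum eqv_mult_left u1)
    also have "\<dots> = (\<Sum>a\<in>UNIV. \<Sum>c\<in>UNIV. if c = a then scal (W i a * cnj (W j a)) else 0)"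
      by (intro sum.cong) auto
    also have "\<dots> = scal (\<Sum>a\<in>UNIV. W i a * cnj (W j a))"
      by (simp add: scal_sum)
    also have "\<dots> = scal (if i = j then 1 else 0)"
      using W by (simp add: unitary_kernel_def)
    finally show "conj_hom W ((\<Sum>k\<in>UNIV. fund i k * fund_st j k) - scal (if i = j then 1 else 0)) \<in> J"
      by (simp add: eqv_def conj_hom_minus conj_hom_scal)
    have "conj_hom W (\<Sum>k\<in>UNIV. fund_st k i * fund k j) = (\<Sum>k\<in>UNIV. \<Sum>a\<in>UNIV. \<Sum>c\<in>UNIV. \<Sum>b\<in>UNIV. \<Sum>d\<in>UNIV.
        scal (W i b * cnj (W j d) * (W k c * cnj (W k a))) * (fund_st a b * fund c d))"
      by (simp add: conj_hom_sum conj_hom_mult conj_hom_fund conj_hom_fund_st sum_product scal_simps mult_ac)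
    also have "\<dots> = (\<Sum>a\<in>UNIV. \<Sum>c\<in>UNIV. \<Sum>b\<in>UNIV. \<Sum>d\<in>UNIV.
        scal (W i b * cnj (W j d) * (\<Sum>k\<in>UNIV. cnj (W k a) * W k c)) * (fund_st a b * fund c d))"
      by (subst sum3) (simp add: sum_distrib_left sum_distrib_right scal_sum mult_ac)
    also have "\<dots> = (\<Sum>b\<in>UNIV. \<Sum>d\<in>UNIV. \<Sum>a\<in>UNIV. \<Sum>c\<in>UNIV.
        scal (W i b * cnj (W j d) * (\<Sum>k\<in>UNIV. cnj (W k a) * W k c)) * (fund_st a b * fund c d))"
      by (rule sum_swap_inner)
    also have "\<dots> = (\<Sum>b\<in>UNIV. \<Sum>d\<in>UNIV. \<Sum>a\<in>UNIV. \<Sum>c\<in>UNIV.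
        if c = a then scal (W i b * cnj (W j d)) * (fund_st a b * fund a d) else 0)"
      using W by (intro sum.cong) (auto simp: unitary_kernel_def)
    also have "\<dots> = (\<Sum>b\<in>UNIV. \<Sum>d\<in>UNIV. scal (W i b * cnj (W j d)) * (\<Sum>a\<in>UNIV. fund_st a b * fund a d))"
      by (simp add: sum_distrib_left)
    also have "eqv \<dots> (\<Sum>b\<in>UNIV. \<Sum>d\<in>UNIV. scal (W i b * cnj (W j d)) * scal (if b = d then 1 else 0))"
      by (intro eqv_sum eqv_mult_left u2)
    also have "\<dots> = (\<Sum>a\<in>UNIV. \<Sum>c\<in>UNIV. if c = a then scal (W i a * cnj (W j a)) else 0)"
      by (intro sum.cong) auto
    also have "\<dots> = scal (\<Sum>a\<in>UNIV. W i a * cnj (W j a))"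
      by (simp add: scal_sum)
    also have "\<dots> = scal (if i = j then 1 else 0)"
      using W by (simp add: unitary_kernel_def)
    finally show "conj_hom W ((\<Sum>k\<in>UNIV. fund_st k i * fund k j) - scal (if i = j then 1 else 0)) \<in> J"
      by (simp add: eqv_def conj_hom_minus conj_hom_scal)
  qed
qed

text \<open>
  With \<open>T' = W\<^sup>* T W\<close>, all tensor powers understood, this is the identity
  \<open>T (W u W\<^sup>*) - (W u W\<^sup>*) T = W (T' u - u T') W\<^sup>*\<close>.
\<close>

lemma conj_hom_intertwining_defect:
  fixes W :: "'i::finite \<Rightarrow> 'i \<Rightarrow> complex"
  assumes W: "unitary_kernel W" and i: "length i = l" and j: "length j = k"
  shows "conj_hom W (intertwining_defect k l T i j) =
    (\<Sum>a | length a = l. \<Sum>b | length b = k. scal (tensor_power W i a * cnj (tensor_power W j b)) *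
      intertwining_defect k l (tm_conj (adjoint_kernel W) k l T) a b)"
proof -
  let ?T = "tm_conj (adjoint_kernel W) k l T"
  let ?w = "\<lambda>a b. scal (tensor_power W i a * cnj (tensor_power W j b))"
  let ?e = "\<lambda>a q r. scal (T r j * (tensor_power W i a * cnj (tensor_power W r q))) * fund_power a q"
  let ?h = "\<lambda>a b q. scal (tensor_power W i a * (?T q b * cnj (tensor_power W j b))) * fund_power a q"
  let ?g = "\<lambda>b q p. scal (T i q * (tensor_power W q p * cnj (tensor_power W j b))) * fund_power p b"
  let ?f = "\<lambda>a b p. scal (tensor_power W i a * ?T a p * cnj (tensor_power W j b)) * fund_power p b"
  have "(\<Sum>a | length a = l. \<Sum>b | length b = k. ?w a b *
      (\<Sum>p | length p = k. scal (?T a p) * fund_power p b)) =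
    (\<Sum>a | length a = l. \<Sum>b | length b = k. \<Sum>p | length p = k.
      ?f a b p)"
    by (simp add: sum_distrib_left scal_scal mult_ac)
  also have "\<dots> = (\<Sum>b | length b = k. \<Sum>a | length a = l. \<Sum>p | length p = k.
      ?f a b p)"
    by (rule sum.swap)
  also have "\<dots> = (\<Sum>b | length b = k. \<Sum>p | length p = k. \<Sum>a | length a = l.
      ?f a b p)"
    by (rule sum.cong[OF refl], rule sum.swap)
  also have "\<dots> = (\<Sum>b | length b = k. \<Sum>p | length p = k. scal ((\<Sum>a | length a = l.
      tensor_power W i a * ?T a p) * cnj (tensor_power W j b)) * fund_power p b)"
    by (simp add: scal_sum sum_distrib_right)
  also have "\<dots> = (\<Sum>b | length b = k. \<Sum>p | length p = k. \<Sum>q | length q = k.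
      ?g b q p)"
    unfolding tm_conj_adjoint_left[OF W i] by (simp add: scal_sum sum_distrib_right mult.assoc)
  also have "\<dots> = (\<Sum>b | length b = k. \<Sum>q | length q = k. \<Sum>p | length p = k.
      ?g b q p)"
    by (rule sum.cong[OF refl], rule sum.swap)
  also have "\<dots> = (\<Sum>q | length q = k. \<Sum>b | length b = k. \<Sum>p | length p = k.
      ?g b q p)"
    by (rule sum.swap)
  also have "\<dots> = (\<Sum>q | length q = k. \<Sum>p | length p = k. \<Sum>b | length b = k.
      ?g b q p)"
    by (rule sum.cong[OF refl], rule sum.swap)
  also have "\<dots> = conj_hom W (\<Sum>q | length q = k. scal (T i q) * fund_power q j)"
    using j by (simp add: conj_hom_simps conj_hom_fund_power[of _ k] sum_distrib_left scal_scal)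
  finally have 1: "(\<Sum>a | length a = l. \<Sum>b | length b = k. ?w a b *
      (\<Sum>p | length p = k. scal (?T a p) * fund_power p b)) =
    conj_hom W (\<Sum>q | length q = k. scal (T i q) * fund_power q j)" .
  have "(\<Sum>a | length a = l. \<Sum>b | length b = k. ?w a b *
      (\<Sum>q | length q = l. scal (?T q b) * fund_power a q)) =
    (\<Sum>a | length a = l. \<Sum>b | length b = k. \<Sum>q | length q = l.
      ?h a b q)"
    by (simp add: sum_distrib_left scal_scal mult_ac)
  also have "\<dots> = (\<Sum>a | length a = l. \<Sum>q | length q = l. \<Sum>b | length b = k.
      ?h a b q)"
    by (rule sum.cong[OF refl], rule sum.swap)
  also have "\<dots> = (\<Sum>a | length a = l. \<Sum>q | length q = l. scal (tensor_power W i a *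
      (\<Sum>b | length b = k. ?T q b * cnj (tensor_power W j b))) * fund_power a q)"
    by (simp add: scal_sum sum_distrib_right sum_distrib_left)
  also have "\<dots> = (\<Sum>a | length a = l. \<Sum>q | length q = l. \<Sum>r | length r = l.
      ?e a q r)"
    unfolding tm_conj_adjoint_right[OF W j] by (simp add: scal_sum sum_distrib_right sum_distrib_left mult_ac)
  also have "\<dots> = (\<Sum>a | length a = l. \<Sum>r | length r = l. \<Sum>q | length q = l.
      ?e a q r)"
    by (rule sum.cong[OF refl], rule sum.swap)
  also have "\<dots> = (\<Sum>r | length r = l. \<Sum>a | length a = l. \<Sum>q | length q = l.
      ?e a q r)"
    by (rule sum.swap)
  also have "\<dots> = conj_hom W (\<Sum>q | length q = l. scal (T q j) * fund_power i q)"
    using i by (simp add: conj_hom_simps conj_hom_fund_power[of _ l] sum_distrib_left scal_scal)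
  finally have 2: "(\<Sum>a | length a = l. \<Sum>b | length b = k. ?w a b *
      (\<Sum>q | length q = l. scal (?T q b) * fund_power a q)) =
    conj_hom W (\<Sum>q | length q = l. scal (T q j) * fund_power i q)" .
  show ?thesis
    unfolding intertwining_defect_def right_diff_distrib sum_subtractf 1 2 conj_hom_minus ..
qed

lemma conj_hom_intertwinerI:
  assumes W: "unitary_kernel W" and J: "fsa_ideal J" and T: "T \<in> tmats k l"
    and T': "tm_conj (adjoint_kernel W) k l T \<in> intertwiners J k l"
  shows "T \<in> intertwiners {p. conj_hom W p \<in> J} k l"
proof -
  interpret fsa_ideal J by fact
  show ?thesis
    using T T' by (auto simp: intertwiners_eq conj_hom_intertwining_defect[OF W] intro!: sum_mem left_mem)
qed

text \<open>
  The converse implication is the first one applied to the inverse change of basis.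
\<close>

lemma conj_hom_intertwiner_iff:
  assumes W: "unitary_kernel W" and J: "fsa_ideal J" and T: "T \<in> tmats k l"
  shows "T \<in> intertwiners {p. conj_hom W p \<in> J} k l \<longleftrightarrow>
    tm_conj (adjoint_kernel W) k l T \<in> intertwiners J k l"
proof
  interpret fsa_ideal J by fact
  let ?I = "{p. conj_hom W p \<in> J}" and ?V = "adjoint_kernel W"
  assume "T \<in> intertwiners ?I k l"
  then have "tm_conj ?V k l T \<in> intertwiners {p. conj_hom ?V p \<in> ?I} k l"
    using conj_hom_intertwinerI[OF unitary_adjoint[OF W], of ?I "tm_conj ?V k l T" k l]
    by (simp add: fsa_ideal_def star_ideal_conj_hom_preimage tm_conj_tmats tm_conj_inverse[OF W T])
  then show "tm_conj ?V k l T \<in> intertwiners J k l"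
    using conj_hom_inverse[OF unitary_adjoint[OF W]] by simp
qed (rule conj_hom_intertwinerI[OF assms])


section \<open>Characters of a finite abelian group\<close>

lemma prod_group_shift:
  fixes f :: "'g::{finite, ab_group_add} \<Rightarrow> 'a::comm_monoid_mult"
  shows "(\<Prod>a\<in>UNIV. f (a + c)) = (\<Prod>a\<in>UNIV. f a)"
  by (rule prod.reindex_bij_witness[of _ "\<lambda>a. a - c" "\<lambda>a. a + c"]) auto

text \<open>
  The product of all values of \<open>f\<close> does not change when the arguments are shifted by \<open>a\<close>, hence \<open>f a ^ N = 1\<close>.
\<close>

lemma is_character_norm:
  fixes f :: "'g::{finite, ab_group_add} \<Rightarrow> complex"
  assumes "is_character f"
  shows "cmod (f a) = 1"
proof -
  have f: "f (b + c) = f b * f c" "f 0 = 1" for b c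
    using assms by (auto simp: is_character_def)
  have nz: "f b \<noteq> 0" for b
    using f(1)[of b "- b"] f(2) by auto
  have "(\<Prod>b\<in>UNIV. f b) = (\<Prod>b\<in>UNIV. f (b + a))"
    by (rule prod_group_shift[symmetric])
  also have "\<dots> = (\<Prod>b\<in>UNIV. f b) * f a ^ CARD('g)"
    by (simp add: f prod.distrib)
  finally have "f a ^ CARD('g) = 1"
    using nz by simp
  then show ?thesis
    by (metis norm_one norm_power norm_ge_zero power_eq_1_iff zero_less_card_finite not_gr_zero
        real_norm_def abs_norm_cancel)
qed

locale characters =
  fixes \<tau> :: "'g::{finite, ab_group_add} \<Rightarrow> 'g \<Rightarrow> complex"
  assumes character_listing: "character_listing \<tau>"
begin

lemma is_character: "is_character (\<tau> \<mu>)"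
  using character_listing by (auto simp: character_listing_def bij_betw_def)

lemma add: "\<tau> \<mu> (\<alpha> + \<beta>) = \<tau> \<mu> \<alpha> * \<tau> \<mu> \<beta>"
  and zero [simp]: "\<tau> \<mu> 0 = 1"
  and norm: "cmod (\<tau> \<mu> \<alpha>) = 1"
  using is_character[of \<mu>] is_character_norm[of "\<tau> \<mu>"] by (auto simp: is_character_def)

lemma nz [simp]: "\<tau> \<mu> \<alpha> \<noteq> 0"
  using norm[of \<mu> \<alpha>] by auto

lemma index_add: "\<tau> (\<mu> + \<nu>) \<alpha> = \<tau> \<mu> \<alpha> * \<tau> \<nu> \<alpha>"
  using character_listing by (simp add: character_listing_def)

lemma inj: "\<tau> \<mu> = \<tau> \<nu> \<longleftrightarrow> \<mu> = \<nu>"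
  using character_listing by (auto simp: character_listing_def bij_betw_def inj_on_def)

lemma index_zero [simp]: "\<tau> 0 \<alpha> = 1"
  using index_add[of 0 0 \<alpha>] by auto

lemma cnj: "cnj (\<tau> \<mu> \<alpha>) = 1 / \<tau> \<mu> \<alpha>"
  using norm[of \<mu> \<alpha>] complex_norm_square[of "\<tau> \<mu> \<alpha>"] by (simp add: field_simps)

lemma minus: "\<tau> \<mu> (- \<alpha>) = 1 / \<tau> \<mu> \<alpha>"
  and index_minus: "\<tau> (- \<mu>) \<alpha> = 1 / \<tau> \<mu> \<alpha>"
  using add[of \<mu> \<alpha> "- \<alpha>"] index_add[of \<mu> "- \<mu>" \<alpha>] by (auto simp: field_simps)

lemma diff: "\<tau> \<mu> (\<alpha> - \<beta>) = \<tau> \<mu> \<alpha> / \<tau> \<mu> \<beta>"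
  and index_diff: "\<tau> (\<mu> - \<nu>) \<alpha> = \<tau> \<mu> \<alpha> / \<tau> \<nu> \<alpha>"
  using add[of \<mu> \<alpha> "- \<beta>"] index_add[of \<mu> "- \<nu>" \<alpha>] by (auto simp: minus index_minus)

lemmas simps = add index_add cnj minus index_minus diff index_diff

lemma sum_character: "(\<Sum>\<alpha>\<in>UNIV. \<tau> \<mu> \<alpha>) = (if \<mu> = 0 then of_nat CARD('g) else 0)"
proof (cases "\<mu> = 0")
  case False
  then obtain \<beta> where \<beta>: "\<tau> \<mu> \<beta> \<noteq> 1"
    using inj[of \<mu> 0] by (auto simp: fun_eq_iff)
  have "(\<Sum>\<alpha>\<in>UNIV. \<tau> \<mu> \<alpha>) = (\<Sum>\<alpha>\<in>UNIV. \<tau> \<mu> (\<alpha> + \<beta>))"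
    by (rule sum_group_shift[symmetric])
  also have "\<dots> = \<tau> \<mu> \<beta> * (\<Sum>\<alpha>\<in>UNIV. \<tau> \<mu> \<alpha>)"
    by (simp add: add sum_distrib_left mult.commute)
  finally show ?thesis using \<beta> False by auto
qed simp

definition fourier_kernel :: "'g \<Rightarrow> 'g \<Rightarrow> complex"
  where "fourier_kernel \<mu> \<alpha> = of_real (1 / sqrt (real CARD('g))) * cnj (\<tau> \<mu> \<alpha>)"

lemma sqrt_card_square: "of_real (1 / sqrt (real CARD('g))) * of_real (1 / sqrt (real CARD('g))) =
    (1 / of_nat CARD('g) :: complex)"
  unfolding of_real_mult[symmetric] by simp

lemma orthogonality: "(\<Sum>\<alpha>\<in>UNIV. \<tau> \<mu> \<alpha> * cnj (\<tau> \<nu> \<alpha>)) = (if \<mu> = \<nu> then of_nat CARD('g) else 0)"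
  using sum_character[of "\<mu> - \<nu>"] by (simp add: simps)

lemma fourier_matrix_inverse:
  "fourier_matrix \<tau> ** (\<chi> \<mu> \<alpha>. cnj (\<tau> \<mu> \<alpha>) / of_nat CARD('g)) = mat 1"
  "(\<chi> \<mu> \<alpha>. cnj (\<tau> \<mu> \<alpha>) / of_nat CARD('g)) ** fourier_matrix \<tau> = mat 1"
proof -
  have "(\<Sum>\<alpha>\<in>UNIV. cnj (\<tau> \<mu> \<alpha>) / of_nat CARD('g) * \<tau> \<nu> \<alpha>) = (if \<mu> = \<nu> then 1 else 0)" for \<mu> \<nu>
    using orthogonality[of \<nu> \<mu>] by (simp add: sum_divide_distrib[symmetric] mult.commute)
  then show *: "(\<chi> \<mu> \<alpha>. cnj (\<tau> \<mu> \<alpha>) / of_nat CARD('g)) ** fourier_matrix \<tau> = mat 1"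
    by (simp add: vec_eq_iff matrix_matrix_mult_def mat_def fourier_matrix_def)
  then show "fourier_matrix \<tau> ** (\<chi> \<mu> \<alpha>. cnj (\<tau> \<mu> \<alpha>) / of_nat CARD('g)) = mat 1"
    by (simp add: matrix_left_right_inverse)
qed

lemma dual_orthogonality: "(\<Sum>\<mu>\<in>UNIV. \<tau> \<mu> \<alpha> * cnj (\<tau> \<mu> \<beta>)) = (if \<alpha> = \<beta> then of_nat CARD('g) else 0)"
proof -
  have "(\<Sum>\<mu>\<in>UNIV. \<tau> \<mu> \<alpha> * (cnj (\<tau> \<mu> \<beta>) / of_nat CARD('g))) = (if \<alpha> = \<beta> then 1 else 0)"
    using fourier_matrix_inverse(1)[THEN arg_cong[where f = "\<lambda>A. A $ \<alpha> $ \<beta>"]]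
    by (simp add: matrix_matrix_mult_def mat_def fourier_matrix_def)
  then show ?thesis
    by (simp add: sum_divide_distrib[symmetric] divide_eq_eq split: if_splits)
qed

lemma dual_sum_character: "(\<Sum>\<mu>\<in>UNIV. \<tau> \<mu> \<alpha>) = (if \<alpha> = 0 then of_nat CARD('g) else 0)"
  using dual_orthogonality[of \<alpha> 0] by simp

lemma unitary_fourier_kernel: "unitary_kernel fourier_kernel"
proof -
  have "(\<Sum>a\<in>UNIV. fourier_kernel i a * cnj (fourier_kernel j a)) =
      (\<Sum>a\<in>UNIV. (1 / of_nat CARD('g)) * (\<tau> j a * cnj (\<tau> i a)))" for i j
    unfolding fourier_kernel_def sqrt_card_square[symmetric] by (simp add: mult_ac)
  moreover have "(\<Sum>i\<in>UNIV. cnj (fourier_kernel i a) * fourier_kernel i b) =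
      (\<Sum>i\<in>UNIV. (1 / of_nat CARD('g)) * (\<tau> i a * cnj (\<tau> i b)))" for a b
    unfolding fourier_kernel_def sqrt_card_square[symmetric] by (simp add: mult_ac)
  ultimately show ?thesis
    unfolding unitary_kernel_def sum_distrib_left[symmetric] orthogonality dual_orthogonality by auto
qed

lemma change_basis_fourier: "change_basis (fourier_matrix \<tau>) I = {p. conj_hom fourier_kernel p \<in> I}"
proof -
  have inv: "matrix_inv (fourier_matrix \<tau>) = (\<chi> \<mu> \<alpha>. cnj (\<tau> \<mu> \<alpha>) / of_nat CARD('g))"
    unfolding matrix_inv_def
  proof (rule some_equality)
    fix B assume "fourier_matrix \<tau> ** B = mat 1 \<and> B ** fourier_matrix \<tau> = mat 1"
    then show "B = (\<chi> \<mu> \<alpha>. cnj (\<tau> \<mu> \<alpha>) / of_nat CARD('g))"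
      by (metis fourier_matrix_inverse(2) matrix_mul_assoc matrix_mul_lid matrix_mul_rid)
  qed (simp add: fourier_matrix_inverse)
  have "matrix_inv (fourier_matrix \<tau>) $ i $ a * fourier_matrix \<tau> $ b $ j =
      fourier_kernel i a * cnj (fourier_kernel j b)" for i a b j
    unfolding inv using sqrt_card_square by (simp add: fourier_kernel_def fourier_matrix_def)
  then show ?thesis
    unfolding change_basis_def conj_hom_def by simp
qed

lemma cnj_cayley_eigenvalue: "cnj (cayley_eigenvalue \<tau> S \<mu>) = cayley_eigenvalue \<tau> S (- \<mu>)"
  by (simp add: cayley_eigenvalue_def simps)

text \<open>
  The eigenvalues are the Fourier transform of the indicator function of \<open>S\<close>, which is idempotent under pointwise multiplication. So
  they are idempotent under normalized convolution.
\<close>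

lemma cayley_eigenvalue_convolution:
  "(\<Sum>\<mu>\<in>UNIV. cayley_eigenvalue \<tau> S \<mu> * cayley_eigenvalue \<tau> S (\<nu> - \<mu>)) =
    of_nat CARD('g) * cayley_eigenvalue \<tau> S \<nu>"
proof -
  have "(\<Sum>\<mu>\<in>UNIV. cayley_eigenvalue \<tau> S \<mu> * cayley_eigenvalue \<tau> S (\<nu> - \<mu>)) =
      (\<Sum>\<mu>\<in>UNIV. \<Sum>\<theta>\<in>S. \<Sum>\<eta>\<in>S. \<tau> \<mu> (\<eta> - \<theta>) * \<tau> \<nu> (- \<eta>))"
    unfolding cayley_eigenvalue_def sum_product
    by (intro sum.cong refl) (simp add: simps)
  also have "\<dots> = (\<Sum>\<theta>\<in>S. \<Sum>\<mu>\<in>UNIV. \<Sum>\<eta>\<in>S. \<tau> \<mu> (\<eta> - \<theta>) * \<tau> \<nu> (- \<eta>))"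
    by (rule sum.swap)
  also have "\<dots> = (\<Sum>\<theta>\<in>S. \<Sum>\<eta>\<in>S. \<Sum>\<mu>\<in>UNIV. \<tau> \<mu> (\<eta> - \<theta>) * \<tau> \<nu> (- \<eta>))"
    by (rule sum.cong[OF refl], rule sum.swap)
  also have "\<dots> = (\<Sum>\<theta>\<in>S. \<Sum>\<eta>\<in>S. if \<eta> = \<theta> then of_nat CARD('g) * \<tau> \<nu> (- \<theta>) else 0)"
    unfolding sum_distrib_right[symmetric] dual_sum_character by (intro sum.cong) auto
  also have "\<dots> = of_nat CARD('g) * cayley_eigenvalue \<tau> S \<nu>"
    by (simp add: cayley_eigenvalue_def sum_distrib_left)
  finally show ?thesis .
qed

end

section \<open>The C*-norm\<close>

lemma norm_complex_scale: "norm (c *s v) = cmod c * norm (v :: complex ^ 'i::finite)"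
  by (simp add: norm_vec_def norm_mult L2_set_right_distrib)

lemma inner_vec_complex: "x \<bullet> y = Re (\<Sum>i\<in>UNIV. cnj (x $ i) * y $ i)"
  for x y :: "complex ^ 'i::finite"
  by (simp add: inner_vec_def inner_complex_def)

text \<open>
  The norm is the operator norm of left multiplication. By the last assumption the left regular representation is a
  *-representation on a Hilbert space, and it is faithful because there is a unit; the C*-identity is then that of operators.
\<close>

lemma cstar_norm_exists:
  fixes X :: "('i::finite, 'z) quantum_set_scheme"
  assumes add_left: "\<And>x y z. qmult X (x + y) z = qmult X x z + qmult X y z"
    and add_right: "\<And>x y z. qmult X x (y + z) = qmult X x y + qmult X x z"
    and scale_left: "\<And>c x y. qmult X (c *s x) y = c *s qmult X x y"
    and scale_right: "\<And>c x y. qmult X x (c *s y) = c *s qmult X x y"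
    and assoc: "\<And>x y z. qmult X (qmult X x y) z = qmult X x (qmult X y z)"
    and one_right: "\<And>x. qmult X x (qone X) = x"
    and adjoint: "\<And>x a b. qmult X (qstar X x) a \<bullet> b = a \<bullet> qmult X x b"
  shows "\<exists>\<nu> :: complex ^ 'i \<Rightarrow> real.
          (\<forall>x. 0 \<le> \<nu> x \<and> (\<nu> x = 0 \<longleftrightarrow> x = 0)) \<and>
          (\<forall>x y. \<nu> (x + y) \<le> \<nu> x + \<nu> y) \<and>
          (\<forall>c x. \<nu> (c *s x) = cmod c * \<nu> x) \<and>
          (\<forall>x y. \<nu> (qmult X x y) \<le> \<nu> x * \<nu> y) \<and>
          (\<forall>x. \<nu> (qmult X (qstar X x) x) = (\<nu> x)\<^sup>2)"
proof -
  define \<nu> where nu_def: "\<nu> x = onorm (qmult X x)" for x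
  have scaleR: "r *\<^sub>R v = of_real r *s v" for r and v :: "complex ^ 'i"
    by (simp add: vec_eq_iff scaleR_conv_of_real[where 'a = complex])
  have "linear (qmult X x)" for x
    by (rule linearI) (simp_all add: add_right scaleR scale_right)
  then have bl: "bounded_linear (qmult X x)" for x
    by (simp add: linear_conv_bounded_linear)
  have bound: "norm (qmult X x y) \<le> \<nu> x * norm y" for x y
    unfolding nu_def by (rule onorm[OF bl])
  have ge: "0 \<le> \<nu> x" for x
    unfolding nu_def by (rule onorm_pos_le[OF bl])
  have zero: "\<nu> x = 0 \<longleftrightarrow> x = 0" for x
  proof
    assume "\<nu> x = 0"
    then have "norm (qmult X x (qone X)) \<le> 0"
      using bound[of x "qone X"] by simp
    then show "x = 0" by (simp add: one_right)
  next
    assume "x = 0"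
    moreover have "qmult X 0 = (\<lambda>y. 0)"
    proof
      show "qmult X 0 y = 0" for y using scale_left[of 0 0 y] by simp
    qed
    ultimately show "\<nu> x = 0"
      by (simp add: nu_def onorm_zero)
  qed
  have triangle: "\<nu> (x + y) \<le> \<nu> x + \<nu> y" for x y
    unfolding nu_def by (subst ext[OF add_left]) (rule onorm_triangle[OF bl bl])
  have scale_le: "\<nu> (c *s x) \<le> cmod c * \<nu> x" for c x
    unfolding nu_def[of "c *s x"]
  proof (rule onorm_bound)
    fix y
    show "norm (qmult X (c *s x) y) \<le> cmod c * \<nu> x * norm y"
      using bound[of x y] by (simp add: scale_left norm_complex_scale mult.assoc mult_left_mono)
  qed (simp add: ge)
  have scale: "\<nu> (c *s x) = cmod c * \<nu> x" for c x
  proof (cases "c = 0")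
    case False
    have "\<nu> x \<le> cmod (1 / c) * \<nu> (c *s x)"
      using scale_le[of "1 / c" "c *s x"] False by simp
    then show ?thesis
      using scale_le[of c x] False by (simp add: norm_divide field_simps)
  qed (use zero in simp)
  have mult: "\<nu> (qmult X x y) \<le> \<nu> x * \<nu> y" for x y
  proof -
    have "qmult X (qmult X x y) = qmult X x \<circ> qmult X y"
      by (simp add: fun_eq_iff assoc)
    then show ?thesis
      unfolding nu_def using onorm_compose[OF bl bl, of x y] by simp
  qed
  have star_le: "\<nu> (qstar X x) \<le> \<nu> x" for x
    unfolding nu_def[of "qstar X x"]
  proof (rule onorm_bound)
    fix a
    let ?b = "qmult X (qstar X x) a"
    have "(norm ?b)\<^sup>2 = a \<bullet> qmult X x ?b"
      by (simp add: power2_norm_eq_inner adjoint)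
    also have "\<dots> \<le> norm a * (\<nu> x * norm ?b)"
      by (rule order_trans[OF norm_cauchy_schwarz]) (simp add: bound mult_left_mono)
    finally have "norm ?b * norm ?b \<le> (\<nu> x * norm a) * norm ?b"
      by (simp add: power2_eq_square mult_ac)
    then show "norm ?b \<le> \<nu> x * norm a"
      using ge[of x] by (cases "norm ?b = 0") auto
  qed (rule ge)
  have "\<nu> (qmult X (qstar X x) x) = (\<nu> x)\<^sup>2" for x
  proof (rule antisym)
    show "\<nu> (qmult X (qstar X x) x) \<le> (\<nu> x)\<^sup>2"
      using mult[of "qstar X x" x] mult_right_mono[OF star_le ge, of x x]
      by (simp add: power2_eq_square)
    let ?s = "sqrt (\<nu> (qmult X (qstar X x) x))"
    have "\<nu> x \<le> ?s"
      unfolding nu_def[of x]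
    proof (rule onorm_bound)
      fix a
      have "(norm (qmult X x a))\<^sup>2 = qmult X (qmult X (qstar X x) x) a \<bullet> a"
        using adjoint[of x "qmult X x a" a] by (simp add: power2_norm_eq_inner assoc)
      also have "\<dots> \<le> (\<nu> (qmult X (qstar X x) x) * norm a) * norm a"
        by (rule order_trans[OF norm_cauchy_schwarz]) (simp add: bound mult_right_mono)
      also have "\<dots> = (?s * norm a)\<^sup>2"
        by (simp add: ge power2_eq_square)
      finally show "norm (qmult X x a) \<le> ?s * norm a"
        by (rule power2_le_imp_le) (simp add: ge)
    qed (simp add: ge)
    then show "(\<nu> x)\<^sup>2 \<le> \<nu> (qmult X (qstar X x) x)"
      using ge power_mono[of "\<nu> x" ?s 2] by simp
  qed
  then show ?thesis
    using ge zero triangle scale mult by blast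
qed

section \<open>The Cayley graph and its twist are quantum graphs\<close>

lemma onb_coord_cayley: "onb_coord (cayley S) c v = v $ c"
  by (simp add: onb_coord_def qinner_def cayley_def axis_def if_zero)

lemma star_matrix_cayley: "star_matrix (cayley S) i j = (if i = j then 1 else 0)"
  by (simp add: star_matrix_def onb_coord_cayley) (simp add: cayley_def axis_def)

lemma mult_tmat_cayley: "mult_tmat (cayley S) [c] [a, b] = (if c = a \<and> c = b then 1 else 0)"
  by (simp add: mult_tmat_def onb_coord_cayley) (simp add: cayley_def axis_def)

lemma adj_tmat_cayley: "adj_tmat (cayley S) [c] [a] = (if c - a \<in> S then 1 else 0)"
proof -
  have "(\<Sum>\<alpha>\<in>UNIV. (if c - \<alpha> \<in> S then 1 else 0) * axis a (1 :: complex) $ \<alpha>) =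
      (\<Sum>\<alpha>\<in>UNIV. if \<alpha> = a then (if c - a \<in> S then 1 else 0) else 0)"
    by (intro sum.cong) (auto simp: axis_def)
  then show ?thesis
    by (simp add: adj_tmat_def onb_coord_cayley) (simp add: cayley_def)
qed

lemma unit_tmat_cayley: "unit_tmat (cayley S) [c] [] = 1"
  by (simp add: unit_tmat_def onb_coord_cayley) (simp add: cayley_def)

lemma finite_quantum_set_cayley: "finite_quantum_set (cayley S)"
proof (unfold_locales, goal_cases)
  case 12
  show ?case
    by (rule cstar_norm_exists) (simp_all add: cayley_def vec_eq_iff ring_distribs inner_vec_complex mult_ac)
qed (simp_all add: cayley_def vec_eq_iff ring_distribs axis_def)

lemma is_quantum_graph_cayley: "is_quantum_graph (cayley S)"
  unfolding is_quantum_graph_def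
proof (intro conjI exI)
  let ?P = "(\<chi> a b. if a - b \<in> S then 1 else 0) :: ((complex, 'a) vec, 'a) vec"
  show "\<forall>i j. qinner (cayley S) (onb (cayley S) i) (onb (cayley S) j) = (if i = j then 1 else 0)"
    using onb_coord_cayley[of S] by (simp add: onb_coord_def) (simp add: cayley_def axis_def)
  have mult: "qmult (cayley S) (axis a 1) (axis c 1) $ r = (if a = r then if c = r then 1 else 0 else 0)" for a c r :: 'a
    by (simp add: cayley_def axis_def)
  show "op_tensor_mult (cayley S) ?P ?P = ?P"
  proof (simp only: vec_eq_iff, intro allI)
    fix r s
    have "op_tensor_mult (cayley S) ?P ?P $ r $ s = (\<Sum>a\<in>UNIV. \<Sum>b\<in>UNIV. \<Sum>c\<in>UNIV. \<Sum>d\<in>UNIV.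
        if d = s then if c = r then if b = s then if a = r then ?P $ r $ s else 0 else 0 else 0 else 0)"
      unfolding op_tensor_mult_def vec_lambda_beta mult by (intro sum.cong) auto
    then show "op_tensor_mult (cayley S) ?P ?P $ r $ s = ?P $ r $ s"
      by simp
  qed
  have star: "qstar (cayley S) (axis a 1) $ r = (if a = r then 1 else 0)" for a r :: 'a
    by (simp add: cayley_def axis_def)
  show "op_tensor_star (cayley S) ?P = ?P"
  proof (simp only: vec_eq_iff, intro allI)
    fix r s
    have "op_tensor_star (cayley S) ?P $ r $ s = (\<Sum>a\<in>UNIV. \<Sum>b\<in>UNIV.
        if b = s then if a = r then ?P $ r $ s else 0 else 0)"
      unfolding op_tensor_star_def vec_lambda_beta star by (intro sum.cong) auto
    then show "op_tensor_star (cayley S) ?P $ r $ s = ?P $ r $ s"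
      by simp
  qed
  show "adj (cayley S) = adjacency_of (cayley S) ?P"
  proof (intro ext, simp only: vec_eq_iff, intro allI)
    fix x :: "(complex, 'a) vec" and r
    have counit: "counit (cayley S) (qmult (cayley S) (axis b 1) x) = x $ b" for b
      by (simp add: cayley_def axis_def if_zero)
    have "adjacency_of (cayley S) ?P x $ r = (\<Sum>b\<in>UNIV. ?P $ r $ b * x $ b)"
      unfolding adjacency_of_def counit
      by (subst sum.swap) (simp add: axis_def if_zero)
    then show "adj (cayley S) x $ r = adjacency_of (cayley S) ?P x $ r"
      by (simp add: cayley_def)
  qed
qed (rule finite_quantum_set_cayley)

context bicharacter
begin

lemma finite_quantum_set_twisted: "finite_quantum_set (twisted_cayley \<tau> \<sigma> S)"
proof -
  let ?X = "twisted_cayley \<tau> \<sigma> S"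
  have assoc: "qmult ?X (qmult ?X x y) z = qmult ?X x (qmult ?X y z)" for x y z
  proof (simp only: vec_eq_iff, intro allI)
    fix \<kappa>
    let ?t = "\<lambda>\<mu> \<nu>. x $ \<mu> * y $ (\<nu> - \<mu>) * cnj (\<sigma> \<mu> (\<nu> - \<mu>)) * z $ (\<kappa> - \<nu>) * cnj (\<sigma> \<nu> (\<kappa> - \<nu>))"
    have "qmult ?X (qmult ?X x y) z $ \<kappa> = (\<Sum>\<nu>\<in>UNIV. \<Sum>\<mu>\<in>UNIV.
        ?t \<mu> \<nu>)"
      by (simp add: qmult_nth sum_distrib_right)
    also have "\<dots> = (\<Sum>\<mu>\<in>UNIV. \<Sum>\<nu>\<in>UNIV.
        ?t \<mu> \<nu>)"
      by (rule sum.swap)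
    also have "\<dots> = (\<Sum>\<mu>\<in>UNIV. \<Sum>\<rho>\<in>UNIV. x $ \<mu> * y $ (\<rho> + \<mu> - \<mu>) * cnj (\<sigma> \<mu> (\<rho> + \<mu> - \<mu>)) *
        z $ (\<kappa> - (\<rho> + \<mu>)) * cnj (\<sigma> (\<rho> + \<mu>) (\<kappa> - (\<rho> + \<mu>))))"
      by (intro sum.cong refl sum_group_shift[symmetric])
    also have "\<dots> = (\<Sum>\<mu>\<in>UNIV. \<Sum>\<rho>\<in>UNIV. x $ \<mu> * (y $ \<rho> * z $ (\<kappa> - \<mu> - \<rho>) * cnj (\<sigma> \<rho> (\<kappa> - \<mu> - \<rho>))) *
        cnj (\<sigma> \<mu> (\<kappa> - \<mu>)))"
    proof (intro sum.cong refl)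
      fix \<mu> \<rho>
      have "\<kappa> - (\<rho> + \<mu>) = \<kappa> - \<mu> - \<rho>" by (simp add: algebra_simps)
      then show "x $ \<mu> * y $ (\<rho> + \<mu> - \<mu>) * cnj (\<sigma> \<mu> (\<rho> + \<mu> - \<mu>)) *
          z $ (\<kappa> - (\<rho> + \<mu>)) * cnj (\<sigma> (\<rho> + \<mu>) (\<kappa> - (\<rho> + \<mu>))) =
        x $ \<mu> * (y $ \<rho> * z $ (\<kappa> - \<mu> - \<rho>) * cnj (\<sigma> \<rho> (\<kappa> - \<mu> - \<rho>))) * cnj (\<sigma> \<mu> (\<kappa> - \<mu>))"
        by (simp add: simps field_simps)
    qed
    also have "\<dots> = qmult ?X x (qmult ?X y z) $ \<kappa>"
      by (simp add: qmult_nth sum_distrib_left sum_distrib_right)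
    finally show "qmult ?X (qmult ?X x y) z $ \<kappa> = qmult ?X x (qmult ?X y z) $ \<kappa>" .
  qed
  have one_left: "qmult ?X (qone ?X) x = x" and one_right: "qmult ?X x (qone ?X) = x" for x
  proof -
    have one: "qone ?X $ \<mu> = (if \<mu> = 0 then 1 else 0)" for \<mu>
      by (simp add: twisted_cayley_def axis_def)
    show "qmult ?X (qone ?X) x = x" "qmult ?X x (qone ?X) = x"
      by (simp_all add: vec_eq_iff qmult_nth one if_zero)
  qed
  have lin: "qmult ?X (x + y) z = qmult ?X x z + qmult ?X y z"
    "qmult ?X x (y + z) = qmult ?X x y + qmult ?X x z"
    "qmult ?X (c *s x) y = c *s qmult ?X x y"
    "qmult ?X x (c *s y) = c *s qmult ?X x y" for c x y z
    by (simp_all add: vec_eq_iff qmult_nth ring_distribs sum.distrib sum_distrib_left mult_ac)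
  have adjoint: "qmult ?X (qstar ?X x) a \<bullet> b = a \<bullet> qmult ?X x b" for x a b
  proof -
    have "cnj (qmult ?X (qstar ?X x) a $ \<kappa>) = (\<Sum>\<mu>\<in>UNIV. x $ \<mu> * cnj (a $ (\<kappa> + \<mu>)) * cnj (\<sigma> \<mu> \<kappa>))" for \<kappa>
    proof -
      have "cnj (qmult ?X (qstar ?X x) a $ \<kappa>) =
          (\<Sum>\<mu>\<in>UNIV. x $ (- \<mu>) * cnj (a $ (\<kappa> - \<mu>)) * cnj (\<sigma> (- \<mu>) \<kappa>))"
        unfolding qmult_nth cnj_sum by (intro sum.cong) (simp_all add: qstar_nth simps)
      also have "\<dots> = (\<Sum>\<mu>\<in>UNIV. x $ (- (- \<mu>)) * cnj (a $ (\<kappa> - (- \<mu>))) * cnj (\<sigma> (- (- \<mu>)) \<kappa>))"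
        by (rule sum_group_shift[symmetric])
      finally show ?thesis by simp
    qed
    then have "(\<Sum>\<kappa>\<in>UNIV. cnj (qmult ?X (qstar ?X x) a $ \<kappa>) * b $ \<kappa>) =
        (\<Sum>\<kappa>\<in>UNIV. \<Sum>\<mu>\<in>UNIV. x $ \<mu> * cnj (a $ (\<kappa> + \<mu>)) * cnj (\<sigma> \<mu> \<kappa>) * b $ \<kappa>)"
      by (simp add: sum_distrib_right)
    also have "\<dots> = (\<Sum>\<mu>\<in>UNIV. \<Sum>\<kappa>\<in>UNIV. x $ \<mu> * cnj (a $ (\<kappa> + \<mu>)) * cnj (\<sigma> \<mu> \<kappa>) * b $ \<kappa>)"
      by (rule sum.swap)
    also have "\<dots> = (\<Sum>\<mu>\<in>UNIV. \<Sum>\<kappa>\<in>UNIV. x $ \<mu> * cnj (a $ (\<kappa> - \<mu> + \<mu>)) * cnj (\<sigma> \<mu> (\<kappa> - \<mu>)) * b $ (\<kappa> - \<mu>))"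
      by (intro sum.cong refl sum_group_shift[symmetric])
    also have "\<dots> = (\<Sum>\<kappa>\<in>UNIV. \<Sum>\<mu>\<in>UNIV. x $ \<mu> * cnj (a $ (\<kappa> - \<mu> + \<mu>)) * cnj (\<sigma> \<mu> (\<kappa> - \<mu>)) * b $ (\<kappa> - \<mu>))"
      by (rule sum.swap)
    also have "\<dots> = (\<Sum>\<kappa>\<in>UNIV. cnj (a $ \<kappa>) * qmult ?X x b $ \<kappa>)"
      by (simp add: qmult_nth sum_distrib_left mult_ac)
    finally show ?thesis by (simp add: inner_vec_complex)
  qed
  have star_mult: "qstar ?X (qmult ?X x y) = qmult ?X (qstar ?X y) (qstar ?X x)" for x y
  proof (simp only: vec_eq_iff, intro allI)
    fix \<kappa>
    have "qstar ?X (qmult ?X x y) $ \<kappa> = (\<Sum>\<mu>\<in>UNIV. cnj (x $ \<mu>) * cnj (y $ (- \<kappa> - \<mu>)) * \<sigma> \<mu> (- \<kappa> - \<mu>) * \<sigma> (- \<kappa>) \<kappa>)"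
      by (simp add: qstar_nth qmult_nth sum_distrib_right)
    also have "\<dots> = (\<Sum>\<mu>\<in>UNIV. cnj (x $ (- (\<kappa> - \<mu>))) * cnj (y $ (- \<kappa> - (- (\<kappa> - \<mu>)))) *
        \<sigma> (- (\<kappa> - \<mu>)) (- \<kappa> - (- (\<kappa> - \<mu>))) * \<sigma> (- \<kappa>) \<kappa>)"
      using sum_group_shift(4)[of "\<lambda>\<mu>. cnj (x $ (- \<mu>)) * cnj (y $ (- \<kappa> - (- \<mu>))) * \<sigma> (- \<mu>) (- \<kappa> - (- \<mu>)) * \<sigma> (- \<kappa>) \<kappa>" \<kappa>]
        sum_group_shift(5)[of "\<lambda>\<mu>. cnj (x $ \<mu>) * cnj (y $ (- \<kappa> - \<mu>)) * \<sigma> \<mu> (- \<kappa> - \<mu>) * \<sigma> (- \<kappa>) \<kappa>"]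
      by simp
    also have "\<dots> = qmult ?X (qstar ?X y) (qstar ?X x) $ \<kappa>"
      unfolding qmult_nth qstar_nth by (intro sum.cong refl) (simp add: simps field_simps)
    finally show "qstar ?X (qmult ?X x y) $ \<kappa> = qmult ?X (qstar ?X y) (qstar ?X x) $ \<kappa>" .
  qed
  have counit: "counit ?X x = (\<Sum>i\<in>UNIV. qmult ?X x (axis i 1) $ i)" for x
  proof -
    have "qmult ?X x (axis i 1) $ i = (\<Sum>(\<mu> :: 'g)\<in>UNIV. if \<mu> = 0 then x $ 0 else 0)" for i
      unfolding qmult_nth by (intro sum.cong) (auto simp: axis_def)
    then show ?thesis by (simp add: counit_twisted)
  qed
  show ?thesis
  proof (unfold_locales, goal_cases)
    case 12
    show ?case by (rule cstar_norm_exists) (rule lin assoc one_right adjoint)+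
  qed (simp_all only: lin assoc one_left one_right star_mult counit,
    simp_all add: vec_eq_iff qstar_nth ring_distribs simps add_divide_distrib)
qed

end

text \<open>
  The projection is the sum of the elements \<open>\<lambda>\<^sub>\<mu> t\<^sub>\<mu> \<otimes> t\<^sub>\<mu>\<^sup>*\<close> divided by \<open>N\<close>. In the tensor product with the opposite
  algebra the phases of the two factors cancel, so the \<open>t\<^sub>\<mu> \<otimes> t\<^sub>\<mu>\<^sup>*\<close> multiply like the elements of \<open>\<Gamma>\<close>, and idempotency is the convolution identity of the
  eigenvalues. Self-adjointness is \<open>cnj \<lambda>\<^sub>\<mu> = \<lambda>\<^sub>-\<^sub>\<mu>\<close>.
\<close>

lemma is_quantum_graph_twisted:
  fixes \<tau> :: "'g::{finite, ab_group_add} \<Rightarrow> 'g \<Rightarrow> complex"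
  assumes \<tau>: "character_listing \<tau>" and \<sigma>: "unitary_bicharacter \<sigma>"
  shows "is_quantum_graph (twisted_cayley \<tau> \<sigma> S)"
  unfolding is_quantum_graph_def
proof (intro conjI exI)
  let ?X = "twisted_cayley \<tau> \<sigma> S" and ?lam = "cayley_eigenvalue \<tau> S" and ?N = "of_nat CARD('g) :: complex"
  interpret bicharacter \<sigma> by standard fact
  interpret t: characters \<tau> by standard fact
  let ?p = "\<lambda>a. ?lam a * \<sigma> (- a) a / ?N"
  \<comment> \<open>The factor \<open>\<sigma> (- a) a\<close> is the one in \<open>t\<^sub>a\<^sup>* = \<sigma> a (- a) t\<^sub>-\<^sub>a\<close>.\<close>
  let ?P = "(\<chi> a b. if b = - a then ?p a else 0) :: ((complex, 'g) vec, 'g) vec"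
  show "finite_quantum_set ?X" by (rule finite_quantum_set_twisted)
  show "\<forall>i j. qinner ?X (onb ?X i) (onb ?X j) = (if i = j then 1 else 0)"
    using onb_coord_twisted[of \<tau> S] sqrt_card
    by (simp add: onb_coord_def onb_nth del: of_real_divide)
  have mult: "qmult ?X (axis a 1) (axis c 1) $ r = (if a + c = r then cnj (\<sigma> a c) else 0)" for a c r
  proof -
    have "qmult ?X (axis a 1) (axis c 1) $ r =
        (\<Sum>\<mu>\<in>UNIV. if \<mu> = a then (if a + c = r then cnj (\<sigma> a c) else 0) else 0)"
      unfolding qmult_nth by (intro sum.cong) (auto simp: axis_def algebra_simps)
    then show ?thesis by simp
  qed
  show "op_tensor_mult ?X ?P ?P = ?P"
  proof (simp only: vec_eq_iff, intro allI)
    fix r s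
    let ?t = "\<lambda>a. ?p a * ?p (r - a) * cnj (\<sigma> a (r - a)) * cnj (\<sigma> (r - a) a)"
    have "op_tensor_mult ?X ?P ?P $ r $ s = (\<Sum>a\<in>UNIV. \<Sum>b\<in>UNIV. \<Sum>c\<in>UNIV. \<Sum>d\<in>UNIV.
        if d = - c then if b = - a then if c = r - a then if s = - r
          then ?t a else 0 else 0 else 0 else 0)"
      unfolding op_tensor_mult_def vec_lambda_beta mult
      by (intro sum.cong refl) (auto simp: simps field_simps)
    also have "\<dots> = (\<Sum>a\<in>UNIV. \<Sum>b\<in>UNIV. \<Sum>c\<in>UNIV. if b = - a then if c = r - a then if s = - r
          then ?t a else 0 else 0 else 0)"
      by simp
    also have "\<dots> = (\<Sum>a\<in>UNIV. \<Sum>c\<in>UNIV. \<Sum>b\<in>UNIV. if b = - a then if c = r - a then if s = - r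
          then ?t a else 0 else 0 else 0)"
      by (rule sum.cong[OF refl], rule sum.swap)
    also have "\<dots> = (\<Sum>a\<in>UNIV. if s = - r
          then ?t a else 0)"
      by simp
    also have "\<dots> = (\<Sum>a\<in>UNIV. if s = - r then ?lam a * ?lam (r - a) * (\<sigma> (- r) r / (?N * ?N)) else 0)"
      by (intro sum.cong refl) (simp add: simps field_simps)
    also have "\<dots> = ?P $ r $ s"
      by (simp add: sum_distrib_right[symmetric] t.cayley_eigenvalue_convolution sum_divide_distrib[symmetric])
    finally show "op_tensor_mult ?X ?P ?P $ r $ s = ?P $ r $ s" .
  qed
  have star: "qstar ?X (axis a 1) $ r = (if a = - r then \<sigma> (- r) r else 0)" for a r
    by (simp add: qstar_nth axis_def eq_commute)
  show "op_tensor_star ?X ?P = ?P"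
  proof (simp only: vec_eq_iff, intro allI)
    fix r s
    have "op_tensor_star ?X ?P $ r $ s = (\<Sum>a\<in>UNIV. \<Sum>b\<in>UNIV.
        if b = - s then if a = - r then (if s = - r then ?p r else 0) else 0 else 0)"
      unfolding op_tensor_star_def vec_lambda_beta star
      by (intro sum.cong refl) (auto simp: t.cnj_cayley_eigenvalue simps minus_equation_iff[of s])
    then show "op_tensor_star ?X ?P $ r $ s = ?P $ r $ s"
      by simp
  qed
  show "adj ?X = adjacency_of ?X ?P"
  proof (intro ext, simp only: vec_eq_iff, intro allI)
    fix x :: "(complex, 'g) vec" and r
    have counit: "counit ?X (qmult ?X (axis b 1) x) = ?N * (x $ (- b) * cnj (\<sigma> b (- b)))" for b
    proof -
      have "qmult ?X (axis b 1) x $ 0 = (\<Sum>\<mu>\<in>UNIV. if \<mu> = b then x $ (- b) * cnj (\<sigma> b (- b)) else 0)"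
        unfolding qmult_nth by (intro sum.cong) (auto simp: axis_def)
      then show ?thesis by (simp add: counit_twisted)
    qed
    have "adjacency_of ?X ?P x $ r = (\<Sum>b\<in>UNIV. ?P $ r $ b * (?N * (x $ (- b) * cnj (\<sigma> b (- b)))))"
      unfolding adjacency_of_def counit
      by (subst sum.swap) (simp add: axis_def if_zero)
    also have "\<dots> = (\<Sum>b\<in>UNIV. if b = - r then ?lam r * x $ r else 0)"
      by (intro sum.cong) (auto simp: simps)
    also have "\<dots> = adj ?X x $ r"
      by (simp add: adj_nth)
    finally show "adj ?X x $ r = adjacency_of ?X ?P x $ r" ..
  qed
qed


section \<open>Conjugation and twisting are monoidal\<close>

lemma tm_conj_linear:
  "tm_conj V k l (\<lambda>i j. c * T i j + R i j) = (\<lambda>i j. c * tm_conj V k l T i j + tm_conj V k l R i j)"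
  by (simp add: tm_conj_def fun_eq_iff ring_distribs sum.distrib sum_distrib_left mult_ac)

lemma tm_conj_id:
  assumes "unitary_kernel V"
  shows "tm_conj V k k (tm_id k) = tm_id k"
proof (intro ext)
  fix i j :: "'a list"
  have "tm_conj V k k (tm_id k) i j = (\<Sum>p | length p = k. \<Sum>q | length q = k.
      if q = p then tensor_power V i p * cnj (tensor_power V j p) else 0)"
    unfolding tm_conj_def by (intro sum.cong refl) (auto simp: tm_id_def)
  also have "\<dots> = (\<Sum>p | length p = k. tensor_power V i p * cnj (tensor_power V j p))"
    by (intro sum.cong refl) simp
  finally show "tm_conj V k k (tm_id k) i j = tm_id k i j"
    by (simp add: tensor_power_unitary[OF assms] tm_id_def)
qed

lemma tm_conj_comp:
  assumes V: "unitary_kernel V"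
  shows "tm_conj V k l (tm_comp m T R) = tm_comp m (tm_conj V m l T) (tm_conj V k m R)"
proof (intro ext)
  fix i j :: "'a list"
  define A where "A q = (\<Sum>p | length p = l. tensor_power V i p * T p q)" for q
  define B where "B q = (\<Sum>t | length t = k. R q t * cnj (tensor_power V j t))" for q
  have T: "tm_conj V m l T i s = (\<Sum>q | length q = m. A q * cnj (tensor_power V s q))" for s
    unfolding tm_conj_def A_def sum_distrib_right by (rule sum.swap)
  have R: "tm_conj V k m R s j = (\<Sum>q | length q = m. tensor_power V s q * B q)" for s
    by (simp add: tm_conj_def B_def sum_distrib_left mult_ac)
  have "tm_comp m (tm_conj V m l T) (tm_conj V k m R) i j =
      (\<Sum>s | length s = m. \<Sum>q | length q = m. \<Sum>q' | length q' = m.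
        A q * B q' * (cnj (tensor_power V s q) * tensor_power V s q'))"
    unfolding tm_comp_def T R sum_product by (intro sum.cong refl) (simp add: mult_ac)
  also have "\<dots> = (\<Sum>q | length q = m. \<Sum>s | length s = m. \<Sum>q' | length q' = m.
        A q * B q' * (cnj (tensor_power V s q) * tensor_power V s q'))"
    by (rule sum.swap)
  also have "\<dots> = (\<Sum>q | length q = m. \<Sum>q' | length q' = m. \<Sum>s | length s = m.
        A q * B q' * (cnj (tensor_power V s q) * tensor_power V s q'))"
    by (rule sum.cong[OF refl], rule sum.swap)
  also have "\<dots> = (\<Sum>q | length q = m. \<Sum>q' | length q' = m. if q' = q then A q * B q else 0)"
    unfolding sum_distrib_left[symmetric] tensor_power_unitary'[OF V] by (intro sum.cong refl) auto
  also have "\<dots> = (\<Sum>q | length q = m. A q * B q)"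
    by (intro sum.cong refl) simp
  also have "\<dots> = (\<Sum>q | length q = m. \<Sum>p | length p = l. \<Sum>t | length t = k.
      tensor_power V i p * T p q * (R q t * cnj (tensor_power V j t)))"
    by (simp add: A_def B_def sum_product)
  also have "\<dots> = (\<Sum>p | length p = l. \<Sum>q | length q = m. \<Sum>t | length t = k.
      tensor_power V i p * T p q * (R q t * cnj (tensor_power V j t)))"
    by (rule sum.swap)
  also have "\<dots> = (\<Sum>p | length p = l. \<Sum>t | length t = k. \<Sum>q | length q = m.
      tensor_power V i p * T p q * (R q t * cnj (tensor_power V j t)))"
    by (rule sum.cong[OF refl], rule sum.swap)
  also have "\<dots> = tm_conj V k l (tm_comp m T R) i j"
    by (simp add: tm_conj_def tm_comp_def sum_distrib_left sum_distrib_right mult_ac)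
  finally show "tm_conj V k l (tm_comp m T R) i j = tm_comp m (tm_conj V m l T) (tm_conj V k m R) i j" ..
qed

lemma sum_lists_append:
  fixes f :: "'i::finite list \<Rightarrow> 'a::comm_monoid_add"
  shows "(\<Sum>p | length p = m + n. f p) = (\<Sum>p | length p = m. \<Sum>q | length q = n. f (p @ q))"
proof -
  have "(\<Sum>p | length p = m + n. f p) = (\<Sum>(p, q)\<in>{p. length p = m} \<times> {q. length q = n}. f (p @ q))"
    by (rule sum.reindex_bij_witness[of _ "\<lambda>(p, q). p @ q" "\<lambda>p. (take m p, drop m p)"]) auto
  then show ?thesis by (simp add: sum.cartesian_product)
qed

lemma tm_conj_tensor:
  "tm_conj V (k + k') (l + l') (tm_tensor k l T R) = tm_tensor k l (tm_conj V k l T) (tm_conj V k' l' R)"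
proof (intro ext)
  fix i j :: "'a list"
  show "tm_conj V (k + k') (l + l') (tm_tensor k l T R) i j =
    tm_tensor k l (tm_conj V k l T) (tm_conj V k' l' R) i j"
  proof (cases "length i = l + l' \<and> length j = k + k'")
    case False
    then have "\<not> (length (take l i) = l \<and> length (take k j) = k) \<or>
        \<not> (length (drop l i) = l' \<and> length (drop k j) = k')"
      by auto
    then have "tm_conj V k l T (take l i) (take k j) = 0 \<or> tm_conj V k' l' R (drop l i) (drop k j) = 0"
      using tmats_zero[OF tm_conj_tmats[of V k l T]] tmats_zero[OF tm_conj_tmats[of V k' l' R]] by blast
    then show ?thesis
      using tmats_zero[OF tm_conj_tmats False] by (auto simp: tm_tensor_def)
  next
    case True
    have i: "tensor_power V i (p @ p') = tensor_power V (take l i) p * tensor_power V (drop l i) p'"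
      if "length p = l" for p p'
      using that True tensor_power_append[of "take l i" p V "drop l i" p'] by simp
    have j: "tensor_power V j (q @ q') = tensor_power V (take k j) q * tensor_power V (drop k j) q'"
      if "length q = k" for q q'
      using that True tensor_power_append[of "take k j" q V "drop k j" q'] by simp
    have "tm_conj V (k + k') (l + l') (tm_tensor k l T R) i j =
        (\<Sum>p | length p = l. \<Sum>p' | length p' = l'. \<Sum>q | length q = k. \<Sum>q' | length q' = k'.
          (tensor_power V (take l i) p * T p q * cnj (tensor_power V (take k j) q)) *
          (tensor_power V (drop l i) p' * R p' q' * cnj (tensor_power V (drop k j) q')))"
      unfolding tm_conj_def sum_lists_append
      by (intro sum.cong refl) (simp add: tm_tensor_def i j)
    also have "\<dots> = tm_tensor k l (tm_conj V k l T) (tm_conj V k' l' R) i j"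
      by (simp add: tm_tensor_def tm_conj_def sum_product)
    finally show ?thesis .
  qed
qed

lemma tm_conj_dagger: "tm_conj V l k (tm_dagger T) = tm_dagger (tm_conj V k l T)"
proof (intro ext)
  fix i j :: "'a list"
  show "tm_conj V l k (tm_dagger T) i j = tm_dagger (tm_conj V k l T) i j"
    unfolding tm_conj_def tm_dagger_def cnj_sum
    by (subst sum.swap) (simp add: mult_ac)
qed

lemma twist_tmat_tmats: "T \<in> tmats k l \<Longrightarrow> twist_tmat \<sigma> T \<in> tmats k l"
  by (auto simp: tmats_def twist_tmat_def)

context bicharacter
begin

lemma twist_tmat_id: "twist_tmat \<sigma> (tm_id k) = tm_id k"
  by (auto simp: twist_tmat_def tm_id_def cnj_sigma_multi fun_eq_iff)

lemma twist_tmat_comp: "twist_tmat \<sigma> (tm_comp m T R) = tm_comp m (twist_tmat \<sigma> T) (twist_tmat \<sigma> R)"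
  by (simp add: twist_tmat_def tm_comp_def fun_eq_iff cnj_sigma_multi sum_distrib_left)

lemma twist_tmat_dagger: "twist_tmat \<sigma> (tm_dagger T) = tm_dagger (twist_tmat \<sigma> T)"
  by (simp add: twist_tmat_def tm_dagger_def fun_eq_iff)

lemma twist_tmat_linear:
  "twist_tmat \<sigma> (\<lambda>i j. c * T i j + R i j) = (\<lambda>i j. c * twist_tmat \<sigma> T i j + twist_tmat \<sigma> R i j)"
  by (simp add: twist_tmat_def fun_eq_iff algebra_simps)

text \<open>
  The phase of a concatenation has the extra factor \<open>\<sigma>\<close> of the two total degrees. It is the same for outputs and
  inputs wherever the entries are nonzero, and so it cancels.
\<close>

lemma twist_tmat_tensor:
  assumes T: "\<And>i j. T i j \<noteq> 0 \<Longrightarrow> sum_list i = sum_list j"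
    and R: "\<And>i j. R i j \<noteq> 0 \<Longrightarrow> sum_list i = sum_list j"
  shows "twist_tmat \<sigma> (tm_tensor k l T R) = tm_tensor k l (twist_tmat \<sigma> T) (twist_tmat \<sigma> R)"
proof (intro ext)
  fix i j :: "'g list"
  show "twist_tmat \<sigma> (tm_tensor k l T R) i j = tm_tensor k l (twist_tmat \<sigma> T) (twist_tmat \<sigma> R) i j"
  proof (cases "T (take l i) (take k j) = 0 \<or> R (drop l i) (drop k j) = 0")
    case False
    then have "\<sigma> (sum_list (take l i)) (sum_list (drop l i)) = \<sigma> (sum_list (take k j)) (sum_list (drop k j))"
      using T R by metis
    then show ?thesis
      using sigma_multi_append[of "take l i" "drop l i"] sigma_multi_append[of "take k j" "drop k j"]
      by (simp add: twist_tmat_def tm_tensor_def cnj)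
  qed (auto simp: twist_tmat_def tm_tensor_def)
qed

end

lemma tmats_eqI_1_1: "T \<in> tmats 1 1 \<Longrightarrow> R \<in> tmats 1 1 \<Longrightarrow> (\<And>c a. T [c] [a] = R [c] [a]) \<Longrightarrow> T = R"
  and tmats_eqI_2_1: "T \<in> tmats 2 1 \<Longrightarrow> R \<in> tmats 2 1 \<Longrightarrow> (\<And>c a b. T [c] [a, b] = R [c] [a, b]) \<Longrightarrow> T = R"
  and tmats_eqI_0_1: "T \<in> tmats 0 1 \<Longrightarrow> R \<in> tmats 0 1 \<Longrightarrow> (\<And>c. T [c] [] = R [c] []) \<Longrightarrow> T = R"
proof -
  show "T = R" if "T \<in> tmats 1 1" "R \<in> tmats 1 1" "\<And>c a. T [c] [a] = R [c] [a]"
  proof (intro ext)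
    fix i j
    show "T i j = R i j"
    proof (cases "length i = 1 \<and> length j = 1")
      case True
      then show ?thesis using that(3) by (auto simp: length_Suc_conv)
    qed (use tmats_zero[OF that(1)] tmats_zero[OF that(2)] in metis)
  qed
  show "T = R" if "T \<in> tmats 2 1" "R \<in> tmats 2 1" "\<And>c a b. T [c] [a, b] = R [c] [a, b]"
  proof (intro ext)
    fix i j
    show "T i j = R i j"
    proof (cases "length i = 1 \<and> length j = 2")
      case True
      then show ?thesis using that(3) by (auto simp: length_Suc_conv numeral_2_eq_2)
    qed (use tmats_zero[OF that(1)] tmats_zero[OF that(2)] in metis)
  qed
  show "T = R" if "T \<in> tmats 0 1" "R \<in> tmats 0 1" "\<And>c. T [c] [] = R [c] []"
  proof (intro ext)
    fix i j
    show "T i j = R i j"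
    proof (cases "length i = 1 \<and> length j = 0")
      case True
      then show ?thesis using that(3) by (auto simp: length_Suc_conv)
    qed (use tmats_zero[OF that(1)] tmats_zero[OF that(2)] in metis)
  qed
qed

lemma twist_structure_tmats:
  fixes \<sigma> :: "'g::{finite, ab_group_add} \<Rightarrow> 'g \<Rightarrow> complex"
  assumes \<sigma>: "unitary_bicharacter \<sigma>"
  defines rho_def: "\<rho> \<equiv> \<lambda>\<mu> \<nu>. cnj (\<sigma> \<mu> \<nu>)"
  shows "twist_tmat \<rho> (mult_tmat (twisted_cayley \<tau> \<sigma> S)) = mult_tmat (twisted_cayley \<tau> trivial_bicharacter S)"
    and "twist_tmat \<rho> (unit_tmat (twisted_cayley \<tau> \<sigma> S)) = unit_tmat (twisted_cayley \<tau> trivial_bicharacter S)"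
    and "twist_tmat \<rho> (adj_tmat (twisted_cayley \<tau> \<sigma> S)) = adj_tmat (twisted_cayley \<tau> trivial_bicharacter S)"
proof -
  interpret bicharacter \<sigma> by standard fact
  interpret r: bicharacter \<rho>
    unfolding rho_def by standard (rule unitary_bicharacter_cnj[OF \<sigma>])
  interpret one: bicharacter trivial_bicharacter by standard (rule unitary_bicharacter_trivial)
  have r: "\<rho> \<mu> \<nu> = cnj (\<sigma> \<mu> \<nu>)" for \<mu> \<nu> by (simp add: rho_def)
  note entries = r.sigma_multi_Cons sigma_multi_Nil twist_tmat_def trivial_bicharacter_def
  show "twist_tmat \<rho> (mult_tmat (twisted_cayley \<tau> \<sigma> S)) = mult_tmat (twisted_cayley \<tau> trivial_bicharacter S)"
  proof (rule tmats_eqI_2_1)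
    fix c a b
    show "twist_tmat \<rho> (mult_tmat (twisted_cayley \<tau> \<sigma> S)) [c] [a, b] =
        mult_tmat (twisted_cayley \<tau> trivial_bicharacter S) [c] [a, b]"
      by (simp add: entries mult_tmat_twisted one.mult_tmat_twisted) (simp add: r cnj)
  qed (rule twist_tmat_tmats mult_tmat_tmats)+
  show "twist_tmat \<rho> (unit_tmat (twisted_cayley \<tau> \<sigma> S)) = unit_tmat (twisted_cayley \<tau> trivial_bicharacter S)"
  proof (rule tmats_eqI_0_1)
    fix c
    show "twist_tmat \<rho> (unit_tmat (twisted_cayley \<tau> \<sigma> S)) [c] [] =
        unit_tmat (twisted_cayley \<tau> trivial_bicharacter S) [c] []"
      by (simp add: entries unit_tmat_twisted one.unit_tmat_twisted)
  qed (rule twist_tmat_tmats unit_tmat_tmats)+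
  show "twist_tmat \<rho> (adj_tmat (twisted_cayley \<tau> \<sigma> S)) = adj_tmat (twisted_cayley \<tau> trivial_bicharacter S)"
  proof (rule tmats_eqI_1_1)
    fix c a
    show "twist_tmat \<rho> (adj_tmat (twisted_cayley \<tau> \<sigma> S)) [c] [a] =
        adj_tmat (twisted_cayley \<tau> trivial_bicharacter S) [c] [a]"
      by (simp add: entries adj_tmat_twisted one.adj_tmat_twisted)
  qed (rule twist_tmat_tmats adj_tmat_tmats)+
qed

section \<open>The Fourier transform of the automorphism group of a Cayley graph\<close>

context characters
begin

text \<open>
  Characters multiply pointwise and are eigenvectors of the adjacency operator; the orthogonality relations turn this into the
  structure constants in the basis of point masses.
\<close>

lemma conj_structure_tmats:
  fixes S :: "'g set"
  defines "V \<equiv> adjoint_kernel fourier_kernel" and "X \<equiv> twisted_cayley \<tau> trivial_bicharacter S"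
  shows "tm_conj V 2 1 (mult_tmat X) = mult_tmat (cayley S)"
    and "tm_conj V 0 1 (unit_tmat X) = unit_tmat (cayley S)"
    and "tm_conj V 1 1 (adj_tmat X) = adj_tmat (cayley S)"
proof -
  interpret one: bicharacter trivial_bicharacter by standard (rule unitary_bicharacter_trivial)
  let ?r = "of_real (1 / sqrt (real CARD('g))) :: complex"
  have V: "V a \<mu> = ?r * \<tau> \<mu> a" for a \<mu>
    by (simp add: V_def adjoint_kernel_def fourier_kernel_def)
  have cnj_r: "cnj ?r = ?r" by simp
  show "tm_conj V 2 1 (mult_tmat X) = mult_tmat (cayley S)"
  proof (rule tmats_eqI_2_1)
    fix c a b
    let ?t = "\<lambda>j k. (?r * ?r) * (?r * ?r) * ((\<tau> j c * cnj (\<tau> j a)) * (\<tau> k c * cnj (\<tau> k b)))"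
    have "tm_conj V 2 1 (mult_tmat X) [c] [a, b] = (\<Sum>m\<in>UNIV. \<Sum>j\<in>UNIV. \<Sum>k\<in>UNIV.
        if m = j + k then ?t j k else 0)"
      unfolding tm_conj_def sum_lists_1 sum_lists_2 X_def one.mult_tmat_twisted trivial_bicharacter_def
      by (intro sum.cong refl) (auto simp: V index_add cnj_r mult_ac simp del: of_real_divide)
    also have "\<dots> = (\<Sum>j\<in>UNIV. \<Sum>m\<in>UNIV. \<Sum>k\<in>UNIV.
        if m = j + k then ?t j k else 0)"
      by (rule sum.swap)
    also have "\<dots> = (\<Sum>j\<in>UNIV. \<Sum>k\<in>UNIV. \<Sum>m\<in>UNIV.
        if m = j + k then ?t j k else 0)"
      by (rule sum.cong[OF refl], rule sum.swap)
    also have "\<dots> = (\<Sum>j\<in>UNIV. \<Sum>k\<in>UNIV.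
        ?t j k)"
      by (intro sum.cong refl) (simp del: of_real_divide)
    also have "\<dots> = (?r * ?r) * (?r * ?r) *
        ((\<Sum>j\<in>UNIV. \<tau> j c * cnj (\<tau> j a)) * (\<Sum>k\<in>UNIV. \<tau> k c * cnj (\<tau> k b)))"
      by (subst sum_product) (simp only: sum_distrib_left)
    also have "\<dots> = mult_tmat (cayley S) [c] [a, b]"
      unfolding sqrt_card_square dual_orthogonality mult_tmat_cayley by simp
    finally show "tm_conj V 2 1 (mult_tmat X) [c] [a, b] = mult_tmat (cayley S) [c] [a, b]" .
  qed (rule tm_conj_tmats mult_tmat_tmats)+
  show "tm_conj V 0 1 (unit_tmat X) = unit_tmat (cayley S)"
  proof (rule tmats_eqI_0_1)
    fix c
    have "tm_conj V 0 1 (unit_tmat X) [c] [] = (\<Sum>(m :: 'g)\<in>UNIV. if m = 0 then of_real (sqrt (real CARD('g))) * ?r else 0)"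
      unfolding tm_conj_def sum_lists_1 sum_lists_0 X_def one.unit_tmat_twisted
      by (intro sum.cong refl) (auto simp: V mult_ac simp del: of_real_divide)
    then show "tm_conj V 0 1 (unit_tmat X) [c] [] = unit_tmat (cayley S) [c] []"
      unfolding one.sqrt_card by (simp add: unit_tmat_cayley)
  qed (rule tm_conj_tmats unit_tmat_tmats)+
  show "tm_conj V 1 1 (adj_tmat X) = adj_tmat (cayley S)"
  proof (rule tmats_eqI_1_1)
    fix c a
    have inner: "(\<Sum>m\<in>UNIV. ?r * ?r * \<tau> m \<alpha>) = (if \<alpha> = 0 then 1 else 0)" for \<alpha>
      unfolding sum_distrib_left[symmetric] dual_sum_character sqrt_card_square by simp
    have "tm_conj V 1 1 (adj_tmat X) [c] [a] = (\<Sum>m\<in>UNIV. \<Sum>j\<in>UNIV.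
        if j = m then (\<Sum>\<theta>\<in>S. ?r * ?r * \<tau> m (c - a - \<theta>)) else 0)"
      unfolding tm_conj_def sum_lists_1 X_def one.adj_tmat_twisted cayley_eigenvalue_def
      by (intro sum.cong refl)
        (auto simp: V cnj_r diff cnj minus sum_distrib_left sum_distrib_right sum_divide_distrib mult_ac simp del: of_real_divide)
    also have "\<dots> = (\<Sum>m\<in>UNIV. \<Sum>\<theta>\<in>S. ?r * ?r * \<tau> m (c - a - \<theta>))"
      by simp
    also have "\<dots> = (\<Sum>\<theta>\<in>S. \<Sum>m\<in>UNIV. ?r * ?r * \<tau> m (c - a - \<theta>))"
      by (rule sum.swap)
    also have "\<dots> = (\<Sum>\<theta>\<in>S. if \<theta> = c - a then 1 else 0)"
      by (intro sum.cong refl) (auto simp: inner simp del: of_real_divide)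
    also have "\<dots> = adj_tmat (cayley S) [c] [a]"
      by (simp add: adj_tmat_cayley)
    finally show "tm_conj V 1 1 (adj_tmat X) [c] [a] = adj_tmat (cayley S) [c] [a]" .
  qed (rule tm_conj_tmats adj_tmat_tmats)+
qed

lemma quantum_aut_cayley_relations: "aut_relations (cayley S) \<subseteq> quantum_aut (cayley S)"
  by (auto simp: quantum_aut_def star_ideal_generated_def)

text \<open>
  Both sides are least ideals for their relations. One inclusion checks the relations of the trivially twisted graph after the
  change of basis, the other one checks those of the classical graph after the inverse change.
\<close>

lemma change_basis_quantum_aut_cayley:
  "change_basis (fourier_matrix \<tau>) (quantum_aut (cayley S)) = quantum_aut (twisted_cayley \<tau> trivial_bicharacter S)"
proof -
  let ?W = "fourier_kernel" and ?V = "adjoint_kernel fourier_kernel"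
  let ?C = "quantum_aut (cayley S)" and ?X = "twisted_cayley \<tau> trivial_bicharacter S"
  let ?K = "quantum_aut ?X"
  note W = unitary_fourier_kernel and V = unitary_adjoint[OF unitary_fourier_kernel]
  interpret one: bicharacter trivial_bicharacter by standard (rule unitary_bicharacter_trivial)
  interpret C: fsa_ideal ?C by (rule fsa_ideal_quantum_aut)
  interpret K: twisted_ideal trivial_bicharacter ?K "cayley_eigenvalue \<tau> S"
    by (rule twisted_ideal_quantum_aut[OF unitary_bicharacter_trivial])
  have C: "unitary_modulo ?C fund" "fund i j - fund_st i j \<in> ?C"
    "mult_tmat (cayley S) \<in> intertwiners ?C 2 1" "adj_tmat (cayley S) \<in> intertwiners ?C 1 1" for i j
    using quantum_aut_cayley_relations[of S] unfolding aut_relations_subset_iff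
    by (simp_all add: star_matrix_cayley if_zero)
  have K: "unitary_modulo ?K fund" "mult_tmat ?X \<in> intertwiners ?K 2 1" "adj_tmat ?X \<in> intertwiners ?K 1 1"
  proof -
    have "aut_relations ?X \<subseteq> ?K" by (auto simp: quantum_aut_def star_ideal_generated_def)
    then show "unitary_modulo ?K fund" "mult_tmat ?X \<in> intertwiners ?K 2 1" "adj_tmat ?X \<in> intertwiners ?K 1 1"
      unfolding aut_relations_subset_iff by simp_all
  qed
  have "aut_relations ?X \<subseteq> {p. conj_hom ?W p \<in> ?C}"
    unfolding aut_relations_subset_iff
  proof (intro conjI allI)
    show "unitary_modulo {p. conj_hom ?W p \<in> ?C} fund"
      by (rule conj_hom_unitary_modulo[OF W C.fsa_ideal_axioms C(1)])
    show "mult_tmat ?X \<in> intertwiners {p. conj_hom ?W p \<in> ?C} 2 1"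
      by (rule conj_hom_intertwinerI[OF W C.fsa_ideal_axioms mult_tmat_tmats])
        (unfold conj_structure_tmats, rule C(3))
    show "adj_tmat ?X \<in> intertwiners {p. conj_hom ?W p \<in> ?C} 1 1"
      by (rule conj_hom_intertwinerI[OF W C.fsa_ideal_axioms adj_tmat_tmats])
        (unfold conj_structure_tmats, rule C(4))
    fix i j
    have eq: "i = - k \<longleftrightarrow> k = - i" for i k :: 'g by auto
    have kernel: "?W i a * cnj (?W (- j) b) = cnj (?W (- i) a) * ?W j b" for a b
      by (simp add: fourier_kernel_def simps)
    have "conj_hom ?W (fund i (- j) - fund_st (- i) j) =
        (\<Sum>a\<in>UNIV. \<Sum>b\<in>UNIV. scal (?W i a * cnj (?W (- j) b)) * (fund a b - fund_st a b))"
      by (simp add: conj_hom_minus conj_hom_fund conj_hom_fund_st kernel right_diff_distrib sum_subtractf)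
    also have "\<dots> \<in> ?C"
      by (intro C.sum_mem C.left_mem C(2))
    finally show "(\<Sum>k\<in>UNIV. scal (star_matrix ?X k j) * fund i k) -
        (\<Sum>k\<in>UNIV. scal (star_matrix ?X i k) * fund_st k j) \<in> {p. conj_hom ?W p \<in> ?C}"
      by (simp add: one.star_matrix_twisted trivial_bicharacter_def eq[of i] if_zero)
  qed
  then have 1: "?K \<subseteq> {p. conj_hom ?W p \<in> ?C}"
    using quantum_aut_subset_iff C.star_ideal_conj_hom_preimage by blast
  have "aut_relations (cayley S) \<subseteq> {p. conj_hom ?V p \<in> ?K}"
    unfolding aut_relations_subset_iff
  proof (intro conjI allI)
    show "unitary_modulo {p. conj_hom ?V p \<in> ?K} fund"
      by (rule conj_hom_unitary_modulo[OF V K.fsa_ideal_axioms K(1)])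
    show "mult_tmat (cayley S) \<in> intertwiners {p. conj_hom ?V p \<in> ?K} 2 1"
      by (rule conj_hom_intertwinerI[OF V K.fsa_ideal_axioms mult_tmat_tmats])
        (simp only: adjoint_adjoint conj_structure_tmats(1)[symmetric] tm_conj_inverse[OF W] K mult_tmat_tmats)
    show "adj_tmat (cayley S) \<in> intertwiners {p. conj_hom ?V p \<in> ?K} 1 1"
      by (rule conj_hom_intertwinerI[OF V K.fsa_ideal_axioms adj_tmat_tmats])
        (simp only: adjoint_adjoint conj_structure_tmats(3)[symmetric] tm_conj_inverse[OF W] K adj_tmat_tmats)
    fix i j
    have "K.eqv (conj_hom ?V (fund_st i j))
        (\<Sum>a\<in>UNIV. \<Sum>b\<in>UNIV. scal (cnj (?V i a) * ?V j b) * (scal (trivial_bicharacter a a * cnj (trivial_bicharacter b b)) * fund (- a) (- b)))"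
      unfolding conj_hom_fund_st by (intro K.eqv_sum K.eqv_mult_left K.fund_st_eqv)
    also have "\<dots> = (\<Sum>a\<in>UNIV. \<Sum>b\<in>UNIV. scal (?V i (- a) * cnj (?V j (- b))) * fund (- a) (- b))"
      by (simp add: adjoint_kernel_def fourier_kernel_def simps trivial_bicharacter_def)
    also have "\<dots> = (\<Sum>a\<in>UNIV. \<Sum>b\<in>UNIV. scal (?V i (- a) * cnj (?V j b)) * fund (- a) b)"
      by (rule sum.cong[OF refl], rule sum_group_shift)
    also have "\<dots> = (\<Sum>a\<in>UNIV. \<Sum>b\<in>UNIV. scal (?V i a * cnj (?V j b)) * fund a b)"
      by (rule sum_group_shift)
    also have "\<dots> = conj_hom ?V (fund i j)"
      by (simp add: conj_hom_fund)
    finally have "conj_hom ?V (fund i j) - conj_hom ?V (fund_st i j) \<in> ?K"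
      using K.eqv_sym by (simp add: K.eqv_def)
    then show "(\<Sum>k\<in>UNIV. scal (star_matrix (cayley S) k j) * fund i k) -
        (\<Sum>k\<in>UNIV. scal (star_matrix (cayley S) i k) * fund_st k j) \<in> {p. conj_hom ?V p \<in> ?K}"
      by (simp add: star_matrix_cayley if_zero conj_hom_minus)
  qed
  then have 2: "?C \<subseteq> {p. conj_hom ?V p \<in> ?K}"
    using quantum_aut_subset_iff K.star_ideal_conj_hom_preimage by blast
  have "p \<in> ?K" if "conj_hom ?W p \<in> ?C" for p
    using 2 that conj_hom_inverse[OF W, of p] by auto
  then show ?thesis
    using 1 by (auto simp: change_basis_fourier)
qed

end

section \<open>Translations and the degree of an intertwiner\<close>

lemma evaluation_fund_power:
  assumes "length p = length j" "ch 0 = 1" "\<And>\<mu> \<nu>. ch (\<mu> + \<nu>) = ch \<mu> * ch \<nu>"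
  shows "evaluation ch (fund_power p j) = (if p = j then ch (sum_list j) else 0)"
  using assms(1) by (induction p j rule: list_induct2) (auto simp: evaluation_simps assms)

text \<open>
  The value of the \<open>(i, j)\<close> defect at the translation by \<open>\<alpha>\<close> is \<open>T i j\<close> times the difference of the characters \<open>\<tau>\<close> of index \<open>|j|\<close> and \<open>|i|\<close> at \<open>\<alpha>\<close>,
  and distinct characters differ at some \<open>\<alpha>\<close>.
\<close>

lemma intertwiner_degree:
  fixes \<tau> :: "'g::{finite, ab_group_add} \<Rightarrow> 'g \<Rightarrow> complex"
  assumes \<tau>: "character_listing \<tau>" and \<sigma>: "unitary_bicharacter \<sigma>"
    and T: "T \<in> intertwiners (quantum_aut (twisted_cayley \<tau> \<sigma> S)) k l" and T_nz: "T i j \<noteq> 0"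
  shows "sum_list i = sum_list j"
proof -
  interpret t: characters \<tau> by standard fact
  interpret twisted_ideal \<sigma> "quantum_aut (twisted_cayley \<tau> \<sigma> S)" "cayley_eigenvalue \<tau> S"
    by (rule twisted_ideal_quantum_aut[OF \<sigma>])
  have i: "length i = l" and j: "length j = k"
    using T T_nz unfolding intertwiners_eq tmats_def by blast+
  have "\<tau> (sum_list i) \<alpha> = \<tau> (sum_list j) \<alpha>" for \<alpha>
  proof -
    let ?ch = "\<lambda>\<mu>. \<tau> \<mu> \<alpha>"
    have "evaluation ?ch (intertwining_defect k l T i j) = 0"
      using T i j by (intro evaluation_vanishes t.index_add t.norm) (simp add: intertwiners_eq)
    moreover have "evaluation ?ch (fund_power p j) = (if p = j then ?ch (sum_list j) else 0)" if "length p = k" for p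
      using that j by (intro evaluation_fund_power t.index_add) simp_all
    moreover have "evaluation ?ch (fund_power i q) = (if q = i then ?ch (sum_list i) else 0)" if "length q = l" for q
      using that i evaluation_fund_power[of i q ?ch] t.index_add by (auto simp: eq_commute)
    ultimately have "T i j * ?ch (sum_list j) - T i j * ?ch (sum_list i) = 0"
      using i j by (simp add: intertwining_defect_def evaluation_simps if_zero)
    then show ?thesis using T_nz by simp
  qed
  then show ?thesis using t.inj by blast
qed

lemma unit_tmat_intertwiner:
  assumes \<sigma>: "unitary_bicharacter \<sigma>"
  shows "unit_tmat (twisted_cayley \<tau> \<sigma> S) \<in> intertwiners (quantum_aut (twisted_cayley \<tau> \<sigma> S)) 0 1"
proof -
  interpret twisted_ideal \<sigma> "quantum_aut (twisted_cayley \<tau> \<sigma> S)" "cayley_eigenvalue \<tau> S"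
    by (rule twisted_ideal_quantum_aut[OF \<sigma>])
  let ?s = "of_real (sqrt (real CARD('a))) :: complex"
  have mem: "scal (if i = 0 then ?s else 0) - scal ?s * fund i 0 \<in> quantum_aut (twisted_cayley \<tau> \<sigma> S)" for i
  proof -
    have "scal (if i = 0 then ?s else 0) - scal ?s * fund i 0 = scal ?s * (scal (if i = 0 then 1 else 0) - fund i 0)"
      by (simp add: right_diff_distrib)
    then show ?thesis
      using eqv_sym[OF fund_unit[of i]] left_mem by (simp add: eqv_def)
  qed
  have sum: "(\<Sum>c\<in>UNIV. scal (unit_tmat (twisted_cayley \<tau> \<sigma> S) [c] []) * fund i c) = scal ?s * fund i 0" for i
    by (simp add: unit_tmat_twisted if_zero)
  show ?thesis
    unfolding intertwiners_0_1 sum unfolding unit_tmat_twisted using mem unit_tmat_tmats by blast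
qed

section \<open>The quantum isomorphism and the cocycle twist\<close>

theorem theorem5p11:
  fixes \<tau> :: "'g::{finite, ab_group_add} \<Rightarrow> 'g \<Rightarrow> complex"
    and \<sigma> :: "'g \<Rightarrow> 'g \<Rightarrow> complex"
    and S :: "'g set"
  assumes "character_listing \<tau>"
    and "unitary_bicharacter \<sigma>"
  shows "quantum_isomorphic (twisted_cayley \<tau> \<sigma> S) (cayley S) \<and>
    is_cocycle_twist \<tau> \<sigma> (quantum_aut (cayley S)) (quantum_aut (twisted_cayley \<tau> \<sigma> S))"
proof
  interpret t: characters \<tau> by standard fact
  interpret bicharacter \<sigma> by standard fact
  let ?\<rho> = "\<lambda>\<mu> \<nu>. cnj (\<sigma> \<mu> \<nu>)" and ?V = "adjoint_kernel t.fourier_kernel"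
  interpret r: bicharacter ?\<rho> by standard (rule unitary_bicharacter_cnj[OF assms(2)])
  let ?X = "twisted_cayley \<tau> \<sigma> S" and ?X1 = "twisted_cayley \<tau> trivial_bicharacter S"
  let ?K = "quantum_aut ?X" and ?K1 = "quantum_aut ?X1" and ?C = "quantum_aut (cayley S)"
  interpret K: twisted_ideal \<sigma> ?K "cayley_eigenvalue \<tau> S"
    by (rule twisted_ideal_quantum_aut[OF assms(2)])
  note W = t.unitary_fourier_kernel and V = unitary_adjoint[OF t.unitary_fourier_kernel]
  \<comment> \<open>Remove the phases first, then pass to the basis of point masses.\<close>
  define \<Phi> where Phi_def: "\<Phi> k l T = tm_conj ?V k l (twist_tmat ?\<rho> T)" for k l T
  have twist: "intertwiners ?K k l = twist_tmat \<sigma> ` intertwiners ?K1 k l" for k l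
    by (rule intertwiners_twisted[OF assms(2)])
  have conj: "T \<in> intertwiners ?K1 k l \<longleftrightarrow> tm_conj ?V k l T \<in> intertwiners ?C k l" if "T \<in> tmats k l" for T k l
    using conj_hom_intertwiner_iff[OF W fsa_ideal_quantum_aut that]
    by (simp add: t.change_basis_quantum_aut_cayley[symmetric] t.change_basis_fourier)
  show "is_cocycle_twist \<tau> \<sigma> ?C ?K"
    unfolding is_cocycle_twist_def t.change_basis_quantum_aut_cayley using K.is_cmqg twist by blast
  have relations: "mult_tmat ?X \<in> intertwiners ?K 2 1" "adj_tmat ?X \<in> intertwiners ?K 1 1"
  proof -
    have "aut_relations ?X \<subseteq> ?K" by (auto simp: quantum_aut_def star_ideal_generated_def)
    then show "mult_tmat ?X \<in> intertwiners ?K 2 1" "adj_tmat ?X \<in> intertwiners ?K 1 1"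
      unfolding aut_relations_subset_iff by simp_all
  qed
  have bij: "bij_betw (\<Phi> k l) (intertwiners ?K k l) (intertwiners ?C k l)" for k l
  proof (rule bij_betw_byWitness[where f' = "\<lambda>R. twist_tmat \<sigma> (tm_conj t.fourier_kernel k l R)"])
    have tmats: "T \<in> tmats k l" if "T \<in> intertwiners I k l" for T and I :: "'g fsa set"
      using that by (simp add: intertwiners_eq)
    show "\<forall>T\<in>intertwiners ?K k l. twist_tmat \<sigma> (tm_conj t.fourier_kernel k l (\<Phi> k l T)) = T"
      using tm_conj_inverse[OF W twist_tmat_tmats[OF tmats]] twist_tmat_cnj(1)[OF assms(2)]
      by (simp add: Phi_def)
    show "\<forall>R\<in>intertwiners ?C k l. \<Phi> k l (twist_tmat \<sigma> (tm_conj t.fourier_kernel k l R)) = R"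
      using tm_conj_inverse[OF V tmats] twist_tmat_cnj(2)[OF assms(2)]
      by (simp add: Phi_def)
    show "\<Phi> k l ` intertwiners ?K k l \<subseteq> intertwiners ?C k l"
    proof
      fix R assume "R \<in> \<Phi> k l ` intertwiners ?K k l"
      then obtain T where T: "T \<in> intertwiners ?K1 k l" and R: "R = \<Phi> k l (twist_tmat \<sigma> T)"
        unfolding twist by blast
      have "R = tm_conj ?V k l T"
        using R twist_tmat_cnj(2)[OF assms(2)] by (simp add: Phi_def)
      then show "R \<in> intertwiners ?C k l"
        using conj[OF tmats[OF T]] T by blast
    qed
    show "(\<lambda>R. twist_tmat \<sigma> (tm_conj t.fourier_kernel k l R)) ` intertwiners ?C k l \<subseteq> intertwiners ?K k l"
    proof clarify
      fix R assume R: "R \<in> intertwiners ?C k l"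
      have "tm_conj t.fourier_kernel k l R \<in> intertwiners ?K1 k l"
        using R tm_conj_inverse[OF V tmats[OF R]] by (subst conj[OF tm_conj_tmats]) simp
      then show "twist_tmat \<sigma> (tm_conj t.fourier_kernel k l R) \<in> intertwiners ?K k l"
        unfolding twist by blast
    qed
  qed
  have "monoidal_dagger_iso ?K ?C \<Phi>"
    unfolding monoidal_dagger_iso_def
  proof (intro conjI allI ballI bij)
    fix k l k' l' m c T R
    show "\<Phi> k k (tm_id k) = tm_id k"
      by (simp add: Phi_def r.twist_tmat_id tm_conj_id[OF V])
    show "\<Phi> k l (\<lambda>i j. c * T i j + R i j) = (\<lambda>i j. c * \<Phi> k l T i j + \<Phi> k l R i j)"
      by (simp add: Phi_def r.twist_tmat_linear tm_conj_linear)
    show "\<Phi> k l (tm_comp m T R) = tm_comp m (\<Phi> m l T) (\<Phi> k m R)"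
      by (simp add: Phi_def r.twist_tmat_comp tm_conj_comp[OF V])
    show "\<Phi> l k (tm_dagger T) = tm_dagger (\<Phi> k l T)"
      by (simp add: Phi_def r.twist_tmat_dagger tm_conj_dagger)
    assume "T \<in> intertwiners ?K k l" "R \<in> intertwiners ?K k' l'"
    then show "\<Phi> (k + k') (l + l') (tm_tensor k l T R) = tm_tensor k l (\<Phi> k l T) (\<Phi> k' l' R)"
      unfolding Phi_def
      by (subst r.twist_tmat_tensor) (auto intro: intertwiner_degree[OF assms] simp: tm_conj_tensor)
  qed
  moreover have "\<Phi> 1 1 (adj_tmat ?X) = adj_tmat (cayley S)" "\<Phi> 2 1 (mult_tmat ?X) = mult_tmat (cayley S)"
    "\<Phi> 0 1 (unit_tmat ?X) = unit_tmat (cayley S)"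
    unfolding Phi_def twist_structure_tmats[OF assms(2)] t.conj_structure_tmats by (rule refl)+
  ultimately show "quantum_isomorphic ?X (cayley S)"
    unfolding quantum_isomorphic_def
    using relations unit_tmat_intertwiner[OF assms(2)] is_quantum_graph_twisted[OF assms] is_quantum_graph_cayley
    by blast
qed

end
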